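(* Let $q\in Q$ and let $u\in W^{2,p}(B)$ be such that $(\Delta +q)u=0$ in $B$ and $u$ vanishes of infinite order at $0$. Then $u=0$ in $B_{1/4}$.
   Context: Let $n\ge 3$ be an integer, $p:=\frac{2n}{n+2}$, $p':=\frac{2n}{n-2}$. $B_r\subset\mathbb{R}^n$ is the open ball centered at $0$ with radius $r>0$, $B:=B_1$, $\dot B:=B\setminus\{0\}$; $\mathbb{N}$ is the set of positive integers. Let $\mathbf{B}_r$ be the closed ball of $L^{n/2}(B)$ centered at $0$ with radius $r>0$. A function $w\in L^2(B)$ vanishes of infinite order at $0$ if there exists $0<\gamma<1$ such that for every integer $m>0$ there is a constant $c_m>0$ with $r^{-m}\int_{B_r}|w|^2dx\le c_m$ for all $0<r<\gamma$. (Note $W^{2,p}(B)\subset L^2(B)$.) $\Lambda:=\{\lambda>0:\ \mathrm{dist}(\lambda,\mathbb{N}+\frac{n-2}{2})=\frac12\}$. $r_\ast=r_\ast(n)>0$ is a constant (such a constant exists) with the property that for every $0<r_0<r_\ast$ there is $\kappa_0=\kappa_0(n,r_0)>0$ such that $\||x|^{-\lambda}u\|_{L^{p'}(B)}\le \kappa_0\||x|^{-\lambda}(\Delta+q)u\|_{L^p(B)}$ for all $u\in C_0^\infty(\dot B)$, $q\in\mathbf{B}_{r_0}$, $\lambda\in\Lambda$. $\sigma:=\sup\{\|w\|_{L^{p'}(B)}:\ w\in H_0^1(B),\ \|\nabla w\|_{L^2(B)}=1\}$. Fix $0<r_0<r_\ast$ and $\vartheta>0$ with $2\vartheta\sigma^2<1$;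 set $\varsigma:=\inf(r_0,\vartheta)$ and $Q:=\mathbf{B}_\varsigma$. *)

theory Defs
  imports "HOL-Analysis.Analysis"
begin

section \<open>Lebesgue spaces\<close>

text \<open>Functions on a domain \<open>\<Omega>\<close> are represented by total functions whose values outside
  \<open>\<Omega>\<close> are irrelevant. They take values in a type of class \<open>real_normed_field\<close> and
  \<open>euclidean_space\<close>, so that real- and complex-valued functions are treated at once.
  Norms are extended nonnegative reals, hence meaningful without integrability
  assumptions.\<close>

definition Lp_norm :: "real \<Rightarrow> 'a::euclidean_space set \<Rightarrow> ('a \<Rightarrow> 'b::real_normed_vector) \<Rightarrow> ennreal"
  where "Lp_norm p \<Omega> f =
    (let I = (\<integral>\<^sup>+ x. ennreal (norm (f x) powr p) \<partial>lebesgue_on \<Omega>)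
     in if I = \<infinity> then \<infinity> else ennreal (enn2real I powr (1 / p)))"

definition Lp :: "real \<Rightarrow> 'a::euclidean_space set \<Rightarrow> ('a \<Rightarrow> 'b::real_normed_vector) set"
  where "Lp p \<Omega> = {f \<in> borel_measurable (lebesgue_on \<Omega>). Lp_norm p \<Omega> f < \<infinity>}"

definition Lp_cball :: "real \<Rightarrow> 'a::euclidean_space set \<Rightarrow> real \<Rightarrow> ('a \<Rightarrow> 'b::real_normed_vector) set"
  where "Lp_cball p \<Omega> r = {f \<in> Lp p \<Omega>. Lp_norm p \<Omega> f \<le> ennreal r}"

definition locally_integrable :: "'a::euclidean_space set \<Rightarrow> ('a \<Rightarrow> 'b::euclidean_space) \<Rightarrow> bool"
  where "locally_integrable \<Omega> f \<longleftrightarrow>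
    (\<forall>K. compact K \<longrightarrow> K \<subseteq> \<Omega> \<longrightarrow> set_integrable lebesgue K f)"

section \<open>Smooth functions with compact support\<close>

definition partial :: "'n::finite \<Rightarrow> (real^'n \<Rightarrow> 'b::real_normed_vector) \<Rightarrow> real^'n \<Rightarrow> 'b"
  where "partial i f x = frechet_derivative f (at x) (axis i 1)"

definition laplacian :: "(real^'n::finite \<Rightarrow> 'b::real_normed_vector) \<Rightarrow> real^'n \<Rightarrow> 'b"
  where "laplacian f x = (\<Sum>i\<in>UNIV. partial i (partial i f) x)"

primrec C_k :: "nat \<Rightarrow> (real^'n::finite \<Rightarrow> 'b::real_normed_vector) \<Rightarrow> bool"
  where
    "C_k 0 f \<longleftrightarrow> continuous_on UNIV f"
  | "C_k (Suc k) f \<longleftrightarrow> (\<forall>x. f differentiable at x) \<and> (\<forall>i. C_k k (partial i f))"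

text \<open>\<open>C\<^sub>0\<^sup>\<infinity>(\<Omega>)\<close>, with its elements extended by zero to the whole space.\<close>

definition test_functions :: "(real^'n::finite) set \<Rightarrow> (real^'n \<Rightarrow> 'b::real_normed_vector) set"
  where "test_functions \<Omega> =
    {f. (\<forall>k. C_k k f) \<and> (\<exists>K. compact K \<and> K \<subseteq> \<Omega> \<and> (\<forall>x. x \<notin> K \<longrightarrow> f x = 0))}"

section \<open>Weak derivatives and Sobolev spaces\<close>

definition has_weak_partial ::
    "(real^'n::finite) set \<Rightarrow> 'n \<Rightarrow> (real^'n \<Rightarrow> 'b::euclidean_space) \<Rightarrow> (real^'n \<Rightarrow> 'b) \<Rightarrow> bool"
  where "has_weak_partial \<Omega> i u g \<longleftrightarrow>
    locally_integrable \<Omega> u \<and> locally_integrable \<Omega> g \<and>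
    (\<forall>\<phi> :: real^'n \<Rightarrow> real. \<phi> \<in> test_functions \<Omega> \<longrightarrow>
      (\<integral>x. partial i \<phi> x *\<^sub>R u x \<partial>lebesgue_on \<Omega>) = - (\<integral>x. \<phi> x *\<^sub>R g x \<partial>lebesgue_on \<Omega>))"

text \<open>A representative of the weak derivative, which is unique almost everywhere in an open \<open>\<Omega>\<close>;
  the value is unspecified if no weak derivative exists.\<close>

definition weak_partial ::
    "(real^'n::finite) set \<Rightarrow> 'n \<Rightarrow> (real^'n \<Rightarrow> 'b::euclidean_space) \<Rightarrow> real^'n \<Rightarrow> 'b"
  where "weak_partial \<Omega> i u = (SOME g. has_weak_partial \<Omega> i u g)"

definition weak_grad ::
    "(real^'n::finite) set \<Rightarrow> (real^'n \<Rightarrow> 'b::euclidean_space) \<Rightarrow> real^'n \<Rightarrow> 'b^'n"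
  where "weak_grad \<Omega> u x = (\<chi> i. weak_partial \<Omega> i u x)"

definition weak_laplacian ::
    "(real^'n::finite) set \<Rightarrow> (real^'n \<Rightarrow> 'b::euclidean_space) \<Rightarrow> real^'n \<Rightarrow> 'b"
  where "weak_laplacian \<Omega> u x = (\<Sum>i\<in>UNIV. weak_partial \<Omega> i (weak_partial \<Omega> i u) x)"

text \<open>\<open>W\<^sup>k\<^sup>,\<^sup>p(\<Omega>)\<close>.\<close>

primrec sobolev ::
    "nat \<Rightarrow> real \<Rightarrow> (real^'n::finite) set \<Rightarrow> (real^'n \<Rightarrow> 'b::euclidean_space) set"
  where
    "sobolev 0 p \<Omega> = Lp p \<Omega>"
  | "sobolev (Suc k) p \<Omega> =
      {u \<in> Lp p \<Omega>. \<forall>i. \<exists>g \<in> sobolev k p \<Omega>. has_weak_partial \<Omega> i u g}"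

text \<open>\<open>H\<^sub>0\<^sup>1(\<Omega>)\<close>: the closure of \<open>C\<^sub>0\<^sup>\<infinity>(\<Omega>)\<close> in \<open>W\<^sup>1\<^sup>,\<^sup>2(\<Omega>)\<close>.\<close>

definition H01 :: "(real^'n::finite) set \<Rightarrow> (real^'n \<Rightarrow> 'b::euclidean_space) set"
  where "H01 \<Omega> = {w \<in> sobolev 1 2 \<Omega>.
    \<exists>\<phi>. (\<forall>k::nat. \<phi> k \<in> test_functions \<Omega>) \<and>
      (\<lambda>k. Lp_norm 2 \<Omega> (\<lambda>x. \<phi> k x - w x)) \<longlonglongrightarrow> 0 \<and>
      (\<lambda>k. Lp_norm 2 \<Omega> (weak_grad \<Omega> (\<lambda>x. \<phi> k x - w x))) \<longlonglongrightarrow> 0}"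

section \<open>The setting on the unit ball\<close>

abbreviation (input) unit_ball :: "(real^'n::finite) set"
  where "unit_ball \<equiv> ball 0 1"

definition exp_p :: "nat \<Rightarrow> real"
  where "exp_p n = 2 * real n / (real n + 2)"

definition exp_p' :: "nat \<Rightarrow> real"
  where "exp_p' n = 2 * real n / (real n - 2)"

text \<open>By the Sobolev embedding \<open>W\<^sup>2\<^sup>,\<^sup>p(B) \<subseteq> L\<^sup>2(B)\<close>, so square integrability
  on \<open>B\<close> is not part of the definition.\<close>

definition vanishes_of_infinite_order :: "(real^'n::finite \<Rightarrow> 'b::real_normed_vector) \<Rightarrow> bool"
  where "vanishes_of_infinite_order w \<longleftrightarrow>
    (\<exists>\<gamma>. 0 < \<gamma> \<and> \<gamma> < 1 \<and>
      (\<forall>m::nat. m > 0 \<longrightarrow> (\<exists>c>0. \<forall>r. 0 < r \<and> r < \<gamma> \<longrightarrow>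
        ennreal (1 / r ^ m) * (\<integral>\<^sup>+ x. ennreal ((norm (w x))\<^sup>2) \<partial>lebesgue_on (ball 0 r)) \<le> ennreal c)))"

definition Lambda :: "nat \<Rightarrow> real set"
  where "Lambda n = {l. l > 0 \<and>
    infdist l {real k + (real n - 2) / 2 | k::nat. k > 0} = 1 / 2}"

text \<open>The Carleman inequality with constant \<open>\<kappa>\<close>, uniform over potentials in the closed ball of
  radius \<open>r\<^sub>0\<close> of \<open>L\<^sup>n\<^sup>/\<^sup>2(B)\<close> and over \<open>\<Lambda>\<close>. The first argument fixes dimension and scalars.\<close>

definition carleman_inequality ::
    "(real^'n::finite \<Rightarrow> 'b::{real_normed_field,euclidean_space}) itself \<Rightarrow> real \<Rightarrow> real \<Rightarrow> bool"
  where "carleman_inequality T r\<^sub>0 \<kappa> \<longleftrightarrow>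
    (\<forall>u :: real^'n \<Rightarrow> 'b. \<forall>q :: real^'n \<Rightarrow> 'b. \<forall>l.
      u \<in> test_functions (unit_ball - {0}) \<longrightarrow>
      q \<in> Lp_cball (real CARD('n) / 2) unit_ball r\<^sub>0 \<longrightarrow>
      l \<in> Lambda CARD('n) \<longrightarrow>
      Lp_norm (exp_p' CARD('n)) unit_ball (\<lambda>x. (norm x powr (- l)) *\<^sub>R u x)
      \<le> ennreal \<kappa> * Lp_norm (exp_p CARD('n)) unit_ball
          (\<lambda>x. (norm x powr (- l)) *\<^sub>R (laplacian u x + q x * u x)))"

text \<open>The defining property of the threshold \<open>r\<^sub>*\<close>.\<close>

definition carleman_threshold ::
    "(real^'n::finite \<Rightarrow> 'b::{real_normed_field,euclidean_space}) itself \<Rightarrow> real \<Rightarrow> bool"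
  where "carleman_threshold T r \<longleftrightarrow>
    r > 0 \<and> (\<forall>r\<^sub>0. 0 < r\<^sub>0 \<and> r\<^sub>0 < r \<longrightarrow> (\<exists>\<kappa>>0. carleman_inequality T r\<^sub>0 \<kappa>))"

text \<open>The constant \<open>\<sigma>\<close> of the embedding of \<open>H\<^sub>0\<^sup>1(B)\<close> into \<open>L\<^sup>p\<^sup>'(B)\<close>. The supremum is taken in
  the extended nonnegative reals.\<close>

definition sobolev_const ::
    "(real^'n::finite \<Rightarrow> 'b::{real_normed_field,euclidean_space}) itself \<Rightarrow> ennreal"
  where "sobolev_const T =
    (SUP w \<in> {w :: real^'n \<Rightarrow> 'b. w \<in> H01 unit_ball \<and> Lp_norm 2 unit_ball (weak_grad unit_ball w) = 1}.
       Lp_norm (exp_p' CARD('n)) unit_ball w)"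

end

theory Submission
  imports Defs "HOL-Real_Asymp.Real_Asymp"
begin

text \<open>The solution \<open>u\<close> is cut off by \<open>\<zeta>(x) = A(x) - A(x / \<epsilon>)\<close>, where \<open>A\<close> equals \<open>1\<close> on the ball of
  radius \<open>1/2\<close>, and the Carleman inequality is applied to \<open>\<zeta> u\<close>. Since \<open>u\<close> solves the equation,
  \<open>(\<Delta> + q) (\<zeta> u)\<close> is the commutator \<open>[\<Delta>, \<zeta>] u\<close>. Its part at scale \<open>\<epsilon>\<close> disappears as \<open>\<epsilon> \<rightarrow> 0\<close> for a
  fixed weight exponent \<open>\<lambda>\<close>, because \<open>u\<close> and \<open>\<nabla>u\<close> vanish to infinite order in \<open>L\<^sup>p\<close>; its part in
  \<open>|x| \<ge> 1/2\<close> contributes at most a multiple of \<open>2\<^sup>\<lambda>\<close>, while the left hand side is at least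
  \<open>4\<^sup>\<lambda>\<close> times the norm of \<open>u\<close> on the ball of radius \<open>1/4\<close>. Now \<open>\<lambda> \<rightarrow> \<infinity>\<close>.

  No Caccioppoli or Sobolev inequality is involved: that \<open>\<nabla>u\<close> vanishes to infinite order follows by
  interpolation between \<open>u\<close> and its second derivatives,
  \<open>|\<partial>\<^sub>i u(x)| \<le> (|u(x + t e\<^sub>i)| + |u(x)|) / t + \<integral>\<^sub>0\<^sup>t |\<partial>\<^sub>i\<partial>\<^sub>i u(x + s e\<^sub>i)| ds\<close> with \<open>t\<close> a large power of the
  radius, and the Carleman inequality passes from test functions to \<open>\<zeta> u\<close> by mollification, where
  its case \<open>q = 0\<close> provides the bound of \<open>\<zeta> u\<close> in \<open>L\<^sup>p\<^sup>'\<close>.\<close>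

section \<open>Calculus of smooth functions\<close>

text \<open>The order of the choices shapes the estimate. An annulus \<rho> \<le> |x| < 1/4 and
  \<lambda> are fixed first; then the inner scale is taken so small, depending on \<lambda>, that
  the p-th power of the weighted inner commutator integrates to at most 2^(\<lambda> p). The
  constant in front of the final factor 2^(-\<lambda> p') depends neither on the annulus nor on
  \<lambda>, so \<lambda> can go to infinity on each annulus. As only exponential growth in
  \<lambda> counts, other constants may be wasteful: integrals of powers are used without taking
  roots, with quasi-triangle factors 2^p. The delicate term of the mollification is q \<zeta> u.
  With q only in L^(n/2), convergence in L^p says nothing about it; Hoelder with 1/p = 2/n + 1/p'
  requires convergence in L^p', hence \<zeta> u in L^p' beforehand. The weak derivatives of u exist
  in the open ball only and are selected by a choice operator. This is why cut-offs precede the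
  convolutions and why weak derivatives have to be shown unique almost everywhere.\<close>

lemma partial_of_has_derivative:
  assumes "(f has_derivative f') (at x)"
  shows "partial i f x = f' (axis i 1)"
  using frechet_derivative_at[OF assms] by (simp add: partial_def)

lemma has_derivative_partials:
  fixes f :: "real^'n::finite \<Rightarrow> 'b::real_normed_vector"
  assumes "f differentiable at x"
  shows "(f has_derivative (\<lambda>h. \<Sum>i\<in>UNIV. (h $ i) *\<^sub>R partial i f x)) (at x)"
proof -
  let ?D = "frechet_derivative f (at x)"
  have D: "(f has_derivative ?D) (at x)"
    using assms by (simp add: frechet_derivative_works)
  then have lin: "linear ?D" by (rule has_derivative_linear)
  have "?D h = (\<Sum>i\<in>UNIV. (h $ i) *\<^sub>R partial i f x)" for h
  proof -
    have "?D h = ?D (\<Sum>i\<in>UNIV. (h $ i) *\<^sub>R axis i 1)"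
      using basis_expansion[of h] by (simp add: scalar_mult_eq_scaleR)
    also have "\<dots> = (\<Sum>i\<in>UNIV. (h $ i) *\<^sub>R partial i f x)"
      by (simp add: linear_sum[OF lin] linear_scale[OF lin] partial_def)
    finally show ?thesis .
  qed
  then have "?D = (\<lambda>h. \<Sum>i\<in>UNIV. (h $ i) *\<^sub>R partial i f x)" by (rule ext)
  with D show ?thesis by simp
qed

definition smooth :: "(real^'n::finite \<Rightarrow> 'b::real_normed_vector) \<Rightarrow> bool"
  where "smooth f \<longleftrightarrow> (\<forall>k. C_k k f)"

text \<open>\<open>C_k (Suc k)\<close> asks for differentiability and for \<open>C_k k\<close> of
  the partials, not for \<open>C_k k\<close> itself. The only real content is the base case:
  differentiable functions are continuous.\<close>

lemma C_k_SucD: "C_k (Suc k) f \<Longrightarrow> C_k k f"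
proof (induction k arbitrary: f)
  case 0
  then show ?case
    by (simp add: differentiable_imp_continuous_on differentiable_on_def differentiable_at_withinI)
qed auto

lemma smooth_iff: "smooth f \<longleftrightarrow> (\<forall>x. f differentiable at x) \<and> (\<forall>i. smooth (partial i f))"
  unfolding smooth_def by (metis C_k.simps(2) C_k_SucD)

lemma smooth_differentiable: "smooth f \<Longrightarrow> f differentiable at x"
  using smooth_iff by blast

lemma smooth_partial: "smooth f \<Longrightarrow> smooth (partial i f)"
  using smooth_iff by blast

lemma smooth_continuous_on: "smooth f \<Longrightarrow> continuous_on S f"
  unfolding smooth_def using C_k.simps(1) continuous_on_subset by blast

lemma C_k_const: "C_k k (\<lambda>x::real^'n::finite. c)"
proof (induction k arbitrary: c)
  case (Suc k)
  have "partial i (\<lambda>x::real^'n. c) = (\<lambda>x. 0)" for i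
    by (simp add: partial_def fun_eq_iff)
  with Suc show ?case by simp
qed simp

lemma partial_add:
  assumes "f differentiable at x" "g differentiable at x"
  shows "partial i (\<lambda>x. f x + g x) x = partial i f x + partial i g x"
  unfolding partial_of_has_derivative[OF has_derivative_add[OF assms[unfolded frechet_derivative_works]]] by (simp add: partial_def)

lemma partial_diff:
  assumes "f differentiable at x" "g differentiable at x"
  shows "partial i (\<lambda>x. f x - g x) x = partial i f x - partial i g x"
  unfolding partial_of_has_derivative[OF has_derivative_diff[OF assms[unfolded frechet_derivative_works]]] by (simp add: partial_def)

lemma partial_scaleR:
  assumes "f differentiable at x" "g differentiable at x"
  shows "partial i (\<lambda>x. f x *\<^sub>R g x) x = f x *\<^sub>R partial i g x + partial i f x *\<^sub>R g x"
  unfolding partial_of_has_derivative[OF has_derivative_scaleR[OF assms[unfolded frechet_derivative_works]]] by (simp add: partial_def)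

lemma partial_affine:
  assumes "f differentiable at (a + c *\<^sub>R x)"
  shows "partial i (\<lambda>x. f (a + c *\<^sub>R x)) x = c *\<^sub>R partial i f (a + c *\<^sub>R x)"
proof -
  have D: "(f has_derivative frechet_derivative f (at (a + c *\<^sub>R x))) (at (a + c *\<^sub>R x))"
    using assms by (simp add: frechet_derivative_works)
  have "((\<lambda>x. f (a + c *\<^sub>R x)) has_derivative
     (\<lambda>h. frechet_derivative f (at (a + c *\<^sub>R x)) (c *\<^sub>R h))) (at x)"
    by (rule has_derivative_compose[where f="\<lambda>x. a + c *\<^sub>R x", OF _ D]) (auto intro!: derivative_eq_intros)
  from partial_of_has_derivative[OF this] show ?thesis
    by (simp add: partial_def linear_scale[OF has_derivative_linear[OF D]])
qed

lemma C_k_add: "C_k k f \<Longrightarrow> C_k k g \<Longrightarrow> C_k k (\<lambda>x. f x + g x)"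
proof (induction k arbitrary: f g)
  case (Suc k)
  have "partial i (\<lambda>x. f x + g x) = (\<lambda>x. partial i f x + partial i g x)" for i
    using Suc.prems by (auto simp: partial_add)
  with Suc show ?case by simp
qed (simp add: continuous_on_add)

lemma C_k_scaleR: "C_k k f \<Longrightarrow> C_k k g \<Longrightarrow> C_k k (\<lambda>x. f x *\<^sub>R g x)"
proof (induction k arbitrary: f g)
  case (Suc k)
  have "partial i (\<lambda>x. f x *\<^sub>R g x) = (\<lambda>x. f x *\<^sub>R partial i g x + partial i f x *\<^sub>R g x)" for i
    using Suc.prems by (auto simp: partial_scaleR)
  with Suc show ?case
    using C_k_SucD[of k f] C_k_SucD[of k g] by (simp add: C_k_add)
qed (simp add: continuous_on_scaleR)

lemma C_k_affine: "C_k k f \<Longrightarrow> C_k k (\<lambda>x. f (a + c *\<^sub>R x))"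
proof (induction k arbitrary: f)
  case 0
  then have f: "continuous_on UNIV f" by simp
  have "continuous_on UNIV (\<lambda>x. f (a + c *\<^sub>R x))"
    by (rule continuous_on_compose2[OF f]) (auto intro!: continuous_intros)
  then show ?case by simp
next
  case (Suc k)
  have "partial i (\<lambda>x. f (a + c *\<^sub>R x)) = (\<lambda>x. c *\<^sub>R partial i f (a + c *\<^sub>R x))" for i
    using Suc.prems by (auto simp: partial_affine)
  moreover have "(\<lambda>x. f (a + c *\<^sub>R x)) differentiable at x" for x
    by (rule differentiable_compose) (use Suc.prems in auto)
  ultimately show ?case
    using Suc by (auto intro!: C_k_scaleR C_k_const)
qed

section \<open>Closure properties of smoothness\<close>

lemma smooth_const [simp]: "smooth (\<lambda>x. c)"
  by (simp add: smooth_def C_k_const)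

lemma smooth_add: "smooth f \<Longrightarrow> smooth g \<Longrightarrow> smooth (\<lambda>x. f x + g x)"
  by (simp add: smooth_def C_k_add)

lemma smooth_scaleR: "smooth f \<Longrightarrow> smooth g \<Longrightarrow> smooth (\<lambda>x. f x *\<^sub>R g x)"
  by (simp add: smooth_def C_k_scaleR)

lemma smooth_affine: "smooth f \<Longrightarrow> smooth (\<lambda>x. f (a + c *\<^sub>R x))"
  by (simp add: smooth_def C_k_affine)

lemma smooth_diff: "smooth f \<Longrightarrow> smooth g \<Longrightarrow> smooth (\<lambda>x. f x - g x)"
  using smooth_add[of f "\<lambda>x. (-1) *\<^sub>R g x"] smooth_scaleR[of "\<lambda>x. -1" g] by simp

lemma smooth_component: "smooth (\<lambda>x::real^'n::finite. x $ i)"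
proof -
  have D: "((\<lambda>x::real^'n. x $ i) has_derivative (\<lambda>h. h $ i)) (at x)" for x
    by (rule bounded_linear_imp_has_derivative) (rule bounded_linear_vec_nth)
  have "partial j (\<lambda>x::real^'n. x $ i) = (\<lambda>x. axis j 1 $ i)" for j
    by (auto simp: partial_of_has_derivative[OF D])
  then show ?thesis
    unfolding smooth_iff[of "\<lambda>x. x $ i"] using D by (auto simp: differentiable_def)
qed

lemma smooth_sum: "finite I \<Longrightarrow> (\<And>i. i \<in> I \<Longrightarrow> smooth (f i)) \<Longrightarrow> smooth (\<lambda>x. \<Sum>i\<in>I. f i x)"
  by (induction rule: finite_induct) (auto intro: smooth_add)

lemma smooth_inner_self: "smooth (\<lambda>x::real^'n::finite. x \<bullet> x)"
  unfolding inner_vec_def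
  using smooth_scaleR[OF smooth_component smooth_component]
  by (auto intro!: smooth_sum simp: inner_real_def)

text \<open>Stating this for a family \<open>G\<close> that differentiation maps into itself,
  through \<open>D\<close> on the indices, replaces an iterated chain rule: each partial is
  \<open>partial i h\<close> times another member of the family composed with \<open>h\<close>, so
  induction on \<open>k\<close> works for all \<open>m\<close> at once.\<close>

lemma C_k_compose_real:
  fixes G :: "'i \<Rightarrow> real \<Rightarrow> real" and h :: "real^'n::finite \<Rightarrow> real"
  assumes G: "\<And>m t. (G m has_real_derivative G (D m) t) (at t)" and h: "smooth h"
  shows "C_k k (\<lambda>x. G m (h x))"
proof (induction k arbitrary: m)
  case 0
  have "continuous_on UNIV (G m)"
    by (meson G DERIV_continuous continuous_at_imp_continuous_on)
  from continuous_on_compose2[OF this smooth_continuous_on[OF h, of UNIV]] show ?case by simp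
next
  case (Suc k)
  have D: "((\<lambda>x. G m (h x)) has_derivative (\<lambda>v. frechet_derivative h (at x) v * G (D m) (h x))) (at x)" for x
    using has_derivative_compose[OF smooth_differentiable[OF h, unfolded frechet_derivative_works]
        G[unfolded has_field_derivative_def]] by (simp add: mult.commute)
  have "partial i (\<lambda>x. G m (h x)) = (\<lambda>x. partial i h x *\<^sub>R G (D m) (h x))" for i
    by (auto simp: partial_of_has_derivative[OF D] partial_def)
  moreover have "C_k k (partial i h)" for i
    using smooth_partial[OF h] by (simp add: smooth_def)
  ultimately show ?case
    using D Suc C_k_scaleR[of k _ "\<lambda>x. G (D m) (h x)"] by (auto simp: differentiable_def)
qed

text \<open>\<open>flat 1\<close> is the classical exp(-1/t), continued by 0 to t \<le> 0. The
  polynomial in 1/t collects the factors that differentiation produces.\<close>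

definition flat :: "real poly \<Rightarrow> real \<Rightarrow> real"
  where "flat P t = (if t > 0 then poly P (1 / t) * exp (- (1 / t)) else 0)"

lemma poly_times_exp_tendsto_0: "((\<lambda>s. poly P s * exp (- s)) \<longlongrightarrow> (0::real)) at_top"
proof -
  have "((\<lambda>s. \<Sum>i\<le>degree P. coeff P i * (s ^ i / exp s)) \<longlongrightarrow> (\<Sum>i\<le>degree P. coeff P i * 0)) at_top"
    by (intro tendsto_intros tendsto_power_div_exp_0)
  then show ?thesis
    by (simp add: poly_altdef sum_distrib_right exp_minus divide_inverse mult.assoc)
qed

text \<open>The functions \<open>flat P\<close> form a class closed under differentiation, hence are smooth.\<close>

lemma flat_has_derivative:
  "(flat P has_real_derivative flat ([:0, 0, 1:] * (P - pderiv P)) t) (at t)"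
proof -
  consider "t > 0" | "t < 0" | "t = 0" by linarith
  then show ?thesis
  proof cases
    case 1
    have "((\<lambda>t. poly P (1 / t) * exp (- (1 / t))) has_real_derivative
        flat ([:0, 0, 1:] * (P - pderiv P)) t) (at t)"
      using 1 by (auto intro!: derivative_eq_intros DERIV_chain2[OF poly_DERIV]
          simp: flat_def power2_eq_square field_simps)
    then show ?thesis
      by (rule has_field_derivative_transform_within_open[where S="{0<..}"])
        (use 1 in \<open>auto simp: flat_def\<close>)
  next
    case 2
    have "((\<lambda>t. 0) has_real_derivative flat ([:0, 0, 1:] * (P - pderiv P)) t) (at t)"
      using 2 by (simp add: flat_def)
    then show ?thesis
      by (rule has_field_derivative_transform_within_open[where S="{..<0}"])
        (use 2 in \<open>auto simp: flat_def\<close>)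
  next
    case 3
    \<comment> \<open>At 0 the difference quotient \<open>flat P s / s\<close> has the same shape
      again, its factor 1/s being absorbed by the polynomial \<open>[:0, 1:] * P\<close>;
      exponential decay then wins.\<close>
    have lim: "((\<lambda>s. poly ([:0, 1:] * P) (inverse s) * exp (- inverse s)) \<longlongrightarrow> 0) (at_right (0::real))"
      by (rule filterlim_compose[OF poly_times_exp_tendsto_0 filterlim_inverse_at_top_right])
    have "((\<lambda>s. flat P s / s) \<longlongrightarrow> 0) (at_right 0)"
      by (rule Lim_transform_eventually[OF lim])
        (auto simp: flat_def eventually_at_filter field_simps)
    moreover have "((\<lambda>s. flat P s / s) \<longlongrightarrow> 0) (at_left 0)"
      by (rule Lim_transform_eventually[OF tendsto_const])
        (auto simp: flat_def eventually_at_filter)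
    ultimately have "((\<lambda>s. flat P s / s) \<longlongrightarrow> 0) (at 0)"
      by (simp add: filterlim_split_at)
    then show ?thesis
      using 3 by (simp add: has_field_derivative_iff flat_def)
  qed
qed

text \<open>The square of the norm is used because it is a polynomial in the coordinates, whereas
  the norm fails to be differentiable at 0.\<close>

lemma smooth_bump:
  fixes r :: real
  defines "f \<equiv> \<lambda>x::real^'n::finite. flat 1 (r\<^sup>2 - x \<bullet> x)"
  assumes "r > 0"
  shows "smooth f" "\<And>x. f x \<ge> 0" "\<And>x. f x \<noteq> 0 \<longleftrightarrow> norm x < r"
proof -
  have "smooth (\<lambda>x::real^'n. r\<^sup>2 - x \<bullet> x)"
    by (intro smooth_diff smooth_const smooth_inner_self)
  from C_k_compose_real[where G=flat, OF flat_has_derivative this] show "smooth f"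
    by (simp add: smooth_def f_def)
  show "\<And>x. f x \<ge> 0" by (simp add: f_def flat_def)
  have "r\<^sup>2 - x \<bullet> x > 0 \<longleftrightarrow> norm x < r" for x :: "real^'n"
    using assms(2) power2_less_imp_less[of "norm x" r] power_strict_mono[of "norm x" r 2]
    by (auto simp: power2_norm_eq_inner[symmetric])
  then show "\<And>x. f x \<noteq> 0 \<longleftrightarrow> norm x < r" by (simp add: f_def flat_def)
qed

section \<open>Test functions\<close>

lemma test_functionsD:
  assumes "f \<in> test_functions \<Omega>"
  shows "smooth f" "\<exists>K. compact K \<and> K \<subseteq> \<Omega> \<and> (\<forall>x. x \<notin> K \<longrightarrow> f x = 0)"
  using assms by (auto simp: test_functions_def smooth_def)

lemma test_functionsI:
  assumes "smooth f" "compact K" "K \<subseteq> \<Omega>" "\<And>x. x \<notin> K \<Longrightarrow> f x = 0"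
  shows "f \<in> test_functions \<Omega>"
  using assms by (auto simp: test_functions_def smooth_def)

lemma partial_eq_0_open:
  assumes "open S" "x \<in> S" "\<And>y. y \<in> S \<Longrightarrow> f y = c"
  shows "partial i f x = 0"
proof -
  have "(f has_derivative (\<lambda>h. 0)) (at x)"
    by (rule has_derivative_transform_within_open[OF has_derivative_const[of c] assms(1,2)])
      (use assms(3) in auto)
  from partial_of_has_derivative[OF this] show ?thesis .
qed

lemma test_functions_partial:
  assumes "f \<in> test_functions \<Omega>"
  shows "partial i f \<in> test_functions \<Omega>"
proof -
  obtain K where K: "compact K" "K \<subseteq> \<Omega>" "\<And>x. x \<notin> K \<Longrightarrow> f x = 0"
    using test_functionsD(2)[OF assms] by blast
  show ?thesis
  proof (rule test_functionsI[OF _ K(1,2)])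
    show "smooth (partial i f)" using assms by (simp add: smooth_partial test_functionsD)
    show "partial i f x = 0" if "x \<notin> K" for x
      by (rule partial_eq_0_open[where S="-K" and c=0])
        (use K that in \<open>auto intro: compact_imp_closed\<close>)
  qed
qed

lemma test_functions_scaleR_smooth:
  assumes "f \<in> test_functions \<Omega>" "smooth g"
  shows "(\<lambda>x. f x *\<^sub>R g x) \<in> test_functions \<Omega>"
  using test_functionsD(2)[OF assms(1)] test_functionsD(1)[OF assms(1)]
  by (force intro: test_functionsI[OF smooth_scaleR[OF _ assms(2)]])

lemma test_functions_mono: "f \<in> test_functions \<Omega> \<Longrightarrow> \<Omega> \<subseteq> \<Omega>' \<Longrightarrow> f \<in> test_functions \<Omega>'"
  by (force simp: test_functions_def)

lemma continuous_on_test_function: "f \<in> test_functions \<Omega> \<Longrightarrow> continuous_on S f"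
  by (simp add: smooth_continuous_on test_functionsD)

lemma test_function_bounded:
  assumes "f \<in> test_functions \<Omega>"
  obtains B where "B > 0" "\<And>x. norm (f x) \<le> B"
proof -
  obtain K where K: "compact K" "K \<subseteq> \<Omega>" "\<And>x. x \<notin> K \<Longrightarrow> f x = 0"
    using test_functionsD(2)[OF assms] by blast
  have "bounded (f ` K)"
    using K compact_continuous_image continuous_on_test_function[OF assms] compact_imp_bounded by blast
  then obtain B where "B > 0" "\<And>x. x \<in> K \<Longrightarrow> norm (f x) \<le> B"
    unfolding bounded_pos by auto
  with K that[of B] show thesis by (metis norm_zero less_imp_le)
qed

lemma borel_measurable_test_function:
  "f \<in> test_functions \<Omega> \<Longrightarrow> f \<in> borel_measurable borel"
  by (simp add: borel_measurable_continuous_onI continuous_on_test_function)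

lemma borel_measurable_test_partials:
  assumes "f \<in> test_functions \<Omega>"
  shows "f \<in> borel_measurable borel" "partial i f \<in> borel_measurable borel"
    "partial i (partial i f) \<in> borel_measurable borel"
  by (intro borel_measurable_test_function[of _ \<Omega>] test_functions_partial assms)+

lemma integrable_test_function:
  fixes f :: "real^'n::finite \<Rightarrow> 'b::{banach,second_countable_topology}"
  assumes "f \<in> test_functions \<Omega>"
  shows "integrable lborel f"
proof -
  obtain K where K: "compact K" "K \<subseteq> \<Omega>" "\<And>x. x \<notin> K \<Longrightarrow> f x = 0"
    using test_functionsD(2)[OF assms] by blast
  have "set_integrable lborel K f"
    unfolding set_integrable_def
    by (rule borel_integrable_compact[OF K(1) continuous_on_test_function[OF assms]])
  moreover have "(\<lambda>x. indicator K x *\<^sub>R f x) = f"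
    using K by (auto simp: indicator_def)
  ultimately show ?thesis by (simp add: set_integrable_def)
qed

text \<open>Needed to use the convolution kernel, as a function of the integration variable, in the
  definition of weak derivatives.\<close>

lemma test_functions_reflect:
  assumes "f \<in> test_functions UNIV"
  shows "(\<lambda>y. f (x - y)) \<in> test_functions UNIV"
proof -
  obtain K where K: "compact K" "\<And>x. x \<notin> K \<Longrightarrow> f x = 0"
    using test_functionsD(2)[OF assms] by blast
  have "smooth (\<lambda>y. f (x - y))"
    using smooth_affine[OF test_functionsD(1)[OF assms], of x "-1"] by simp
  then show ?thesis
  proof (rule test_functionsI)
    show "compact ((\<lambda>k. x - k) ` K)"
      by (intro compact_continuous_image K continuous_intros)
    show "f (x - y) = 0" if "y \<notin> (\<lambda>k. x - k) ` K" for y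
      using K(2)[of "x - y"] that by (metis diff_diff_eq2 add_diff_cancel_left' image_eqI)
  qed auto
qed

lemma partial_reflect:
  assumes "f differentiable at (x - y)"
  shows "partial i (\<lambda>y. f (x - y)) y = - partial i f (x - y)"
  using partial_affine[of f x "-1" y i] assms by simp

section \<open>Mollification in \<open>L\<^sup>p\<close>\<close>

text \<open>The p-th power of the L^p norm over the whole space, for Lebesgue-Borel measure. Without
  the root it is linear in |f|^p, so that Tonelli and translation invariance apply directly; the
  triangle inequality is replaced by \<open>Lpow_add\<close>.\<close>

definition Lpow :: "real \<Rightarrow> ('a::euclidean_space \<Rightarrow> 'b::real_normed_vector) \<Rightarrow> ennreal"
  where "Lpow p f = (\<integral>\<^sup>+ x. ennreal (norm (f x) powr p) \<partial>lborel)"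

abbreviation Lpow_on :: "real \<Rightarrow> 'a::euclidean_space set \<Rightarrow> ('a \<Rightarrow> 'b::real_normed_vector) \<Rightarrow> ennreal"
  where "Lpow_on p S f \<equiv> Lpow p (\<lambda>x. indicator S x *\<^sub>R f x)"

lemma powr_add_le: "0 \<le> p \<Longrightarrow> 0 \<le> a \<Longrightarrow> 0 \<le> b \<Longrightarrow> (a + b) powr p \<le> 2 powr p * (a powr p + b powr p)" for p :: real
proof -
  assume h: "0 \<le> p" "0 \<le> a" "0 \<le> b"
  have "(a + b) powr p \<le> (2 * max a b) powr p"
    by (rule powr_mono2) (use h in auto)
  also have "\<dots> = 2 powr p * (max a b) powr p"
    using h by (simp add: powr_mult)
  also have "\<dots> \<le> 2 powr p * (a powr p + b powr p)"
    by (intro mult_left_mono) (auto simp: max_def)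
  finally show ?thesis .
qed

lemma powr_norm_add_le:
  "0 \<le> p \<Longrightarrow> norm (a + b) powr p \<le> 2 powr p * (norm a powr p + norm b powr p)" for a :: "'b::real_normed_vector"
  using powr_mono2[OF _ norm_ge_zero norm_triangle_ineq] powr_add_le[of p "norm a" "norm b"]
  by (meson norm_ge_zero order_trans)

lemma Lpow_add:
  assumes p: "0 \<le> p" and [measurable]: "f \<in> borel_measurable borel" "g \<in> borel_measurable borel"
  shows "Lpow p (\<lambda>x. f x + g x) \<le> ennreal (2 powr p) * (Lpow p f + Lpow p g)"
proof -
  have "Lpow p (\<lambda>x. f x + g x) \<le> (\<integral>\<^sup>+ x. ennreal (2 powr p) * (ennreal (norm (f x) powr p) + ennreal (norm (g x) powr p)) \<partial>lborel)"
    unfolding Lpow_def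
    by (intro nn_integral_mono) (use powr_norm_add_le[OF p] in \<open>simp flip: ennreal_plus ennreal_mult''\<close>)
  also have "\<dots> = ennreal (2 powr p) * (Lpow p f + Lpow p g)"
    unfolding Lpow_def by (simp add: nn_integral_cmult nn_integral_add)
  finally show ?thesis .
qed

lemma Lpow_minus: "Lpow p (\<lambda>x. - f x) = Lpow p f"
  by (simp add: Lpow_def)

lemma Lpow_diff:
  fixes f g :: "'a::euclidean_space \<Rightarrow> 'b::{real_normed_vector,second_countable_topology}"
  assumes p: "0 \<le> p" and [measurable]: "f \<in> borel_measurable borel" "g \<in> borel_measurable borel"
  shows "Lpow p (\<lambda>x. f x - g x) \<le> ennreal (2 powr p) * (Lpow p f + Lpow p g)"
  using Lpow_add[OF p, of f "\<lambda>x. - g x"] by (simp add: Lpow_minus)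

lemma Lpow_mono_AE:
  assumes "0 \<le> p" "AE x in lborel. norm (f x) \<le> norm (g x)"
  shows "Lpow p f \<le> Lpow p g"
  unfolding Lpow_def
  by (intro nn_integral_mono_AE) (use assms in \<open>auto intro!: powr_mono2 ennreal_leI\<close>)

lemma Lpow_mono: "0 \<le> p \<Longrightarrow> (\<And>x. norm (f x) \<le> norm (g x)) \<Longrightarrow> Lpow p f \<le> Lpow p g"
  by (rule Lpow_mono_AE) auto

lemma Lpow_scaleR:
  fixes f :: "'a::euclidean_space \<Rightarrow> 'b::{real_normed_vector,second_countable_topology}"
  assumes [measurable]: "f \<in> borel_measurable borel"
  shows "Lpow p (\<lambda>x. c *\<^sub>R f x) = ennreal (\<bar>c\<bar> powr p) * Lpow p f"
  unfolding Lpow_def by (simp add: powr_mult ennreal_mult nn_integral_cmult)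

lemma Lpow_1: "Lpow 1 f = (\<integral>\<^sup>+ x. ennreal (norm (f x)) \<partial>lborel)"
  by (simp add: Lpow_def)

text \<open>Convexity gives the tangent inequality at positive points; at \<open>x = 0\<close> it
  amounts to (1 - p) b^p \<le> 0.\<close>

lemma powr_above_tangent:
  fixes x b p :: real
  assumes "p \<ge> 1" "x \<ge> 0" "b > 0"
  shows "x powr p \<ge> b powr p + p * b powr (p - 1) * (x - b)"
proof (cases "x = 0")
  case True
  have "b powr (p - 1) * b = b powr p" using assms by (simp add: powr_mult_base mult.commute)
  then have "b powr p + p * b powr (p - 1) * (x - b) = (1 - p) * b powr p"
    using True by (simp add: algebra_simps)
  also have "\<dots> \<le> 0" using assms by (simp add: mult_nonpos_nonneg)
  finally show ?thesis by (simp add: True)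
next
  case False
  have "x powr p - b powr p \<ge> (p * b powr (p - 1)) * (x - b)"
    by (rule convex_on_imp_above_tangent[OF powr_convex])
      (use assms False in \<open>auto intro!: derivative_eq_intros simp: interior_open\<close>)
  then show ?thesis by simp
qed

text \<open>Jensen's inequality for the probability density \<open>w\<close>, by integrating the
  tangent inequality at the mean. It serves twice: with a mollifier as density, and with the uniform
  density on a segment.\<close>

lemma weighted_jensen_powr:
  assumes p: "p \<ge> 1" and [measurable]: "w \<in> borel_measurable M" "f \<in> borel_measurable M"
    and w: "\<And>x. w x \<ge> 0" "(\<integral>\<^sup>+ x. ennreal (w x) \<partial>M) = 1"
    and f: "\<And>x. f x \<ge> 0" and int: "integrable M (\<lambda>x. w x * f x)"
  shows "ennreal ((\<integral>x. w x * f x \<partial>M) powr p) \<le> (\<integral>\<^sup>+ x. ennreal (w x * f x powr p) \<partial>M)"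
proof -
  define b where "b = (\<integral>x. w x * f x \<partial>M)"
  have "b \<ge> 0" unfolding b_def by (rule integral_nonneg_AE) (auto simp: w f)
  have wint: "integrable M w" "integral\<^sup>L M w = 1"
    using w by (auto simp: integrable_iff_bounded integral_eq_nn_integral)
  show ?thesis
  \<comment> \<open>The tangent inequality needs a positive mean, and integrating it needs a finite
    right hand side; in the remaining cases the claim is trivial.\<close>
  proof (cases "b = 0 \<or> (\<integral>\<^sup>+ x. ennreal (w x * f x powr p) \<partial>M) = \<infinity>")
    case True
    then show ?thesis by (auto simp: b_def[symmetric])
  next
    case False
    then have "b > 0" using \<open>b \<ge> 0\<close> by auto
    have intp: "integrable M (\<lambda>x. w x * f x powr p)"
      using False w by (intro integrableI_bounded) (auto simp: abs_mult less_top)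
    \<comment> \<open>The added linear term has integral 0, because \<open>w\<close> has mass 1 and
      \<open>b\<close> is the mean of \<open>f\<close>.\<close>
    have "b powr p = (\<integral>x. w x * (b powr p) + p * b powr (p - 1) * (w x * f x - b * w x) \<partial>M)"
      using wint int by (simp add: b_def[symmetric])
    also have "\<dots> \<le> (\<integral>x. w x * f x powr p \<partial>M)"
    proof (rule integral_mono)
      fix x
      show "w x * (b powr p) + p * b powr (p - 1) * (w x * f x - b * w x) \<le> w x * f x powr p"
        using mult_left_mono[OF powr_above_tangent[OF p f \<open>b > 0\<close>] w(1), of x x] by (simp add: algebra_simps)
    qed (use wint int intp in auto)
    finally have "ennreal (b powr p) \<le> ennreal (\<integral>x. w x * f x powr p \<partial>M)" by (rule ennreal_leI)
    also have "\<dots> = (\<integral>\<^sup>+ x. ennreal (w x * f x powr p) \<partial>M)"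
      by (rule nn_integral_eq_integral[symmetric, OF intp]) (simp add: w)
    finally show ?thesis by (simp add: b_def)
  qed
qed

lemma nn_integral_lborel_translate:
  fixes a :: "'a::euclidean_space"
  assumes [measurable]: "f \<in> borel_measurable borel"
  shows "(\<integral>\<^sup>+ x. f (a + x) \<partial>lborel) = (\<integral>\<^sup>+ x. f x \<partial>lborel)"
proof -
  have "(\<integral>\<^sup>+ x. f x \<partial>lborel) = (\<integral>\<^sup>+ x. f x \<partial>distr lborel borel ((+) a))"
    by (simp add: lborel_distr_plus)
  then show ?thesis by (simp add: nn_integral_distr)
qed

lemma nn_integral_lborel_reflect:
  fixes a :: "'a::euclidean_space"
  assumes [measurable]: "f \<in> borel_measurable borel"
  shows "(\<integral>\<^sup>+ x. f (a - x) \<partial>lborel) = (\<integral>\<^sup>+ x. f x \<partial>lborel)"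
proof -
  have "(\<integral>\<^sup>+ x. f x \<partial>lborel) = (\<integral>\<^sup>+ x. f x \<partial>density (distr lborel borel (\<lambda>x. a + (-1) *\<^sub>R x)) (\<lambda>_. 1))"
    using lborel_affine[of "-1" a] by simp
  then show ?thesis by (simp add: density_1 nn_integral_distr)
qed

text \<open>As a Bochner integral this is 0 at points where the integrand is not integrable, which
  keeps the norm bounds below valid there.\<close>

definition conv :: "('a::euclidean_space \<Rightarrow> real) \<Rightarrow> ('a \<Rightarrow> 'b) \<Rightarrow> 'a \<Rightarrow> 'b::{banach,second_countable_topology}"
  where "conv \<eta> v x = (\<integral>y. \<eta> (x - y) *\<^sub>R v y \<partial>lborel)"

lemma borel_measurable_conv [measurable]:
  assumes [measurable]: "\<eta> \<in> borel_measurable borel" "v \<in> borel_measurable borel"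
  shows "conv \<eta> v \<in> borel_measurable borel"
  unfolding conv_def[abs_def] by (rule lborel.borel_measurable_lebesgue_integral) measurable

lemma integrable_conv_kernel:
  fixes \<eta> :: "'a::euclidean_space \<Rightarrow> real" and v :: "'a \<Rightarrow> 'b::{banach,second_countable_topology}"
  assumes [measurable]: "\<eta> \<in> borel_measurable borel" and B: "\<And>x. \<bar>\<eta> x\<bar> \<le> B" and v: "integrable lborel v"
  shows "integrable lborel (\<lambda>y. \<eta> (x - y) *\<^sub>R v y)"
proof (rule Bochner_Integration.integrable_bound)
  have [measurable]: "v \<in> borel_measurable borel" using v by auto
  show "integrable lborel (\<lambda>y. B *\<^sub>R v y)" using v by simp
  show "(\<lambda>y. \<eta> (x - y) *\<^sub>R v y) \<in> borel_measurable lborel" by measurable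
  have "B \<ge> 0" using B[of 0] by linarith
  then show "AE y in lborel. norm (\<eta> (x - y) *\<^sub>R v y) \<le> norm (B *\<^sub>R v y)"
    using B by (auto intro!: mult_right_mono)
qed

text \<open>Young's inequality for a kernel of mass 1: Jensen at each point, then Tonelli and the
  translation invariance of the kernel's integral.\<close>

lemma Lpow_conv_le:
  assumes p: "p \<ge> 1" and [measurable]: "\<eta> \<in> borel_measurable borel" "v \<in> borel_measurable borel"
    and \<eta>: "\<And>x. \<eta> x \<ge> 0" "(\<integral>\<^sup>+ x. ennreal (\<eta> x) \<partial>lborel) = 1"
  shows "Lpow p (conv \<eta> v) \<le> Lpow p v"
proof -
  have one: "(\<integral>\<^sup>+ y. ennreal (\<eta> (x - y)) \<partial>lborel) = 1" for x
    using nn_integral_lborel_reflect[of "\<lambda>y. ennreal (\<eta> y)" x] \<eta> by simp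
  have *: "ennreal (norm (conv \<eta> v x) powr p) \<le> (\<integral>\<^sup>+ y. ennreal (\<eta> (x - y) * norm (v y) powr p) \<partial>lborel)" for x
  proof (cases "integrable lborel (\<lambda>y. \<eta> (x - y) *\<^sub>R v y)")
    case True
    then have int: "integrable lborel (\<lambda>y. \<eta> (x - y) * norm (v y))"
      using integrable_norm[OF True] \<eta> by simp
    have "norm (conv \<eta> v x) \<le> (\<integral>y. \<eta> (x - y) * norm (v y) \<partial>lborel)"
      unfolding conv_def using integral_norm_bound[of lborel "\<lambda>y. \<eta> (x - y) *\<^sub>R v y"] \<eta> by simp
    then have "ennreal (norm (conv \<eta> v x) powr p) \<le> ennreal ((\<integral>y. \<eta> (x - y) * norm (v y) \<partial>lborel) powr p)"
      using p by (intro ennreal_leI powr_mono2) auto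
    also have "\<dots> \<le> (\<integral>\<^sup>+ y. ennreal (\<eta> (x - y) * norm (v y) powr p) \<partial>lborel)"
      by (rule weighted_jensen_powr[OF p]) (use int one \<eta> in auto)
    finally show ?thesis .
  next
    case False
    then show ?thesis by (simp add: conv_def not_integrable_integral_eq)
  qed
  have "Lpow p (conv \<eta> v) \<le> (\<integral>\<^sup>+ x. \<integral>\<^sup>+ y. ennreal (\<eta> (x - y) * norm (v y) powr p) \<partial>lborel \<partial>lborel)"
    unfolding Lpow_def by (intro nn_integral_mono *)
  also have "\<dots> = (\<integral>\<^sup>+ y. \<integral>\<^sup>+ x. ennreal (\<eta> (x - y) * norm (v y) powr p) \<partial>lborel \<partial>lborel)"
    by (rule lborel_pair.Fubini'[symmetric]) measurable
  also have "\<dots> = (\<integral>\<^sup>+ y. ennreal (norm (v y) powr p) * (\<integral>\<^sup>+ x. ennreal (\<eta> (- y + x)) \<partial>lborel) \<partial>lborel)"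
    by (intro nn_integral_cong) (simp add: ennreal_mult' \<eta> nn_integral_cmult[symmetric] mult.commute)
  also have "\<dots> = Lpow p v"
    by (subst nn_integral_lborel_translate[where f="\<lambda>x. ennreal (\<eta> x)"]) (simp_all add: \<eta> Lpow_def)
  finally show ?thesis .
qed

section \<open>Null sequences in \<open>ennreal\<close>\<close>

lemma ennreal_tendsto_0I:
  assumes "\<And>e::real. e > 0 \<Longrightarrow> eventually (\<lambda>k. f k \<le> ennreal e) F"
  shows "(f \<longlongrightarrow> (0::ennreal)) F"
proof (rule order_tendstoI)
  fix a :: ennreal assume "0 < a"
  then obtain b where "0 < b" "b < a" using dense by blast
  then obtain e where e: "b = ennreal e" "e > 0" by (cases b) (auto simp: top_unique)
  show "\<forall>\<^sub>F x in F. f x < a"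
    using assms[OF e(2)] \<open>b < a\<close> by (auto elim!: eventually_mono simp: e)
qed auto

lemma ennreal_tendsto_0D:
  assumes "(f \<longlongrightarrow> (0::ennreal)) F" "(e::real) > 0"
  shows "eventually (\<lambda>k. f k \<le> ennreal e) F"
  using order_tendstoD(2)[OF assms(1), of "ennreal e"] assms(2) by (auto elim!: eventually_mono)

lemma ennreal_tendsto_0_cmult:
  assumes "(f \<longlongrightarrow> (0::ennreal)) F" "c \<noteq> \<infinity>"
  shows "((\<lambda>k. c * f k) \<longlongrightarrow> 0) F"
proof -
  have "((\<lambda>k. c * f k) \<longlongrightarrow> c * 0) F"
    by (rule ennreal_tendsto_cmult[OF _ assms(1)]) (use assms(2) in \<open>simp add: less_top\<close>)
  then show ?thesis by simp
qed

lemma ennreal_tendsto_0_le: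
  fixes f g :: "_ \<Rightarrow> ennreal"
  assumes "(g \<longlongrightarrow> 0) F" "\<And>k. f k \<le> g k"
  shows "(f \<longlongrightarrow> 0) F"
proof (rule ennreal_tendsto_0I)
  fix e :: real assume "e > 0"
  from ennreal_tendsto_0D[OF assms(1) this] show "\<forall>\<^sub>F k in F. f k \<le> ennreal e"
    by (rule eventually_mono) (rule order_trans[OF assms(2)])
qed

text \<open>Smoothness of the kernels is kept out, since convergence in L^p rests only on mass, sign
  and shrinking support. A smooth instance is built in
  \<open>exists_smooth_approx_identity\<close>.\<close>

locale approx_identity =
  fixes \<eta> :: "nat \<Rightarrow> 'a::euclidean_space \<Rightarrow> real"
  assumes kernel_measurable [measurable]: "\<And>k. \<eta> k \<in> borel_measurable borel"
    and kernel_bounded: "\<And>k. \<exists>B. \<forall>x. \<eta> k x \<le> B"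
    and kernel_nonneg: "\<And>k x. 0 \<le> \<eta> k x"
    and kernel_integral: "\<And>k. (\<integral>\<^sup>+ x. ennreal (\<eta> k x) \<partial>lborel) = 1"
    and kernel_support: "\<And>k x. 1 / Suc k \<le> norm x \<Longrightarrow> \<eta> k x = 0"
begin

abbreviation err :: "real \<Rightarrow> nat \<Rightarrow> ('a \<Rightarrow> 'b::{banach,second_countable_topology}) \<Rightarrow> ennreal"
  where "err p k v \<equiv> Lpow p (\<lambda>x. conv (\<eta> k) v x - v x)"

lemma kernel_reflect_integral: "(\<integral>\<^sup>+ y. ennreal (\<eta> k (x - y)) \<partial>lborel) = 1"
  using nn_integral_lborel_reflect[of "\<lambda>y. ennreal (\<eta> k y)" x] kernel_integral by simp

lemma kernel_has_integral: "has_bochner_integral lborel (\<lambda>y. \<eta> k (x - y)) 1"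
  using kernel_reflect_integral[of k x] kernel_nonneg
  by (auto simp: has_bochner_integral_iff integrable_iff_bounded integral_eq_nn_integral)

lemma integrable_kernel:
  fixes v :: "'a \<Rightarrow> 'b::{banach,second_countable_topology}"
  assumes "integrable lborel v"
  shows "integrable lborel (\<lambda>y. \<eta> k (x - y) *\<^sub>R v y)"
proof -
  obtain B where B: "\<And>x. \<eta> k x \<le> B" using kernel_bounded by blast
  show ?thesis
    by (rule integrable_conv_kernel[OF _ _ assms, where B=B]) (use B kernel_nonneg in auto)
qed

lemma conv_add:
  assumes "integrable lborel v" "integrable lborel w"
  shows "conv (\<eta> k) (\<lambda>x. v x + w x) x = conv (\<eta> k) v x + conv (\<eta> k) w x"
  unfolding conv_def scaleR_add_right by (intro Bochner_Integration.integral_add integrable_kernel assms)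

lemma conv_diff:
  assumes "integrable lborel v" "integrable lborel w"
  shows "conv (\<eta> k) (\<lambda>x. v x - w x) x = conv (\<eta> k) v x - conv (\<eta> k) w x"
  unfolding conv_def scaleR_diff_right by (intro Bochner_Integration.integral_diff integrable_kernel assms)

lemma Lpow_conv:
  assumes "p \<ge> 1" "v \<in> borel_measurable borel"
  shows "Lpow p (conv (\<eta> k) v) \<le> Lpow p v"
  using assms by (intro Lpow_conv_le kernel_nonneg kernel_integral kernel_measurable)

text \<open>With d = v - w, the error of v is the error of w plus that of d, and the latter is at
  most twice the size of d by Young's inequality. Two nested quasi-triangle inequalities give
  4^p.\<close>

lemma Lpow_conv_diff_approx:
  assumes p: "p \<ge> 1" and v: "integrable lborel v" and w: "integrable lborel w"
  shows "err p k v \<le>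
    ennreal (4 powr p) * (err p k w + 2 * Lpow p (\<lambda>x. v x - w x))"
proof -
  have [measurable]: "v \<in> borel_measurable borel" "w \<in> borel_measurable borel" using v w by auto
  have p0: "p \<ge> 0" using p by simp
  have one: "1 \<le> ennreal (2 powr p)"
    using ge_one_powr_ge_zero[of 2 p] p by (metis ennreal_leI ennreal_1 p0 one_le_numeral)
  let ?d = "\<lambda>x. v x - w x"
  have "err p k v = Lpow p (\<lambda>x. (conv (\<eta> k) w x - w x) + (conv (\<eta> k) ?d x - ?d x))"
    using v w by (simp add: conv_diff algebra_simps)
  also have "\<dots> \<le> ennreal (2 powr p) * (err p k w + err p k ?d)"
    by (intro Lpow_add p0) measurable
  also have "\<dots> \<le> ennreal (2 powr p) * (ennreal (2 powr p) * err p k w +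
      ennreal (2 powr p) * (Lpow p (conv (\<eta> k) ?d) + Lpow p ?d))"
    using mult_right_mono[OF one, of "err p k w"]
    by (intro mult_left_mono add_mono Lpow_diff p0) (auto simp del: ennreal_1)
  also have "\<dots> \<le> ennreal (2 powr p) * (ennreal (2 powr p) * err p k w +
      ennreal (2 powr p) * (Lpow p ?d + Lpow p ?d))"
    by (intro mult_left_mono add_mono order_refl Lpow_conv p) auto
  also have "\<dots> = (ennreal (2 powr p) * ennreal (2 powr p)) * (err p k w + 2 * Lpow p ?d)"
    by (simp add: algebra_simps mult_2)
  also have "ennreal (2 powr p) * ennreal (2 powr p) = ennreal (4 powr p)"
    by (simp add: ennreal_mult'[symmetric] powr_mult[symmetric])
  finally show ?thesis .
qed

text \<open>The density argument in reusable form: functions whose mollifications converge are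
  closed under approximation in the same power integral. It is applied to sets, to pointwise limits
  and to truncations.\<close>

lemma Lpow_conv_diff_tendsto_by_approx:
  assumes p: "p \<ge> 1" and v: "integrable lborel v"
    and app: "\<And>e. e > 0 \<Longrightarrow> \<exists>w. integrable lborel w \<and> Lpow p (\<lambda>x. v x - w x) \<le> ennreal e \<and>
      (\<lambda>k. err p k w) \<longlonglongrightarrow> 0"
  shows "(\<lambda>k. err p k v) \<longlonglongrightarrow> 0"
proof (rule ennreal_tendsto_0I)
  fix e :: real assume "e > 0"
  define d where "d = e / (4 powr p * 3)"
  have "d > 0" using \<open>e > 0\<close> by (simp add: d_def)
  from app[OF this] obtain w where w: "integrable lborel w" "Lpow p (\<lambda>x. v x - w x) \<le> ennreal d"
    "(\<lambda>k. err p k w) \<longlonglongrightarrow> 0" by blast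
  show "\<forall>\<^sub>F k in sequentially. err p k v \<le> ennreal e"
    using ennreal_tendsto_0D[OF w(3) \<open>d > 0\<close>]
  proof eventually_elim
    case (elim k)
    have "err p k v \<le> ennreal (4 powr p) * (ennreal d + 2 * ennreal d)"
      by (rule order_trans[OF Lpow_conv_diff_approx[OF p v w(1)]])
        (intro mult_left_mono add_mono elim w; simp)
    also have "2 * ennreal d = ennreal (2 * d)"
      by (simp add: ennreal_mult')
    also have "ennreal d + \<dots> = ennreal (d + 2 * d)"
      by (rule ennreal_plus[symmetric]) (use \<open>d > 0\<close> in auto)
    also have "ennreal (4 powr p) * \<dots> = ennreal (4 powr p * (d + 2 * d))"
      by (rule ennreal_mult'[symmetric]) simp
    also have "4 powr p * (d + 2 * d) = e" by (simp add: d_def)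
    finally show ?case .
  qed
qed

text \<open>The mollified indicator lies between \<open>0\<close> and \<open>1\<close>, tends to \<open>1\<close> on \<open>U\<close> and has integral at
  most \<open>|U|\<close>, so that the mass it has outside \<open>U\<close> is bounded by the mass missing inside.\<close>

lemma conv_indicator_open_tendsto:
  fixes c :: "'b::{banach,second_countable_topology}"
  assumes U: "open U" and fin: "emeasure lborel U < \<infinity>"
  shows "(\<lambda>k. Lpow 1 (\<lambda>x. conv (\<eta> k) (\<lambda>x. indicator U x *\<^sub>R c) x - indicator U x *\<^sub>R c)) \<longlonglongrightarrow> 0"
proof -
  let ?i = "indicator U :: 'a \<Rightarrow> real"
  define a where "a k = conv (\<eta> k) ?i" for k
  have [measurable]: "U \<in> sets borel" using U by simp
  have iU: "integrable lborel ?i" using fin by (simp add: less_top)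
  have a_meas [measurable]: "a k \<in> borel_measurable borel" for k unfolding a_def by measurable
  have a0: "0 \<le> a k x" for k x
    unfolding a_def conv_def by (intro integral_nonneg_AE) (auto simp: kernel_nonneg)
  have a1: "a k x \<le> 1" for k x
  proof -
    have "a k x \<le> (\<integral>y. \<eta> k (x - y) \<partial>lborel)"
      unfolding a_def conv_def using integrable_kernel[OF iU] kernel_has_integral[of k x]
      by (intro integral_mono) (auto simp: kernel_nonneg has_bochner_integral_iff indicator_def)
    then show ?thesis using kernel_has_integral[of k x] by (simp add: has_bochner_integral_iff)
  qed
  have a_int: "integrable lborel (a k)" and a_le: "(\<integral>x. a k x \<partial>lborel) \<le> measure lborel U" for k
  proof -
    have "Lpow 1 (a k) \<le> Lpow 1 ?i" unfolding a_def by (rule Lpow_conv) auto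
    also have "\<dots> = emeasure lborel U" by (simp add: Lpow_1 ennreal_indicator)
    finally have le: "(\<integral>\<^sup>+ x. ennreal (a k x) \<partial>lborel) \<le> emeasure lborel U"
      using a0 by (simp add: Lpow_1)
    then show int: "integrable lborel (a k)"
      using fin a0 by (intro integrableI_bounded) (auto intro: le_less_trans)
    show "(\<integral>x. a k x \<partial>lborel) \<le> measure lborel U"
      using le fin nn_integral_eq_integral[OF int] a0
      by (simp add: emeasure_eq_ennreal_measure less_top)
  qed
  have lim: "(\<lambda>k. \<integral>x. ?i x * (1 - a k x) \<partial>lborel) \<longlonglongrightarrow> (\<integral>x. 0 \<partial>(lborel::'a measure))"
  proof (rule integral_dominated_convergence[where w="?i"])
    show "AE x in lborel. (\<lambda>k. ?i x * (1 - a k x)) \<longlonglongrightarrow> 0"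
    proof (rule AE_I2)
      fix x
      show "(\<lambda>k. ?i x * (1 - a k x)) \<longlonglongrightarrow> 0"
      proof (cases "x \<in> U")
        case True
        then obtain e where e: "e > 0" "ball x e \<subseteq> U" using U open_contains_ball by blast
        obtain N where N: "1 / Suc N < e" using nat_approx_posE[OF e(1)] by auto
        \<comment> \<open>Once the kernel centred at \<open>x\<close> is supported inside
          \<open>U\<close>, the mollified indicator is exactly 1 at \<open>x\<close>, so the
          sequence is eventually constant.\<close>
        have "?i x * (1 - a k x) = 0" if "k \<ge> N" for k
        proof -
          have "1 / Suc k \<le> 1 / Suc N" using that by (simp add: frac_le)
          have "\<eta> k (x - y) *\<^sub>R ?i y = \<eta> k (x - y)" for y
            using kernel_support[of k "x - y"] e N \<open>1 / Suc k \<le> 1 / Suc N\<close>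
            by (cases "norm (x - y) < e") (auto simp: indicator_def subset_iff dist_norm)
          then have "(\<lambda>y. \<eta> k (x - y) *\<^sub>R ?i y) = (\<lambda>y. \<eta> k (x - y))" by (rule ext)
          then have "a k x = 1"
            using kernel_has_integral[of k x] unfolding a_def conv_def by (simp only: has_bochner_integral_iff)
          then show ?thesis by simp
        qed
        then show ?thesis
          by (intro tendsto_eventually) (auto simp: eventually_sequentially)
      qed simp
    qed
    show "AE x in lborel. norm (?i x * (1 - a k x)) \<le> ?i x" for k
      using a0 a1 by (auto simp: indicator_def abs_le_iff)
  qed (use iU in auto)
  have bound: "Lpow 1 (\<lambda>x. conv (\<eta> k) (\<lambda>x. indicator U x *\<^sub>R c) x - indicator U x *\<^sub>R c)
      \<le> ennreal (norm c) * ennreal (2 * (\<integral>x. ?i x * (1 - a k x) \<partial>lborel))" for k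
  proof -
    have c: "conv (\<eta> k) (\<lambda>x. indicator U x *\<^sub>R c) x = a k x *\<^sub>R c" for x
      unfolding a_def conv_def scaleR_scaleR[symmetric]
      using integrable_kernel[OF iU] by (simp flip: integral_scaleR_left)
    have int1: "integrable lborel (\<lambda>x. ?i x * (1 - a k x))"
      by (rule Bochner_Integration.integrable_bound[OF iU]) (use a0[of k] a1[of k] in \<open>auto simp: indicator_def\<close>)
    have "Lpow 1 (\<lambda>x. conv (\<eta> k) (\<lambda>x. indicator U x *\<^sub>R c) x - indicator U x *\<^sub>R c)
      = (\<integral>\<^sup>+ x. ennreal (norm c) * ennreal (\<bar>a k x - ?i x\<bar>) \<partial>lborel)"
      unfolding Lpow_1 c scaleR_diff_left[symmetric] by (simp add: ennreal_mult mult.commute)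
    also have "\<dots> = ennreal (norm c) * (\<integral>\<^sup>+ x. ennreal (\<bar>a k x - ?i x\<bar>) \<partial>lborel)"
      by (rule nn_integral_cmult) measurable
    also have "(\<integral>\<^sup>+ x. ennreal (\<bar>a k x - ?i x\<bar>) \<partial>lborel) = ennreal (\<integral>x. \<bar>a k x - ?i x\<bar> \<partial>lborel)"
      using a_int iU by (intro nn_integral_eq_integral) auto
    \<comment> \<open>For values of \<open>a k\<close> in [0, 1] this is an identity, checked inside
      and outside \<open>U\<close>. The first bracket has integral at most 0 since mollification
      does not increase the mass; the second is the mass missing inside.\<close>
    also have "(\<integral>x. \<bar>a k x - ?i x\<bar> \<partial>lborel) = (\<integral>x. (a k x - ?i x) + 2 * (?i x * (1 - a k x)) \<partial>lborel)"
    proof (rule Bochner_Integration.integral_cong)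
      show "\<bar>a k x - ?i x\<bar> = (a k x - ?i x) + 2 * (?i x * (1 - a k x))" for x
        using a0[of k x] a1[of k x] by (auto simp: indicator_def)
    qed simp
    also have "\<dots> = (\<integral>x. a k x \<partial>lborel) - measure lborel U + 2 * (\<integral>x. ?i x * (1 - a k x) \<partial>lborel)"
      using a_int iU int1 by simp
    also have "ennreal \<dots> \<le> ennreal (2 * (\<integral>x. ?i x * (1 - a k x) \<partial>lborel))"
      using a_le[of k] by (intro ennreal_leI) auto
    finally show ?thesis by (simp add: mult_left_mono)
  qed
  have "(\<lambda>k. ennreal (2 * (\<integral>x. ?i x * (1 - a k x) \<partial>lborel))) \<longlonglongrightarrow> ennreal (2 * 0)"
    using lim by (intro tendsto_intros) simp
  then have "(\<lambda>k. ennreal (norm c) * ennreal (2 * (\<integral>x. ?i x * (1 - a k x) \<partial>lborel))) \<longlonglongrightarrow> 0"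
    by (intro ennreal_tendsto_0_cmult) auto
  then show ?thesis
    by (rule ennreal_tendsto_0_le) (rule bound)
qed

text \<open>Induction over integrable functions. Outer regularity reduces indicators of Borel sets
  to those of open sets, where convergence can be read off from the supports; sums and dominated
  limits follow by Young's inequality.\<close>

lemma conv_tendsto_L1:
  fixes v :: "'a \<Rightarrow> 'b::{banach,second_countable_topology}"
  assumes "integrable lborel v"
  shows "(\<lambda>k. err 1 k v) \<longlonglongrightarrow> 0"
  using assms
proof (induction rule: integrable_induct)
  case (base A c)
  have [measurable]: "A \<in> sets borel" using base by simp
  show ?case
  proof (rule Lpow_conv_diff_tendsto_by_approx)
    show "integrable lborel (\<lambda>x. indicator A x *\<^sub>R c)" using base by (simp add: less_top)
    fix e :: real assume "e > 0"
    \<comment> \<open>The summand 1 covers the case \<open>c = 0\<close>.\<close>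
    define d where "d = e / (norm c + 1)"
    have "d > 0" using \<open>e > 0\<close> by (auto simp: d_def intro!: divide_pos_pos add_nonneg_pos)
    obtain U where U: "open U" "A \<subseteq> U" "emeasure lborel (U - A) < d"
      using outer_regular_lborel[of A d] base \<open>d > 0\<close> by auto
    have [measurable]: "U \<in> sets borel" using U by simp
    have "emeasure lborel U = emeasure lborel A + emeasure lborel (U - A)"
      using U(2) by (subst plus_emeasure) (auto simp: Un_absorb1)
    then have fin: "emeasure lborel U < \<infinity>"
      using base less_trans[OF U(3) ennreal_less_top] by (simp add: less_top)
    have "Lpow 1 (\<lambda>x. indicator A x *\<^sub>R c - indicator U x *\<^sub>R c) = (\<integral>\<^sup>+ x. ennreal (norm c) * indicator (U - A) x \<partial>lborel)"
      unfolding Lpow_1 using U(2) by (intro nn_integral_cong) (auto simp: indicator_def)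
    also have "\<dots> = ennreal (norm c) * emeasure lborel (U - A)"
      by (subst nn_integral_cmult) auto
    also have "\<dots> \<le> ennreal (norm c) * ennreal d"
      using U(3) by (intro mult_left_mono) auto
    also have "\<dots> = ennreal (norm c * d)" using \<open>d > 0\<close> by (simp add: ennreal_mult')
    also have "norm c * d \<le> e"
      using \<open>e > 0\<close> by (simp add: d_def field_simps add_pos_nonneg)
    finally have "Lpow 1 (\<lambda>x. indicator A x *\<^sub>R c - indicator U x *\<^sub>R c) \<le> ennreal e"
      by (simp add: ennreal_leI)
    then show "\<exists>w. integrable lborel w \<and> Lpow 1 (\<lambda>x. indicator A x *\<^sub>R c - w x) \<le> ennreal e \<and>
      (\<lambda>k. err 1 k w) \<longlonglongrightarrow> 0"
      using conv_indicator_open_tendsto[OF U(1) fin, of c] fin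
      by (intro exI[of _ "\<lambda>x. indicator U x *\<^sub>R c"]) (simp add: less_top)
  qed simp
next
  case (add f g)
  have [measurable]: "f \<in> borel_measurable borel" "g \<in> borel_measurable borel" using add by auto
  have "(\<lambda>k. ennreal (2 powr 1) * (err 1 k f + err 1 k g)) \<longlonglongrightarrow> 0"
    using tendsto_add[OF add.IH] by (intro ennreal_tendsto_0_cmult) auto
  moreover have "Lpow 1 (\<lambda>x. conv (\<eta> k) (\<lambda>x. f x + g x) x - (f x + g x)) \<le>
     ennreal (2 powr 1) * (err 1 k f + err 1 k g)" for k
  proof -
    have "(\<lambda>x. conv (\<eta> k) (\<lambda>x. f x + g x) x - (f x + g x)) =
      (\<lambda>x. (conv (\<eta> k) f x - f x) + (conv (\<eta> k) g x - g x))"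
      using add by (simp add: conv_add fun_eq_iff)
    then show ?thesis by (simp only:) (intro Lpow_add; simp)
  qed
  ultimately show ?case
    by (rule ennreal_tendsto_0_le)
next
  case (lim f s)
  have [measurable]: "f \<in> borel_measurable borel" "\<And>i. s i \<in> borel_measurable borel" using lim by auto
  have "(\<lambda>i. \<integral>\<^sup>+ x. ennreal (norm (f x - s i x)) \<partial>lborel) \<longlonglongrightarrow> (\<integral>\<^sup>+ x. 0 \<partial>(lborel :: 'a measure))"
  proof (rule nn_integral_dominated_convergence[where w="\<lambda>x. ennreal (3 * norm (f x))"])
    \<comment> \<open>The induction rule supplies simple functions bounded by
      \<open>2 * norm (f x)\<close>, hence the factor 3.\<close>
    have "norm (f x - s j x) \<le> 3 * norm (f x)" for x j
      using lim.hyps(3)[of x j] norm_triangle_ineq4[of "f x" "s j x"] by simp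
    then show "AE x in lborel. ennreal (norm (f x - s j x)) \<le> ennreal (3 * norm (f x))" for j
      by (auto intro!: ennreal_leI)
    show "(\<integral>\<^sup>+ x. ennreal (3 * norm (f x)) \<partial>lborel) < \<infinity>"
      using lim.hyps(4) integrable_iff_bounded[of lborel "\<lambda>x. 3 *\<^sub>R f x"] by simp
    have "(\<lambda>i. ennreal (norm (f x - s i x))) \<longlonglongrightarrow> ennreal 0" for x
    proof -
      have "(\<lambda>i. norm (f x - s i x)) \<longlonglongrightarrow> norm (f x - f x)"
        by (intro tendsto_intros lim.hyps(2)) simp
      then show ?thesis by (intro tendsto_ennrealI) simp
    qed
    then show "AE x in lborel. (\<lambda>i. ennreal (norm (f x - s i x))) \<longlonglongrightarrow> 0" by simp
  qed auto
  then have L: "(\<lambda>i. Lpow 1 (\<lambda>x. f x - s i x)) \<longlonglongrightarrow> 0" by (simp add: Lpow_1)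
  show ?case
  proof (rule Lpow_conv_diff_tendsto_by_approx[OF _ lim.hyps(4)])
    fix e :: real assume "e > 0"
    then obtain i where "Lpow 1 (\<lambda>x. f x - s i x) \<le> ennreal e"
      using ennreal_tendsto_0D[OF L] by (auto simp: eventually_sequentially)
    then show "\<exists>w. integrable lborel w \<and> Lpow 1 (\<lambda>x. f x - w x) \<le> ennreal e \<and>
      (\<lambda>k. err 1 k w) \<longlonglongrightarrow> 0"
      using lim.hyps(1) lim.IH by blast
  qed simp
qed

text \<open>Truncating \<open>v\<close> at height M reduces the claim to convergence in L^1: the
  truncation and its mollifications stay below M, so a p-th power of their difference is at most (2
  M)^(p - 1) times the difference itself.\<close>

lemma conv_tendsto_Lp:
  fixes v :: "'a \<Rightarrow> 'b::{banach,second_countable_topology}"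
  assumes p: "p \<ge> 1" and v: "integrable lborel v" and fin: "Lpow p v < \<infinity>"
  shows "(\<lambda>k. err p k v) \<longlonglongrightarrow> 0"
proof (rule Lpow_conv_diff_tendsto_by_approx[OF p v])
  have [measurable]: "v \<in> borel_measurable borel" using v by auto
  define w where "w M x = (if norm (v x) \<le> real M then v x else 0)" for M x
  have [measurable]: "w M \<in> borel_measurable borel" for M unfolding w_def by measurable
  have w_int: "integrable lborel (w M)" for M
    by (rule Bochner_Integration.integrable_bound[OF v]) (auto simp: w_def)
  have w_le: "norm (w M x) \<le> real M" for M x by (simp add: w_def)
  have "(\<lambda>M. \<integral>\<^sup>+ x. ennreal (norm (v x - w M x) powr p) \<partial>lborel) \<longlonglongrightarrow> (\<integral>\<^sup>+ x. 0 \<partial>(lborel :: 'a measure))"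
  proof (rule nn_integral_dominated_convergence[where w="\<lambda>x. ennreal (norm (v x) powr p)"])
    show "(\<integral>\<^sup>+ x. ennreal (norm (v x) powr p) \<partial>lborel) < \<infinity>" using fin by (simp add: Lpow_def)
    show "AE x in lborel. ennreal (norm (v x - w j x) powr p) \<le> ennreal (norm (v x) powr p)" for j
      by (auto simp: w_def)
    have "(\<lambda>M. ennreal (norm (v x - w M x) powr p)) \<longlonglongrightarrow> 0" for x
    proof -
      obtain N where N: "norm (v x) \<le> real N" using real_arch_simple by blast
      then have "ennreal (norm (v x - w M x) powr p) = 0" if "M \<ge> N" for M
        using that by (auto simp: w_def dest: order_trans[of "norm (v x)" "real N" "real M"])
      then show ?thesis by (intro tendsto_eventually) (auto simp: eventually_sequentially)
    qed
    then show "AE x in lborel. (\<lambda>M. ennreal (norm (v x - w M x) powr p)) \<longlonglongrightarrow> 0" by simp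
  qed auto
  then have L: "(\<lambda>M. Lpow p (\<lambda>x. v x - w M x)) \<longlonglongrightarrow> 0" by (simp add: Lpow_def)
  fix e :: real assume "e > 0"
  then obtain M where M: "Lpow p (\<lambda>x. v x - w M x) \<le> ennreal e"
    using ennreal_tendsto_0D[OF L] by (auto simp: eventually_sequentially)
  have c_le: "norm (conv (\<eta> k) (w M) x) \<le> real M" for k x
  proof -
    have "norm (conv (\<eta> k) (w M) x) \<le> (\<integral>y. norm (\<eta> k (x - y) *\<^sub>R w M y) \<partial>lborel)"
      unfolding conv_def by (rule integral_norm_bound)
    also have "\<dots> \<le> (\<integral>y. \<eta> k (x - y) * real M \<partial>lborel)"
      using integrable_kernel[OF w_int] kernel_has_integral[of k x]
      by (intro integral_mono integrable_norm) (auto simp: kernel_nonneg has_bochner_integral_iff intro!: mult_left_mono w_le)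
    also have "\<dots> = real M" using kernel_has_integral[of k x] by (simp add: has_bochner_integral_iff)
    finally show ?thesis .
  qed
  have bound: "Lpow p (\<lambda>x. conv (\<eta> k) (w M) x - w M x) \<le>
     ennreal ((2 * real M) powr (p - 1)) * Lpow 1 (\<lambda>x. conv (\<eta> k) (w M) x - w M x)" for k
  proof -
    have "norm (conv (\<eta> k) (w M) x - w M x) powr p \<le>
       (2 * real M) powr (p - 1) * norm (conv (\<eta> k) (w M) x - w M x)" for x
    proof -
      let ?t = "norm (conv (\<eta> k) (w M) x - w M x)"
      have "?t \<le> 2 * real M" using norm_triangle_ineq4[of "conv (\<eta> k) (w M) x" "w M x"] c_le[of k x] w_le[of M x] by simp
      then have "?t powr (p - 1) \<le> (2 * real M) powr (p - 1)" using p by (intro powr_mono2) auto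
      moreover have "?t powr p = ?t powr (p - 1) * ?t"
        using powr_mult_base[of ?t "p - 1"] by (simp add: mult.commute)
      ultimately show ?thesis by (simp add: mult_right_mono)
    qed
    then have "Lpow p (\<lambda>x. conv (\<eta> k) (w M) x - w M x) \<le>
      (\<integral>\<^sup>+ x. ennreal ((2 * real M) powr (p - 1)) * ennreal (norm (conv (\<eta> k) (w M) x - w M x)) \<partial>lborel)"
      unfolding Lpow_def by (intro nn_integral_mono) (simp flip: ennreal_mult)
    also have "\<dots> = ennreal ((2 * real M) powr (p - 1)) * Lpow 1 (\<lambda>x. conv (\<eta> k) (w M) x - w M x)"
      unfolding Lpow_1 by (rule nn_integral_cmult) measurable
    finally show ?thesis .
  qed
  have "(\<lambda>k. ennreal ((2 * real M) powr (p - 1)) * Lpow 1 (\<lambda>x. conv (\<eta> k) (w M) x - w M x)) \<longlonglongrightarrow> 0"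
    by (intro ennreal_tendsto_0_cmult conv_tendsto_L1 w_int) simp
  then have "(\<lambda>k. Lpow p (\<lambda>x. conv (\<eta> k) (w M) x - w M x)) \<longlonglongrightarrow> 0"
    by (rule ennreal_tendsto_0_le) (rule bound)
  then show "\<exists>w. integrable lborel w \<and> Lpow p (\<lambda>x. v x - w x) \<le> ennreal e \<and>
      (\<lambda>k. err p k w) \<longlonglongrightarrow> 0"
    using M w_int by blast
qed

end

section \<open>Mollification and weak derivatives\<close>

lemma exists_smooth_approx_identity:
  obtains \<eta> :: "nat \<Rightarrow> real^'n::finite \<Rightarrow> real"
  where "approx_identity \<eta>" "\<And>k. \<eta> k \<in> test_functions UNIV"
proof -
  define f where "f k = (\<lambda>x::real^'n. flat 1 ((1 / real (Suc k))\<^sup>2 - x \<bullet> x))" for k :: nat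
  have pos: "1 / real (Suc k) > 0" for k by simp
  have f: "smooth (f k)" "f k x \<ge> 0" "f k x \<noteq> 0 \<longleftrightarrow> norm x < 1 / Suc k" for k x
    unfolding f_def by (rule smooth_bump[OF pos])+
  have test: "f k \<in> test_functions UNIV" for k
  proof (rule test_functionsI[OF f(1)])
    show "f k x = 0" if "x \<notin> cball 0 (1 / Suc k)" for x
      using that f(3)[of k x] by (metis dist_0_norm less_imp_le mem_cball)
  qed auto
  define c where "c k = integral\<^sup>L lborel (f k)" for k
  have c: "c k > 0" for k
  proof -
    \<comment> \<open>A vanishing integral would make the ball on which the bump is positive a null
      set.\<close>
    have "c k \<noteq> 0"
    proof
      assume "c k = 0"
      then have "AE x in lborel. f k x = 0"
        unfolding c_def using integral_nonneg_eq_0_iff_AE[OF integrable_test_function[OF test]] f by auto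
      then have "AE x in lborel. (x :: real^'n) \<notin> ball 0 (1 / Suc k)"
        by (rule eventually_mono) (use f(3)[of k] in \<open>auto simp del: of_nat_Suc\<close>)
      then have "ball 0 (1 / Suc k) \<in> null_sets (lborel :: (real^'n) measure)"
        by (subst AE_iff_null_sets) auto
      then show False
        using open_not_negligible[of "ball (0::real^'n) (1 / Suc k)"] pos[of k]
        by (auto simp: negligible_iff_null_sets null_sets_completionI simp del: of_nat_Suc)
    qed
    moreover have "c k \<ge> 0" unfolding c_def by (rule integral_nonneg_AE) (use f in auto)
    ultimately show ?thesis by simp
  qed
  define \<eta> where "\<eta> k = (\<lambda>x. f k x *\<^sub>R (1 / c k))" for k
  have \<eta>: "\<eta> k \<in> test_functions UNIV" for k
    unfolding \<eta>_def by (rule test_functions_scaleR_smooth[OF test]) simp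
  have "approx_identity \<eta>"
  proof
    show "\<eta> k \<in> borel_measurable borel" for k using borel_measurable_test_function[OF \<eta>] .
    show "\<exists>B. \<forall>x. \<eta> k x \<le> B" for k
      using test_function_bounded[OF \<eta>, of k] by (metis abs_le_D1 real_norm_def)
    show nn: "0 \<le> \<eta> k x" for k x using f c[of k] by (simp add: \<eta>_def)
    have "(\<integral>x. \<eta> k x \<partial>lborel) = 1" for k
      using c[of k] by (simp add: \<eta>_def c_def[symmetric])
    then show "(\<integral>\<^sup>+ x. ennreal (\<eta> k x) \<partial>lborel) = 1" for k
      using nn_integral_eq_integral[OF integrable_test_function[OF \<eta>, of k]] nn by simp
    show "\<eta> k x = 0" if "1 / Suc k \<le> norm x" for k x
      using that f(3)[of k x] by (auto simp: \<eta>_def)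
  qed
  with \<eta> that show thesis by blast
qed

section \<open>Convolution with a smooth kernel\<close>

lemma norm_sum_components_le:
  fixes a :: "'n::finite \<Rightarrow> 'b::real_normed_vector"
  assumes "\<And>i. norm (a i) \<le> B"
  shows "norm (\<Sum>i\<in>UNIV. (h $ i) *\<^sub>R a i) \<le> (real CARD('n) * B) * norm (h :: real^'n)"
proof -
  have "norm (\<Sum>i\<in>UNIV. (h $ i) *\<^sub>R a i) \<le> (\<Sum>i\<in>(UNIV::'n set). norm h * B)"
  proof (rule sum_norm_le)
    fix i
    show "norm ((h $ i) *\<^sub>R a i) \<le> norm h * B"
      using component_le_norm_cart[of h i] assms[of i]
      by (auto intro!: mult_mono)
  qed
  then show ?thesis by (simp add: algebra_simps)
qed

lemma test_function_lipschitz: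
  fixes f :: "real^'n::finite \<Rightarrow> 'b::real_normed_vector"
  assumes f: "f \<in> test_functions \<Omega>"
  obtains L where "L > 0" "\<And>x y. norm (f x - f y) \<le> L * norm (x - y)"
proof -
  have "\<exists>B>0. \<forall>x. norm (partial i f x) \<le> B" for i
    using test_function_bounded[OF test_functions_partial[OF f, of i]] by metis
  then obtain B where B: "\<And>i. B i > 0" "\<And>i x. norm (partial i f x) \<le> B i" by metis
  define M where "M = sum B UNIV"
  have BM: "B i \<le> M" for i unfolding M_def by (rule member_le_sum) (use B(1) in \<open>auto intro: less_imp_le\<close>)
  have M: "M > 0" using B(1)[of undefined] BM[of undefined] by linarith
  define L where "L = real CARD('n) * M"
  have "norm (f x - f y) \<le> L * norm (x - y)" for x y
  proof (rule differentiable_bound[where S=UNIV])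
    show "(f has_derivative (\<lambda>h. \<Sum>i\<in>UNIV. (h $ i) *\<^sub>R partial i f x)) (at x within UNIV)" for x
      using has_derivative_partials[OF smooth_differentiable[OF test_functionsD(1)[OF f]]] .
    show "onorm (\<lambda>h. \<Sum>i\<in>UNIV. (h $ i) *\<^sub>R partial i f x) \<le> L" for x
      unfolding L_def by (rule onorm_le) (rule norm_sum_components_le, rule order_trans[OF B(2) BM])
  qed auto
  moreover have "L > 0" using M by (simp add: L_def)
  ultimately show thesis using that by blast
qed

text \<open>The partials are globally Lipschitz by compact support, which gives a quadratic
  remainder with one constant for all pairs of points. This uniformity lets a convolution with a
  merely integrable function be differentiated.\<close>

lemma test_function_taylor:
  fixes f :: "real^'n::finite \<Rightarrow> 'b::real_normed_vector"
  assumes f: "f \<in> test_functions \<Omega>"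
  obtains C where "C > 0"
    "\<And>x y. norm (f y - f x - (\<Sum>i\<in>UNIV. ((y - x) $ i) *\<^sub>R partial i f x)) \<le> C * (norm (y - x))\<^sup>2"
proof -
  have "\<exists>L>0. \<forall>x y. norm (partial i f x - partial i f y) \<le> L * norm (x - y)" for i
    using test_function_lipschitz[OF test_functions_partial[OF f, of i]] by metis
  then obtain L where L: "\<And>i. L i > 0" "\<And>i x y. norm (partial i f x - partial i f y) \<le> L i * norm (x - y)"
    by metis
  define M where "M = sum L UNIV"
  have LM: "L i \<le> M" for i unfolding M_def by (rule member_le_sum) (use L(1) in \<open>auto intro: less_imp_le\<close>)
  have M: "M > 0" using L(1)[of undefined] LM[of undefined] by linarith
  define C where "C = real CARD('n) * M"
  let ?D = "\<lambda>x h. \<Sum>i\<in>UNIV. (h $ i) *\<^sub>R partial i f x"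
  have "norm (f y - f x - ?D x (y - x)) \<le> norm (y - x) * (C * norm (y - x))" for x y
  proof (rule differentiable_bound_linearization[where S="closed_segment x y" and f'="?D"])
    show "x + t *\<^sub>R (y - x) \<in> closed_segment x y" if "t \<in> {0..1}" for t
      using that by (auto simp: closed_segment_def algebra_simps intro!: exI[of _ t])
    show "(f has_derivative ?D z) (at z within closed_segment x y)" for z
      using has_derivative_partials[OF smooth_differentiable[OF test_functionsD(1)[OF f]]]
      by (rule has_derivative_at_withinI)
    show "onorm (?D z - ?D x) \<le> C * norm (y - x)" if z: "z \<in> closed_segment x y" for z
    proof (rule onorm_le)
      fix h :: "real^'n"
      have eq: "(?D z - ?D x) h = (\<Sum>i\<in>UNIV. (h $ i) *\<^sub>R (partial i f z - partial i f x))"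
        by (simp add: sum_subtractf scaleR_diff_right)
      have "norm (partial i f z - partial i f x) \<le> M * norm (y - x)" for i
      proof -
        have "norm (z - x) \<le> norm (y - x)" using segment_bound1[OF z] .
        then have "L i * norm (z - x) \<le> M * norm (y - x)"
          using LM[of i] M L(1)[of i] by (intro mult_mono) auto
        then show ?thesis using L(2)[of i z x] by linarith
      qed
      from norm_sum_components_le[OF this, of h]
      show "norm ((?D z - ?D x) h) \<le> C * norm (y - x) * norm h"
        unfolding eq C_def by (simp add: mult.assoc)
    qed
  qed auto
  moreover have "C > 0" using M by (simp add: C_def)
  ultimately show thesis using that[of C] by (simp add: power2_eq_square mult.left_commute)
qed

lemma integrable_conv_test:
  fixes v :: "real^'n::finite \<Rightarrow> 'b::{banach,second_countable_topology}"
  assumes "\<eta> \<in> test_functions \<Omega>" "integrable lborel v"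
  shows "integrable lborel (\<lambda>y. \<eta> (x - y) *\<^sub>R v y)"
proof -
  obtain B where "\<And>x. norm (\<eta> x) \<le> B" using test_function_bounded[OF assms(1)] by metis
  then show ?thesis
    by (intro integrable_conv_kernel[OF borel_measurable_test_function[OF assms(1)] _ assms(2)]) auto
qed

text \<open>Integrating the uniform Taylor remainder of the kernel against \<open>v\<close> bounds
  the linearization error by C |z - x|^2 times the L^1 norm of \<open>v\<close>; no limit theorem
  for integrals is involved.\<close>

lemma conv_has_derivative:
  assumes \<eta>: "\<eta> \<in> test_functions \<Omega>" and v: "integrable lborel v"
  shows "(conv \<eta> v has_derivative (\<lambda>h. \<Sum>i\<in>UNIV. (h $ i) *\<^sub>R conv (partial i \<eta>) v x)) (at x)"
proof -
  obtain C where C: "C > 0"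
    "\<And>x y. norm (\<eta> y - \<eta> x - (\<Sum>i\<in>UNIV. ((y - x) $ i) *\<^sub>R partial i \<eta> x)) \<le> C * (norm (y - x))\<^sup>2"
    using test_function_taylor[OF \<eta>] by metis
  define I where "I = (\<integral>y. norm (v y) \<partial>lborel)"
  let ?D = "\<lambda>h. \<Sum>i\<in>UNIV. (h $ i) *\<^sub>R conv (partial i \<eta>) v x"
  note int = integrable_conv_test[OF \<eta> v]
  note int' = integrable_conv_test[OF test_functions_partial[OF \<eta>] v]
  have key: "norm (conv \<eta> v z - conv \<eta> v x - ?D (z - x)) \<le> (C * I) * (norm (z - x))\<^sup>2" for z
  proof -
    let ?R = "\<lambda>y. \<eta> (z - y) - \<eta> (x - y) - (\<Sum>i\<in>UNIV. ((z - x) $ i) *\<^sub>R partial i \<eta> (x - y))"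
    have R: "(\<lambda>y. ?R y *\<^sub>R v y) = (\<lambda>y. \<eta> (z - y) *\<^sub>R v y - \<eta> (x - y) *\<^sub>R v y -
        (\<Sum>i\<in>UNIV. ((z - x) $ i) *\<^sub>R (partial i \<eta> (x - y) *\<^sub>R v y)))"
      by (simp add: scaleR_diff_left scaleR_sum_left)
    have Rint: "integrable lborel (\<lambda>y. ?R y *\<^sub>R v y)"
      unfolding R by (intro Bochner_Integration.integrable_diff Bochner_Integration.integrable_sum
          integrable_scaleR_right int int')
    have eq: "conv \<eta> v z - conv \<eta> v x - ?D (z - x) = (\<integral>y. ?R y *\<^sub>R v y \<partial>lborel)"
      unfolding R conv_def by (simp del: scaleR_scaleR add: int int' Bochner_Integration.integral_diff Bochner_Integration.integral_sum
          Bochner_Integration.integrable_sum)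
    have "norm (\<integral>y. ?R y *\<^sub>R v y \<partial>lborel) \<le> (\<integral>y. norm (?R y *\<^sub>R v y) \<partial>lborel)" by (rule integral_norm_bound)
    also have "\<dots> \<le> (\<integral>y. (C * (norm (z - x))\<^sup>2) * norm (v y) \<partial>lborel)"
    proof (rule integral_mono)
      fix y
      have "norm (?R y) \<le> C * (norm (z - x))\<^sup>2" using C(2)[of "z - y" "x - y"] by simp
      then show "norm (?R y *\<^sub>R v y) \<le> (C * (norm (z - x))\<^sup>2) * norm (v y)"
        unfolding norm_scaleR real_norm_def by (rule mult_right_mono) simp
    next
      show "integrable lborel (\<lambda>y. norm (?R y *\<^sub>R v y))" by (rule integrable_norm[OF Rint])
      show "integrable lborel (\<lambda>y. (C * (norm (z - x))\<^sup>2) * norm (v y))" using v by auto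
    qed
    also have "\<dots> = (C * I) * (norm (z - x))\<^sup>2" by (simp add: I_def)
    finally show ?thesis unfolding eq .
  qed
  show ?thesis
  proof (rule has_derivativeI_sandwich[where e=1 and H="\<lambda>z. (C * I) * norm (z - x)"])
    show "bounded_linear ?D"
      by (intro bounded_linear_sum bounded_linear_scaleR_left[THEN bounded_linear_compose] bounded_linear_vec_nth)
    show "norm ((conv \<eta> v z - conv \<eta> v x) - ?D (z - x)) / norm (z - x) \<le> (C * I) * norm (z - x)"
      if "z \<noteq> x" for z
      using key[of z] that by (simp add: divide_le_eq power2_eq_square mult.assoc)
    have "((\<lambda>z. C * I * norm (z - x)) \<longlongrightarrow> C * I * norm (x - x)) (at x)"
      by (intro tendsto_intros)
    then show "((\<lambda>z. C * I * norm (z - x)) \<longlongrightarrow> 0) (at x)" by simp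
  qed simp
qed

lemma partial_conv:
  assumes \<eta>: "\<eta> \<in> test_functions \<Omega>" and v: "integrable lborel v"
  shows "partial i (conv \<eta> v) = conv (partial i \<eta>) v"
proof
  fix x
  have "partial i (conv \<eta> v) x = (\<Sum>j\<in>UNIV. (if j = i then conv (partial j \<eta>) v x else 0))"
    unfolding partial_of_has_derivative[OF conv_has_derivative[OF \<eta> v]]
    by (intro sum.cong) (auto simp: axis_def)
  then show "partial i (conv \<eta> v) x = conv (partial i \<eta>) v x" by simp
qed

lemma smooth_conv:
  assumes \<eta>: "\<eta> \<in> test_functions \<Omega>" and v: "integrable lborel v"
  shows "smooth (conv \<eta> v)"
proof -
  have diff: "conv \<eta> v differentiable at x" if "\<eta> \<in> test_functions \<Omega>" for \<eta> x
    using conv_has_derivative[OF that v] unfolding differentiable_def by blast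
  have "C_k k (conv \<eta> v)" if "\<eta> \<in> test_functions \<Omega>" for k \<eta>
    using that
  proof (induction k arbitrary: \<eta>)
    case 0
    then show ?case
      by (auto simp: continuous_on_eq_continuous_within intro!: differentiable_imp_continuous_within diff)
  next
    case (Suc k)
    then show ?case
      using diff by (auto simp: partial_conv[OF _ v] test_functions_partial)
  qed
  with \<eta> show ?thesis by (simp add: smooth_def)
qed

text \<open>The convolution lives on the Minkowski sum of \<open>K\<close> and the closed ball of
  radius \<open>d\<close>. The second conclusion records this, for reading off where a cut-off
  vanishes.\<close>

lemma conv_test_function:
  assumes \<eta>: "\<eta> \<in> test_functions UNIV" and v: "integrable lborel v"
    and K: "compact K" "\<And>x. x \<notin> K \<Longrightarrow> v x = 0"
    and d: "\<And>x. d \<le> norm x \<Longrightarrow> \<eta> x = 0" and sub: "\<And>x y. y \<in> K \<Longrightarrow> norm (x - y) \<le> d \<Longrightarrow> x \<in> \<Omega>"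
  shows "conv \<eta> v \<in> test_functions \<Omega>"
    and "\<And>x. conv \<eta> v x \<noteq> 0 \<Longrightarrow> \<exists>y\<in>K. norm (x - y) \<le> d"
proof -
  show *: "\<exists>y\<in>K. norm (x - y) \<le> d" if "conv \<eta> v x \<noteq> 0" for x
  proof (rule ccontr)
    assume "\<not> (\<exists>y\<in>K. norm (x - y) \<le> d)"
    then have "(\<lambda>y. \<eta> (x - y) *\<^sub>R v y) = (\<lambda>y. 0)"
      using K(2) d by (intro ext) (metis linorder_linear scaleR_eq_0_iff)
    then have "conv \<eta> v x = 0" unfolding conv_def by simp
    with that show False by simp
  qed
  let ?K = "{a + b | a b. a \<in> K \<and> b \<in> cball 0 d}"
  show "conv \<eta> v \<in> test_functions \<Omega>"
  proof (rule test_functionsI[OF smooth_conv[OF \<eta> v]])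
    show "compact ?K" by (rule compact_sums) (use K in auto)
    show "?K \<subseteq> \<Omega>" using sub by fastforce
    show "conv \<eta> v x = 0" if "x \<notin> ?K" for x
    proof (rule ccontr)
      assume "conv \<eta> v x \<noteq> 0"
      then obtain y where "y \<in> K" "norm (x - y) \<le> d" using * by blast
      then have "x = y + (x - y) \<and> y \<in> K \<and> x - y \<in> cball 0 d" by simp
      with that show False by blast
    qed
  qed
qed

text \<open>The weak derivative for functions integrable on the whole space, so that convolutions
  make sense without restricting the point. The identity itself is still tested on
  \<open>\<Omega>\<close> only.\<close>

definition weak_pair ::
    "(real^'n::finite) set \<Rightarrow> 'n \<Rightarrow> (real^'n \<Rightarrow> 'b::{banach,second_countable_topology}) \<Rightarrow> (real^'n \<Rightarrow> 'b) \<Rightarrow> bool"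
  where "weak_pair \<Omega> i u g \<longleftrightarrow> integrable lborel u \<and> integrable lborel g \<and>
    (\<forall>\<phi> :: real^'n \<Rightarrow> real. \<phi> \<in> test_functions \<Omega> \<longrightarrow>
      (\<integral>x. partial i \<phi> x *\<^sub>R u x \<partial>lborel) = - (\<integral>x. \<phi> x *\<^sub>R g x \<partial>lborel))"

lemma integrable_test_scaleR:
  fixes v :: "real^'n::finite \<Rightarrow> 'b::{banach,second_countable_topology}" and \<zeta> :: "real^'n \<Rightarrow> real"
  assumes "\<zeta> \<in> test_functions \<Omega>" "integrable lborel v"
  shows "integrable lborel (\<lambda>y. \<zeta> y *\<^sub>R v y)"
proof -
  obtain B where "B > 0" and B: "\<And>x. norm (\<zeta> x) \<le> B" using test_function_bounded[OF assms(1)] by metis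
  show ?thesis
  proof (rule Bochner_Integration.integrable_bound)
  show "integrable lborel (\<lambda>y. B *\<^sub>R v y)" using assms by simp
  show "(\<lambda>y. \<zeta> y *\<^sub>R v y) \<in> borel_measurable lborel"
    using borel_measurable_test_function[OF assms(1)] assms(2) by simp
  show "AE y in lborel. norm (\<zeta> y *\<^sub>R v y) \<le> norm (B *\<^sub>R v y)"
    using B \<open>B > 0\<close> by (auto intro!: mult_right_mono)
  qed
qed

lemma conv_add_test:
  assumes "\<eta> \<in> test_functions \<Omega>" "integrable lborel v" "integrable lborel w"
  shows "conv \<eta> (\<lambda>x. v x + w x) = (\<lambda>x. conv \<eta> v x + conv \<eta> w x)"
  unfolding conv_def scaleR_add_right
  by (intro ext Bochner_Integration.integral_add integrable_conv_test[OF assms(1)] assms)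

text \<open>Mollification commutes with weak differentiation: the derivative is put on the kernel,
  and the product of \<open>\<zeta>\<close> with the reflected kernel serves as test function. The
  cut-off gives the product rule term and removes any condition on the distance of x to the
  boundary.\<close>

lemma partial_conv_weak:
  assumes \<eta>: "\<eta> \<in> test_functions UNIV" and \<zeta>: "\<zeta> \<in> test_functions \<Omega>" and ug: "weak_pair \<Omega> i u g"
  shows "partial i (conv \<eta> (\<lambda>y. \<zeta> y *\<^sub>R u y)) = conv \<eta> (\<lambda>y. \<zeta> y *\<^sub>R g y + partial i \<zeta> y *\<^sub>R u y)"
proof
  fix x
  have u: "integrable lborel u" and g: "integrable lborel g" using ug by (auto simp: weak_pair_def)
  define \<phi> where "\<phi> y = \<zeta> y *\<^sub>R \<eta> (x - y)" for y
  have sm: "smooth (\<lambda>y. \<eta> (x - y))" using test_functions_reflect[OF \<eta>] by (rule test_functionsD)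
  \<comment> \<open>The support lies in \<open>\<Omega>\<close> because of the factor
    \<open>\<zeta>\<close>, wherever the kernel is centred.\<close>
  have \<phi>: "\<phi> \<in> test_functions \<Omega>"
    unfolding \<phi>_def by (rule test_functions_scaleR_smooth[OF \<zeta> sm])
  note int1 = integrable_conv_test[OF \<eta> integrable_test_scaleR[OF \<zeta> g]]
  note int2 = integrable_conv_test[OF \<eta> integrable_test_scaleR[OF test_functions_partial[OF \<zeta>] u]]
  note int3 = integrable_conv_test[OF test_functions_partial[OF \<eta>] integrable_test_scaleR[OF \<zeta> u]]
  have d: "partial i \<phi> y = partial i \<zeta> y * \<eta> (x - y) - \<zeta> y * partial i \<eta> (x - y)" for y
    unfolding \<phi>_def
    by (subst partial_scaleR)
      (auto simp: partial_reflect smooth_differentiable sm test_functionsD(1)[OF \<zeta>] test_functionsD(1)[OF \<eta>])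
  have "conv (partial i \<eta>) (\<lambda>y. \<zeta> y *\<^sub>R u y) x =
     (\<integral>y. \<eta> (x - y) *\<^sub>R (partial i \<zeta> y *\<^sub>R u y) - partial i \<phi> y *\<^sub>R u y \<partial>lborel)"
    unfolding conv_def d by (simp add: scaleR_diff_left mult.commute)
  also have "\<dots> = (\<integral>y. \<eta> (x - y) *\<^sub>R (partial i \<zeta> y *\<^sub>R u y) \<partial>lborel) - (\<integral>y. partial i \<phi> y *\<^sub>R u y \<partial>lborel)"
    using int2 integrable_test_scaleR[OF test_functions_partial[OF \<phi>] u] by (rule Bochner_Integration.integral_diff)
  also have "(\<integral>y. partial i \<phi> y *\<^sub>R u y \<partial>lborel) = - (\<integral>y. \<phi> y *\<^sub>R g y \<partial>lborel)"
    using ug \<phi> by (simp add: weak_pair_def)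
  also have "(\<integral>y. \<phi> y *\<^sub>R g y \<partial>lborel) = (\<integral>y. \<eta> (x - y) *\<^sub>R (\<zeta> y *\<^sub>R g y) \<partial>lborel)"
    by (simp add: \<phi>_def mult.commute)
  also have "(\<integral>y. \<eta> (x - y) *\<^sub>R (partial i \<zeta> y *\<^sub>R u y) \<partial>lborel) - - \<dots> =
      conv \<eta> (\<lambda>y. \<zeta> y *\<^sub>R g y + partial i \<zeta> y *\<^sub>R u y) x"
    unfolding conv_def scaleR_add_right using int1 int2 by simp
  finally show "partial i (conv \<eta> (\<lambda>y. \<zeta> y *\<^sub>R u y)) x = \<dots>"
    by (simp add: partial_conv[OF \<eta> integrable_test_scaleR[OF \<zeta> u]])
qed

text \<open>The previous rule applied to \<open>\<zeta> u\<close>, then to \<open>\<zeta> g\<close>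
  and to the product rule term; the two cross terms coincide and produce the factor 2.\<close>

lemma partial_partial_conv_weak:
  assumes \<eta>: "\<eta> \<in> test_functions UNIV" and \<zeta>: "\<zeta> \<in> test_functions \<Omega>"
    and ug: "weak_pair \<Omega> i u g" and gh: "weak_pair \<Omega> i g h"
  shows "partial i (partial i (conv \<eta> (\<lambda>y. \<zeta> y *\<^sub>R u y))) =
    conv \<eta> (\<lambda>y. \<zeta> y *\<^sub>R h y + 2 *\<^sub>R partial i \<zeta> y *\<^sub>R g y + partial i (partial i \<zeta>) y *\<^sub>R u y)"
proof
  fix x
  have u: "integrable lborel u" and g: "integrable lborel g" and h: "integrable lborel h"
    using ug gh by (auto simp: weak_pair_def)
  note \<zeta>' = test_functions_partial[OF \<zeta>]
  note \<zeta>'' = test_functions_partial[OF \<zeta>']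
  note int = integrable_test_scaleR[OF \<zeta> u] integrable_test_scaleR[OF \<zeta> g] integrable_test_scaleR[OF \<zeta> h]
    integrable_test_scaleR[OF \<zeta>' u] integrable_test_scaleR[OF \<zeta>' g] integrable_test_scaleR[OF \<zeta>'' u]
  have "partial i (partial i (conv \<eta> (\<lambda>y. \<zeta> y *\<^sub>R u y))) x =
    partial i (\<lambda>x. conv \<eta> (\<lambda>y. \<zeta> y *\<^sub>R g y) x + conv \<eta> (\<lambda>y. partial i \<zeta> y *\<^sub>R u y) x) x"
    by (simp add: partial_conv_weak[OF \<eta> \<zeta> ug] conv_add_test[OF \<eta>] int)
  also have "\<dots> = partial i (conv \<eta> (\<lambda>y. \<zeta> y *\<^sub>R g y)) x + partial i (conv \<eta> (\<lambda>y. partial i \<zeta> y *\<^sub>R u y)) x"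
    by (intro partial_add smooth_differentiable smooth_conv[OF \<eta>] int)
  also have "\<dots> = conv \<eta> (\<lambda>y. (\<zeta> y *\<^sub>R h y + partial i \<zeta> y *\<^sub>R g y) + (partial i \<zeta> y *\<^sub>R g y + partial i (partial i \<zeta>) y *\<^sub>R u y)) x"
    by (simp add: partial_conv_weak[OF \<eta> \<zeta> gh] partial_conv_weak[OF \<eta> \<zeta>' ug] conv_add_test[OF \<eta>] int)
  also have "\<dots> = conv \<eta> (\<lambda>y. \<zeta> y *\<^sub>R h y + 2 *\<^sub>R partial i \<zeta> y *\<^sub>R g y + partial i (partial i \<zeta>) y *\<^sub>R u y) x"
    by (simp only: scaleR_2 add.assoc)
  finally show "partial i (partial i (conv \<eta> (\<lambda>y. \<zeta> y *\<^sub>R u y))) x = \<dots>" .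
qed

section \<open>Interpolation of first derivatives\<close>

lemma smooth_line_derivative:
  fixes f :: "real^'n::finite \<Rightarrow> 'b::real_normed_vector"
  assumes "smooth f"
  shows "((\<lambda>s. f (x + s *\<^sub>R axis i 1)) has_vector_derivative partial i f (x + s *\<^sub>R axis i 1)) (at s within S)"
proof -
  let ?y = "x + s *\<^sub>R axis i 1" and ?D = "frechet_derivative f (at (x + s *\<^sub>R axis i 1))"
  have D: "(f has_derivative ?D) (at ?y)"
    using smooth_differentiable[OF assms] by (simp add: frechet_derivative_works)
  have "((\<lambda>s. f (x + s *\<^sub>R axis i 1)) has_derivative (\<lambda>h. ?D (h *\<^sub>R axis i 1))) (at s within S)"
    by (rule has_derivative_compose[where f="\<lambda>s. x + s *\<^sub>R axis i 1", OF _ D])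
      (auto intro!: derivative_eq_intros)
  then show ?thesis
    by (simp add: has_vector_derivative_def partial_def linear_scale[OF has_derivative_linear[OF D]])
qed

text \<open>On the line through x, the error of linearizing f over length t is at most t times the
  oscillation of the first derivative, and this oscillation is at most the integral of the second
  derivative. Dividing by t gives the bound.\<close>

lemma smooth_partial_interpolation:
  fixes f :: "real^'n::finite \<Rightarrow> 'b::banach"
  assumes f: "smooth f" and t: "t > 0"
  shows "norm (partial i f x) \<le> (norm (f (x + t *\<^sub>R axis i 1)) + norm (f x)) / t
    + integral {0..t} (\<lambda>r. norm (partial i (partial i f) (x + r *\<^sub>R axis i 1)))"
proof -
  let ?a = "\<lambda>s. x + s *\<^sub>R axis i 1"
  let ?N = "\<lambda>r. norm (partial i (partial i f) (?a r))"
  have cont: "continuous_on S ?N" for S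
    by (intro continuous_intros continuous_on_compose2[OF smooth_continuous_on[OF smooth_partial[OF smooth_partial[OF f]], of UNIV]]) auto
  have B: "norm (partial i f (?a s) - partial i f (?a 0)) \<le> integral {0..t} ?N" if s: "s \<in> {0..t}" for s
  proof -
    have "((\<lambda>r. partial i (partial i f) (?a r)) has_integral (partial i f (?a s) - partial i f (?a 0))) {0..s}"
      by (rule fundamental_theorem_of_calculus)
        (use s in \<open>auto intro!: smooth_line_derivative[OF smooth_partial[OF f]]\<close>)
    then have "norm (partial i f (?a s) - partial i f (?a 0)) \<le> integral {0..s} ?N"
      using integral_norm_bound_integral[of "\<lambda>r. partial i (partial i f) (?a r)" "{0..s}" ?N]
        integrable_continuous_real[OF cont, of 0 s] by (auto simp: has_integral_iff)
    also have "\<dots> \<le> integral {0..t} ?N"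
      by (rule integral_subset_le) (use s integrable_continuous_real[OF cont] in auto)
    finally show ?thesis .
  qed
  have "norm (f (?a t) - f (?a 0) - (t - 0) *\<^sub>R partial i f (?a 0)) \<le> norm (t - 0) * integral {0..t} ?N"
    by (rule vector_differentiable_bound_linearization[where S="{0..t}" and f="\<lambda>s. f (?a s)" and f'="\<lambda>s. partial i f (?a s)"])
      (use t B in \<open>auto intro!: smooth_line_derivative[OF f] simp: closed_segment_eq_real_ivl\<close>)
  then have "norm (f (?a t) - f x - t *\<^sub>R partial i f x) \<le> t * integral {0..t} ?N"
    using t by simp
  moreover have "norm (t *\<^sub>R partial i f x) \<le> norm (f (?a t) - f x - t *\<^sub>R partial i f x) + norm (f (?a t)) + norm (f x)"
    using norm_triangle_sub[of "t *\<^sub>R partial i f x" "f (?a t) - f x"] norm_triangle_ineq4[of "f (?a t)" "f x"]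
    by (simp add: norm_minus_commute)
  ultimately have "t * norm (partial i f x) \<le> t * integral {0..t} ?N + norm (f (?a t)) + norm (f x)"
    using t by simp
  then show ?thesis using t by (simp add: field_simps)
qed

text \<open>The integral is t times a mean, and Jensen for the uniform density on [0, t] moves the
  power inside. The density is kept as a weight over the whole line for the later use of
  Tonelli.\<close>

lemma integral_powr_le:
  fixes f :: "real \<Rightarrow> real"
  assumes p: "p \<ge> 1" and t: "t > 0" and f: "continuous_on UNIV f" "\<And>r. f r \<ge> 0"
  shows "ennreal ((integral {0..t} f) powr p) \<le>
    ennreal (t powr p) * (\<integral>\<^sup>+ r. ennreal (indicator {0..t} r / t) * ennreal (f r powr p) \<partial>lborel)"
proof -
  let ?w = "\<lambda>r. indicator {0..t} r / t :: real"
  have [measurable]: "f \<in> borel_measurable borel" using f by (simp add: borel_measurable_continuous_onI)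
  have int: "set_integrable lborel {0..t} f"
    unfolding set_integrable_def by (rule borel_integrable_compact) (auto intro: continuous_on_subset[OF f(1)])
  have "(\<integral>r. ?w r * f r \<partial>lborel) = integral {0..t} f / t"
    using set_borel_integral_eq_integral(2)[OF int] by (simp add: set_lebesgue_integral_def)
  then have eq: "integral {0..t} f = t * (\<integral>r. ?w r * f r \<partial>lborel)" using t by simp
  have nn: "(\<integral>r. ?w r * f r \<partial>lborel) \<ge> 0"
    by (rule integral_nonneg_AE) (use t f in auto)
  have one: "(\<integral>\<^sup>+ r. ennreal (?w r) \<partial>lborel) = 1"
  proof -
    have "(\<integral>\<^sup>+ r. ennreal (?w r) \<partial>lborel) = (\<integral>\<^sup>+ r. ennreal (1 / t) * indicator {0..t} r \<partial>lborel)"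
      by (intro nn_integral_cong) (auto simp: indicator_def)
    also have "\<dots> = ennreal (1 / t) * ennreal t"
      using t by (subst nn_integral_cmult) auto
    finally show ?thesis using t by (simp flip: ennreal_mult)
  qed
  have "ennreal ((integral {0..t} f) powr p) = ennreal (t powr p) * ennreal ((\<integral>r. ?w r * f r \<partial>lborel) powr p)"
    unfolding eq powr_mult by (rule ennreal_mult) auto
  also have "\<dots> \<le> ennreal (t powr p) * (\<integral>\<^sup>+ r. ennreal (?w r * f r powr p) \<partial>lborel)"
  proof (intro mult_left_mono weighted_jensen_powr[OF p])
    show "integrable lborel (\<lambda>r. ?w r * f r)"
      using integrable_mult_right[OF int[unfolded set_integrable_def], of "1 / t"] by (simp add: mult.commute)
  qed (use one t f in auto)
  also have "(\<integral>\<^sup>+ r. ennreal (?w r * f r powr p) \<partial>lborel) = (\<integral>\<^sup>+ r. ennreal (?w r) * ennreal (f r powr p) \<partial>lborel)"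
    using t by (intro nn_integral_cong ennreal_mult) auto
  finally show ?thesis .
qed

text \<open>The pointwise interpolation is raised to the power p and integrated over
  \<open>S\<close>. Only the two end points of each segment must lie in \<open>S'\<close>, because
  the second derivative is measured on the whole space.\<close>

lemma Lpow_partial_interpolation:
  fixes f :: "real^'n::finite \<Rightarrow> 'b::{banach,second_countable_topology}"
  assumes p: "p \<ge> 1" and f: "smooth f" and t: "t > 0"
    and S [measurable]: "S \<in> sets borel" "S' \<in> sets borel"
    and sub: "S \<subseteq> S'" "\<And>x. x \<in> S \<Longrightarrow> x + t *\<^sub>R axis i 1 \<in> S'"
  shows "Lpow_on p S (partial i f) \<le>
    ennreal (4 powr p) * (ennreal (2 * t powr (-p)) * Lpow_on p S' f
      + ennreal (t powr p) * Lpow p (partial i (partial i f)))"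
proof -
  let ?e = "axis i 1 :: real^'n"
  let ?w = "\<lambda>r. indicator {0..t} r / t :: real"
  define H where "H = partial i (partial i f)"
  have [measurable]: "f \<in> borel_measurable borel" "H \<in> borel_measurable borel" "partial i f \<in> borel_measurable borel"
    unfolding H_def by (intro borel_measurable_continuous_onI smooth_continuous_on smooth_partial f)+
  have p0: "p \<ge> 0" using p by simp
  let ?J = "\<lambda>x. \<integral>\<^sup>+ r. ennreal (?w r) * ennreal (norm (H (x + r *\<^sub>R ?e)) powr p) \<partial>lborel"
  let ?F = "\<lambda>x. ennreal (norm (indicator S' x *\<^sub>R f x) powr p)"
  have pt: "ennreal (norm (indicator S x *\<^sub>R partial i f x) powr p) \<le>
     ennreal (4 powr p) * (ennreal (t powr (-p)) * (?F (t *\<^sub>R ?e + x) + ?F x) + ennreal (t powr p) * ?J x)" for x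
  proof (cases "x \<in> S")
    case True
    let ?a = "norm (f (x + t *\<^sub>R ?e))" and ?b = "norm (f x)" and ?c = "integral {0..t} (\<lambda>r. norm (H (x + r *\<^sub>R ?e)))"
    have cont: "continuous_on UNIV (\<lambda>r. norm (H (x + r *\<^sub>R ?e)))"
      unfolding H_def
      by (intro continuous_intros continuous_on_compose2[OF smooth_continuous_on[OF smooth_partial[OF smooth_partial[OF f]], of UNIV]]) auto
    have c0: "?c \<ge> 0" by (rule integral_nonneg) (auto intro!: integrable_continuous_real continuous_on_subset[OF cont])
    have "norm (partial i f x) powr p \<le> ((?a + ?b) / t + ?c) powr p"
      using smooth_partial_interpolation[OF f t, of i x] p0 unfolding H_def by (intro powr_mono2) auto
    also have "\<dots> \<le> 2 powr p * (((?a + ?b) / t) powr p + ?c powr p)"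
      by (rule powr_add_le[OF p0 _ c0]) (use t in auto)
    also have "((?a + ?b) / t) powr p = t powr (-p) * (?a + ?b) powr p"
      using t by (simp add: powr_divide powr_minus_divide)
    also have "2 powr p * (t powr (-p) * (?a + ?b) powr p + ?c powr p) \<le>
      2 powr p * (t powr (-p) * (2 powr p * (?a powr p + ?b powr p)) + 2 powr p * ?c powr p)"
    \<comment> \<open>The integral term is enlarged by a factor 2^p it does not need, so that 4^p
      can be taken out of the whole sum.\<close>
    proof (intro mult_left_mono add_mono powr_add_le p0)
      show "?c powr p \<le> 2 powr p * ?c powr p"
        using ge_one_powr_ge_zero[of 2 p] p0 mult_right_mono[of 1 "2 powr p" "?c powr p"] by simp
    qed auto
    also have "\<dots> = (2 powr p * 2 powr p) * (t powr (-p) * (?a powr p + ?b powr p) + ?c powr p)"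
      by (simp add: algebra_simps)
    also have "2 powr p * 2 powr p = (4::real) powr p" by (simp add: powr_mult[symmetric])
    finally have "ennreal (norm (partial i f x) powr p) \<le>
        ennreal (4 powr p * (t powr (-p) * (?a powr p + ?b powr p) + ?c powr p))"
      by (rule ennreal_leI)
    also have "\<dots> = ennreal (4 powr p) * (ennreal (t powr (-p)) * (ennreal (?a powr p) + ennreal (?b powr p)) + ennreal (?c powr p))"
      by (simp add: ennreal_mult ennreal_plus)
    also have "ennreal (?c powr p) \<le> ennreal (t powr p) * ?J x"
      by (rule integral_powr_le[OF p t cont]) auto
    also have "ennreal (?a powr p) = ?F (t *\<^sub>R ?e + x)" using sub(2)[OF True] by (simp add: add.commute)
    also have "ennreal (?b powr p) = ?F x" using sub(1) True by auto
    finally show ?thesis using True by (simp add: mult_left_mono add_mono)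
  qed simp
  \<comment> \<open>Averaging the translates over r costs nothing: after exchanging the integrals
    each translate contributes the same amount, and the weight has mass 1.\<close>
  have FJ: "(\<integral>\<^sup>+ x. ?J x \<partial>lborel) = Lpow p H"
  proof -
    have "(\<integral>\<^sup>+ x. ?J x \<partial>lborel) = (\<integral>\<^sup>+ r. \<integral>\<^sup>+ x. ennreal (?w r) * ennreal (norm (H (x + r *\<^sub>R ?e)) powr p) \<partial>lborel \<partial>lborel)"
      by (rule lborel_pair.Fubini'[symmetric]) measurable
    also have "\<dots> = (\<integral>\<^sup>+ r. ennreal (?w r) * Lpow p H \<partial>lborel)"
    proof (intro nn_integral_cong)
      fix r
      have "(\<integral>\<^sup>+ x. ennreal (?w r) * ennreal (norm (H (x + r *\<^sub>R ?e)) powr p) \<partial>lborel) =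
        ennreal (?w r) * (\<integral>\<^sup>+ x. ennreal (norm (H (r *\<^sub>R ?e + x)) powr p) \<partial>lborel)"
        by (subst nn_integral_cmult) (auto simp: add.commute)
      also have "(\<integral>\<^sup>+ x. ennreal (norm (H (r *\<^sub>R ?e + x)) powr p) \<partial>lborel) = Lpow p H"
        unfolding Lpow_def by (rule nn_integral_lborel_translate) measurable
      finally show "(\<integral>\<^sup>+ x. ennreal (?w r) * ennreal (norm (H (x + r *\<^sub>R ?e)) powr p) \<partial>lborel) = ennreal (?w r) * Lpow p H" .
    qed
    also have "\<dots> = (\<integral>\<^sup>+ r. ennreal (1 / t) * indicator {0..t} r \<partial>lborel) * Lpow p H"
      by (subst nn_integral_multc[symmetric]) (auto intro!: nn_integral_cong simp: indicator_def)
    also have "(\<integral>\<^sup>+ r. ennreal (1 / t) * indicator {0..t} r \<partial>lborel) = ennreal (1 / t) * ennreal t"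
      using t by (subst nn_integral_cmult) auto
    also have "\<dots> = 1" using t by (simp flip: ennreal_mult)
    finally show ?thesis by simp
  qed
  have FT: "(\<integral>\<^sup>+ x. ?F (t *\<^sub>R ?e + x) \<partial>lborel) = (\<integral>\<^sup>+ x. ?F x \<partial>lborel)"
    by (rule nn_integral_lborel_translate) measurable
  have [measurable]: "?J \<in> borel_measurable borel" by measurable
  have "Lpow_on p S (partial i f) \<le>
    (\<integral>\<^sup>+ x. ennreal (4 powr p) * (ennreal (t powr (-p)) * (?F (t *\<^sub>R ?e + x) + ?F x) + ennreal (t powr p) * ?J x) \<partial>lborel)"
    unfolding Lpow_def by (intro nn_integral_mono pt)
  also have "\<dots> = ennreal (4 powr p) * (ennreal (t powr (-p)) * ((\<integral>\<^sup>+ x. ?F (t *\<^sub>R ?e + x) \<partial>lborel) + (\<integral>\<^sup>+ x. ?F x \<partial>lborel)) + ennreal (t powr p) * (\<integral>\<^sup>+ x. ?J x \<partial>lborel))"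
    by (simp add: nn_integral_cmult nn_integral_add)
  also have "\<dots> = ennreal (4 powr p) * (ennreal (2 * t powr (-p)) * Lpow_on p S' f
      + ennreal (t powr p) * Lpow p H)"
    unfolding FT FJ by (simp add: Lpow_def ennreal_mult mult_2[symmetric] mult.assoc mult.left_commute)
  finally show ?thesis unfolding H_def .
qed

lemma Lpow_bounded_scaleR:
  fixes v :: "'a::euclidean_space \<Rightarrow> 'b::{real_normed_vector,second_countable_topology}"
  assumes "p \<ge> 0" "v \<in> borel_measurable borel" "\<And>x. \<bar>a x\<bar> \<le> B"
  shows "Lpow p (\<lambda>x. a x *\<^sub>R v x) \<le> ennreal (B powr p) * Lpow p v"
proof -
  have "B \<ge> 0" using assms(3)[of undefined] by linarith
  have "Lpow p (\<lambda>x. a x *\<^sub>R v x) \<le> Lpow p (\<lambda>x. B *\<^sub>R v x)"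
    using assms \<open>B \<ge> 0\<close> by (intro Lpow_mono) (auto intro!: mult_right_mono)
  then show ?thesis using Lpow_scaleR[OF assms(2), of p B] \<open>B \<ge> 0\<close> by simp
qed

lemma Lpow_test_scaleR_finite:
  fixes v :: "real^'n::finite \<Rightarrow> 'b::{real_normed_vector,second_countable_topology}" and \<zeta> :: "real^'n \<Rightarrow> real"
  assumes "p \<ge> 0" "v \<in> borel_measurable borel" "\<zeta> \<in> test_functions \<Omega>" "Lpow p v < \<infinity>"
  shows "Lpow p (\<lambda>x. \<zeta> x *\<^sub>R v x) < \<infinity>"
proof -
  obtain B where "\<And>x. norm (\<zeta> x) \<le> B" using test_function_bounded[OF assms(3)] by metis
  then show ?thesis
    using Lpow_bounded_scaleR[OF assms(1,2), of \<zeta> B] assms(4)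
    by (auto intro: le_less_trans simp: ennreal_mult_less_top)
qed

lemma Lpow_add_finite:
  assumes "p \<ge> 0" "f \<in> borel_measurable borel" "g \<in> borel_measurable borel" "Lpow p f < \<infinity>" "Lpow p g < \<infinity>"
  shows "Lpow p (\<lambda>x. f x + g x) < \<infinity>"
  using Lpow_add[OF assms(1-3)] assms(4,5) by (auto intro: le_less_trans simp: ennreal_mult_less_top)

text \<open>The smooth inequality holds for the mollifications of \<open>\<zeta> u\<close>, whose
  derivatives are mollifications of the displayed product rule expressions, and passes to the limit.
  The constant 16 is 2 * 4 * 2: the smooth case and a quasi-triangle inequality on either
  side.\<close>

lemma Lpow_weak_partial_interpolation:
  fixes u :: "real^'n::finite \<Rightarrow> 'b::{banach,second_countable_topology}"
  assumes p: "p \<ge> 1" and \<zeta>: "\<zeta> \<in> test_functions \<Omega>"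
    and ug: "weak_pair \<Omega> i u g" and gh: "weak_pair \<Omega> i g h"
    and fin: "Lpow p u < \<infinity>" "Lpow p g < \<infinity>"
    and t: "t > 0" and S [measurable]: "S \<in> sets borel" "S' \<in> sets borel"
    and sub: "S \<subseteq> S'" "\<And>x. x \<in> S \<Longrightarrow> x + t *\<^sub>R axis i 1 \<in> S'"
  shows "Lpow p (\<lambda>x. indicator S x *\<^sub>R (\<zeta> x *\<^sub>R g x + partial i \<zeta> x *\<^sub>R u x)) \<le>
    ennreal (16 powr p) * (ennreal (2 * t powr (-p)) * Lpow p (\<lambda>x. indicator S' x *\<^sub>R \<zeta> x *\<^sub>R u x)
      + ennreal (t powr p) * Lpow p (\<lambda>y. \<zeta> y *\<^sub>R h y + 2 *\<^sub>R partial i \<zeta> y *\<^sub>R g y + partial i (partial i \<zeta>) y *\<^sub>R u y))"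
    (is "Lpow p (\<lambda>x. _ *\<^sub>R ?V x) \<le> _ * (_ * Lpow p (\<lambda>x. _ *\<^sub>R ?U x) + _ * Lpow p ?H)")
proof -
  obtain \<eta> :: "nat \<Rightarrow> real^'n \<Rightarrow> real" where ai: "approx_identity \<eta>" and \<eta>: "\<And>k. \<eta> k \<in> test_functions UNIV"
    using exists_smooth_approx_identity by blast
  interpret approx_identity \<eta> by (rule ai)
  have int: "integrable lborel u" "integrable lborel g" "integrable lborel h"
    using ug gh by (auto simp: weak_pair_def)
  have [measurable]: "u \<in> borel_measurable borel" "g \<in> borel_measurable borel" "h \<in> borel_measurable borel"
    using int by auto
  note \<zeta>' = test_functions_partial[OF \<zeta>]
  note \<zeta>'' = test_functions_partial[OF \<zeta>']
  note borel_measurable_test_partials[OF \<zeta>, measurable]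
  have p0: "p \<ge> 0" using p by simp
  have U: "integrable lborel ?U" "Lpow p ?U < \<infinity>"
    by (intro integrable_test_scaleR[OF \<zeta>] int Lpow_test_scaleR_finite[OF p0 _ \<zeta>] fin; measurable)+
  have V: "integrable lborel ?V" "Lpow p ?V < \<infinity>"
    by (intro Bochner_Integration.integrable_add integrable_test_scaleR[OF \<zeta>] integrable_test_scaleR[OF \<zeta>'] int
        Lpow_add_finite p0 Lpow_test_scaleR_finite[OF p0 _ \<zeta>] Lpow_test_scaleR_finite[OF p0 _ \<zeta>'] fin; measurable)+
  define a where "a k = err p k ?U" for k
  define b where "b k = err p k ?V" for k
  have a: "a \<longlonglongrightarrow> 0" unfolding a_def by (rule conv_tendsto_Lp[OF p U])
  have b: "b \<longlonglongrightarrow> 0" unfolding b_def by (rule conv_tendsto_Lp[OF p V])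
  let ?P = "ennreal (2 powr p)" and ?Q = "ennreal (4 powr p)" and ?T = "ennreal (2 * t powr (-p))" and ?T' = "ennreal (t powr p)"
  let ?LU = "Lpow_on p S' ?U"
  have le: "Lpow_on p S ?V \<le> ?P * (b k + ?Q * (?T * (?P * (a k + ?LU)) + ?T' * Lpow p ?H))" for k
  proof -
    let ?Uk = "conv (\<eta> k) ?U"
    have Vk: "partial i ?Uk = conv (\<eta> k) ?V" by (rule partial_conv_weak[OF \<eta> \<zeta> ug])
    have Hk: "partial i (partial i ?Uk) = conv (\<eta> k) ?H" by (rule partial_partial_conv_weak[OF \<eta> \<zeta> ug gh])
    have "Lpow_on p S ?V =
       Lpow p (\<lambda>x. indicator S x *\<^sub>R (?V x - conv (\<eta> k) ?V x) + indicator S x *\<^sub>R conv (\<eta> k) ?V x)"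
      by (simp add: scaleR_diff_right)
    also have "\<dots> \<le> ?P * (Lpow p (\<lambda>x. indicator S x *\<^sub>R (?V x - conv (\<eta> k) ?V x)) + Lpow p (\<lambda>x. indicator S x *\<^sub>R conv (\<eta> k) ?V x))"
      by (intro Lpow_add p0) measurable
    also have "Lpow p (\<lambda>x. indicator S x *\<^sub>R (?V x - conv (\<eta> k) ?V x)) \<le> b k"
      unfolding b_def by (intro Lpow_mono p0) (auto simp: indicator_def norm_minus_commute)
    also have "Lpow p (\<lambda>x. indicator S x *\<^sub>R conv (\<eta> k) ?V x) \<le> ?Q * (?T * Lpow_on p S' ?Uk + ?T' * Lpow p (conv (\<eta> k) ?H))"
      unfolding Vk[symmetric] Hk[symmetric]
      by (rule Lpow_partial_interpolation[OF p smooth_conv[OF \<eta> U(1)] t S sub])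
    also have "Lpow p (conv (\<eta> k) ?H) \<le> Lpow p ?H"
      by (rule Lpow_conv[OF p]) measurable
    also have "Lpow_on p S' ?Uk \<le> ?P * (a k + ?LU)"
    proof -
      have "Lpow_on p S' ?Uk = Lpow p (\<lambda>x. indicator S' x *\<^sub>R (?Uk x - ?U x) + indicator S' x *\<^sub>R ?U x)"
        by (simp add: scaleR_diff_right)
      also have "\<dots> \<le> ?P * (Lpow p (\<lambda>x. indicator S' x *\<^sub>R (?Uk x - ?U x)) + ?LU)"
        by (intro Lpow_add p0) measurable
      also have "Lpow p (\<lambda>x. indicator S' x *\<^sub>R (?Uk x - ?U x)) \<le> a k"
        unfolding a_def by (intro Lpow_mono p0) (auto simp: indicator_def)
      finally show ?thesis by (simp add: mult_left_mono add_mono)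
    qed
    finally show ?thesis by (simp add: mult_left_mono add_mono)
  qed
  \<comment> \<open>The right hand side depends on k only through the two null sequences, so letting
    k tend to infinity deletes them.\<close>
  have "(\<lambda>k. ?P * (b k + ?Q * (?T * (?P * (a k + ?LU)) + ?T' * Lpow p ?H))) \<longlonglongrightarrow>
    ?P * (0 + ?Q * (?T * (?P * (0 + ?LU)) + ?T' * Lpow p ?H))"
    by (intro ennreal_tendsto_cmult tendsto_add a b tendsto_const) auto
  then have "Lpow_on p S ?V \<le> ?P * (0 + ?Q * (?T * (?P * (0 + ?LU)) + ?T' * Lpow p ?H))"
    by (rule tendsto_lowerbound) (use le in auto)
  also have "\<dots> = (?P * ?Q) * (?P * (?T * ?LU) + ?T' * Lpow p ?H)" by (simp add: algebra_simps)
  also have "\<dots> \<le> (?P * ?Q) * (?P * (?T * ?LU) + ?P * (?T' * Lpow p ?H))"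
  proof -
    have "1 \<le> ?P" using ge_one_powr_ge_zero[of 2 p] p0 by (metis ennreal_leI ennreal_1 one_le_numeral)
    from mult_right_mono[OF this, of "?T' * Lpow p ?H"] show ?thesis
      by (intro mult_left_mono add_mono) auto
  qed
  also have "\<dots> = (?P * ?Q * ?P) * (?T * ?LU + ?T' * Lpow p ?H)" by (simp add: algebra_simps)
  also have "?P * ?Q * ?P = ennreal (16 powr p)" by (simp add: ennreal_mult'[symmetric] powr_mult[symmetric])
  finally show ?thesis .
qed

section \<open>The Carleman inequality for cut-off solutions\<close>

lemma nn_integral_lebesgue_on:
  assumes "\<Omega> \<in> sets lebesgue"
  shows "(\<integral>\<^sup>+ x. f x \<partial>lebesgue_on \<Omega>) = (\<integral>\<^sup>+ x. f x * indicator \<Omega> x \<partial>lborel)"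
  using assms by (simp add: nn_integral_restrict_space nn_integral_completion)

lemma Lp_norm_Lpow:
  assumes \<Omega>: "\<Omega> \<in> sets lebesgue" and "\<And>x. x \<notin> \<Omega> \<Longrightarrow> f x = 0"
  shows "Lp_norm p \<Omega> f = (if Lpow p f = \<infinity> then \<infinity> else ennreal (enn2real (Lpow p f) powr (1 / p)))"
proof -
  have "(\<integral>\<^sup>+ x. ennreal (norm (f x) powr p) \<partial>lebesgue_on \<Omega>) = Lpow p f"
    unfolding nn_integral_lebesgue_on[OF \<Omega>] Lpow_def
    by (intro nn_integral_cong) (use assms(2) in \<open>auto simp: indicator_def\<close>)
  then show ?thesis by (simp add: Lp_norm_def Let_def)
qed

lemma laplacian_test_function_outside:
  fixes w :: "real^'n::finite \<Rightarrow> 'b::real_normed_vector"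
  assumes "w \<in> test_functions \<Omega>" "x \<notin> \<Omega>"
  shows "laplacian w x = 0" "w x = 0"
proof -
  have *: "f x = 0" if f: "f \<in> test_functions \<Omega>" for f :: "real^'n \<Rightarrow> 'b"
    using test_functionsD(2)[OF f] assms(2) by blast
  show "w x = 0" using assms(1) by (rule *)
  show "laplacian w x = 0"
    unfolding laplacian_def by (intro sum.neutral ballI * test_functions_partial assms(1))
qed

text \<open>The Carleman inequality with the roots removed. A real bound \<open>A\<close> on the
  right excludes the infinite branch in the definition of the norm, and the inequality then excludes
  it on the left.\<close>

lemma carleman_Lpow:
  fixes w q :: "real^'n::finite \<Rightarrow> 'b::{real_normed_field,euclidean_space}"
  assumes n: "CARD('n) \<ge> 3" and C: "carleman_inequality TYPE(real^'n \<Rightarrow> 'b) r\<^sub>0 \<kappa>" and \<kappa>: "\<kappa> > 0"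
    and w: "w \<in> test_functions (ball 0 1 - {0})"
    and q: "q \<in> Lp_cball (real CARD('n) / 2) (ball 0 1) r\<^sub>0" and l: "l \<in> Lambda CARD('n)"
    and A: "Lpow (exp_p CARD('n)) (\<lambda>x. norm x powr (-l) *\<^sub>R (laplacian w x + q x * w x)) \<le> ennreal A" "A \<ge> 0"
  shows "Lpow (exp_p' CARD('n)) (\<lambda>x. norm x powr (-l) *\<^sub>R w x)
    \<le> ennreal ((\<kappa> * A powr (1 / exp_p CARD('n))) powr exp_p' CARD('n))"
proof -
  let ?p = "exp_p CARD('n)" and ?p' = "exp_p' CARD('n)"
  have p': "?p' > 0" and p: "?p > 0" using n by (auto simp: exp_p'_def exp_p_def)
  let ?f = "\<lambda>x. norm x powr (-l) *\<^sub>R w x" and ?g = "\<lambda>x. norm x powr (-l) *\<^sub>R (laplacian w x + q x * w x)"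
  note out = laplacian_test_function_outside[OF w]
  have f: "Lp_norm ?p' (ball 0 1) ?f = (if Lpow ?p' ?f = \<infinity> then \<infinity> else ennreal (enn2real (Lpow ?p' ?f) powr (1 / ?p')))"
    by (rule Lp_norm_Lpow) (auto simp: out)
  have g: "Lp_norm ?p (ball 0 1) ?g = (if Lpow ?p ?g = \<infinity> then \<infinity> else ennreal (enn2real (Lpow ?p ?g) powr (1 / ?p)))"
    by (rule Lp_norm_Lpow) (auto simp: out)
  have gfin: "Lpow ?p ?g \<noteq> \<infinity>" using A by (auto simp: top_unique)
  have "enn2real (Lpow ?p ?g) \<le> A" using A by (simp add: enn2real_leI)
  then have "Lp_norm ?p (ball 0 1) ?g \<le> ennreal (A powr (1 / ?p))"
    unfolding g using gfin p by (auto intro!: ennreal_leI powr_mono2)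
  then have "ennreal \<kappa> * Lp_norm ?p (ball 0 1) ?g \<le> ennreal (\<kappa> * A powr (1 / ?p))"
    using \<kappa> by (simp add: ennreal_mult mult_left_mono)
  moreover have "Lp_norm ?p' (ball 0 1) ?f \<le> ennreal \<kappa> * Lp_norm ?p (ball 0 1) ?g"
    using C w q l unfolding carleman_inequality_def by blast
  ultimately have le: "Lp_norm ?p' (ball 0 1) ?f \<le> ennreal (\<kappa> * A powr (1 / ?p))" by (rule order_trans[rotated])
  then have ffin: "Lpow ?p' ?f \<noteq> \<infinity>" unfolding f by (auto simp: top_unique split: if_splits)
  define I where "I = enn2real (Lpow ?p' ?f)"
  have I: "Lpow ?p' ?f = ennreal I" "I \<ge> 0" using ffin by (auto simp: I_def less_top)
  have "I powr (1 / ?p') \<le> \<kappa> * A powr (1 / ?p)"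
    using le ffin \<kappa> unfolding f I_def[symmetric] by simp
  then have "(I powr (1 / ?p')) powr ?p' \<le> (\<kappa> * A powr (1 / ?p)) powr ?p'"
    using p' by (intro powr_mono2) auto
  then have "I \<le> (\<kappa> * A powr (1 / ?p)) powr ?p'" using p' I(2) by (simp add: powr_powr)
  then show ?thesis unfolding I(1) by (rule ennreal_leI)
qed

text \<open>Convergence in L^1 gives almost everywhere convergence of a subsequence, to which Fatou
  applies. Hence the multiplier \<open>m\<close> may be unbounded, as the Carleman weight
  is.\<close>

lemma Lpow_fatou:
  fixes f :: "nat \<Rightarrow> 'a::euclidean_space \<Rightarrow> 'b::{banach,second_countable_topology}"
  assumes [measurable]: "\<And>k. f k \<in> borel_measurable borel" "g \<in> borel_measurable borel" "m \<in> borel_measurable borel"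
    and L1: "(\<lambda>k. Lpow 1 (\<lambda>x. f k x - g x)) \<longlonglongrightarrow> 0"
    and bd: "eventually (\<lambda>k. Lpow p (\<lambda>x. m x *\<^sub>R f k x) \<le> C) sequentially" and p: "p > 0"
  shows "Lpow p (\<lambda>x. m x *\<^sub>R g x) \<le> C"
proof -
  \<comment> \<open>Starting at N makes all differences integrable and brings the uniform bound into
    force.\<close>
  obtain N where N: "\<And>k. k \<ge> N \<Longrightarrow> Lpow 1 (\<lambda>x. f k x - g x) \<le> ennreal 1" "\<And>k. k \<ge> N \<Longrightarrow> Lpow p (\<lambda>x. m x *\<^sub>R f k x) \<le> C"
    using eventually_conj[OF ennreal_tendsto_0D[OF L1, of 1] bd] by (auto simp: eventually_sequentially)
  let ?d = "\<lambda>k x. f (k + N) x - g x"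
  have int: "integrable lborel (?d k)" for k
    using N(1)[of "k + N"] by (intro integrableI_bounded) (auto simp: Lpow_1 intro: le_less_trans[OF _ ennreal_one_less_top])
  have "(\<lambda>k. Lpow 1 (?d k)) \<longlonglongrightarrow> 0" using LIMSEQ_ignore_initial_segment[OF L1, of N] .
  moreover have "Lpow 1 (?d k) = ennreal (\<integral>x. norm (?d k x) \<partial>lborel)" for k
    unfolding Lpow_1 by (rule nn_integral_eq_integral) (use int in auto)
  ultimately have "(\<lambda>k. \<integral>x. norm (?d k x) \<partial>lborel) \<longlonglongrightarrow> 0"
    by (simp add: ennreal_tendsto_0_iff)
  from tendsto_L1_AE_subseq[OF int this] obtain r :: "nat \<Rightarrow> nat" where r: "AE x in lborel. (\<lambda>k. ?d (r k) x) \<longlonglongrightarrow> 0" by blast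
  let ?F = "\<lambda>k x. ennreal (norm (m x *\<^sub>R f (r k + N) x) powr p)"
  have "AE x in lborel. ennreal (norm (m x *\<^sub>R g x) powr p) = liminf (\<lambda>k. ?F k x)"
    using r
  proof eventually_elim
    case (elim x)
    then have "(\<lambda>k. f (r k + N) x) \<longlonglongrightarrow> g x" by (simp add: LIM_zero_iff)
    then have "(\<lambda>k. norm (m x *\<^sub>R f (r k + N) x) powr p) \<longlonglongrightarrow> norm (m x *\<^sub>R g x) powr p"
      using p by (intro tendsto_powr' tendsto_intros) auto
    then have "(\<lambda>k. ?F k x) \<longlonglongrightarrow> ennreal (norm (m x *\<^sub>R g x) powr p)" by (rule tendsto_ennrealI)
    from lim_imp_Liminf[OF _ this] show ?case by simp
  qed
  then have "Lpow p (\<lambda>x. m x *\<^sub>R g x) = (\<integral>\<^sup>+ x. liminf (\<lambda>k. ?F k x) \<partial>lborel)"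
    unfolding Lpow_def by (rule nn_integral_cong_AE)
  also have "\<dots> \<le> liminf (\<lambda>k. \<integral>\<^sup>+ x. ?F k x \<partial>lborel)"
    by (rule nn_integral_liminf) measurable
  also have "\<dots> \<le> liminf (\<lambda>k. C)"
    using N(2) by (intro Liminf_mono always_eventually) (simp add: Lpow_def)
  also have "\<dots> = C" by (simp add: Liminf_const)
  finally show ?thesis .
qed

text \<open>Hoelder's inequality for null sequences in the form of Young's inequality with a
  parameter: a small multiple of |q|^a plus a large multiple of |v|^b, the first being small
  uniformly in k.\<close>

lemma Lpow_mult_tendsto_0:
  fixes q :: "'a::euclidean_space \<Rightarrow> 'b::real_normed_field" and v :: "nat \<Rightarrow> 'a \<Rightarrow> 'b"
  assumes [measurable]: "q \<in> borel_measurable borel" "\<And>k. v k \<in> borel_measurable borel"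
    and pos: "p > 0" "a > 0" "b > 0" and eq: "p / a + p / b = 1"
    and q: "Lpow a q < \<infinity>" and v: "(\<lambda>k. Lpow b (v k)) \<longlonglongrightarrow> 0"
  shows "(\<lambda>k. Lpow p (\<lambda>x. q x * v k x)) \<longlonglongrightarrow> 0"
proof (rule ennreal_tendsto_0I)
  fix e :: real assume e: "e > 0"
  define \<alpha> \<beta> where "\<alpha> = p / a" and "\<beta> = p / b"
  have \<alpha>\<beta>: "\<alpha> > 0" "\<beta> > 0" "\<alpha> + \<beta> = 1" "\<alpha> \<le> 1" "\<beta> \<le> 1" 
  proof -
    show "\<alpha> > 0" "\<beta> > 0" using pos by (simp_all add: \<alpha>_def \<beta>_def)
    show "\<alpha> + \<beta> = 1" using eq by (simp add: \<alpha>_def \<beta>_def)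
    then show "\<alpha> \<le> 1" "\<beta> \<le> 1" using \<open>\<alpha> > 0\<close> \<open>\<beta> > 0\<close> by linarith+
  qed
  define Q where "Q = enn2real (Lpow a q)"
  have Q: "Lpow a q = ennreal Q" "Q \<ge> 0" using q by (auto simp: Q_def less_top)
  define s where "s = e / (2 * (Q + 1))"
  have s: "s > 0" "s * Q \<le> e / 2" using e Q(2) by (auto simp: s_def field_simps)
  \<comment> \<open>Chosen so that \<open>s powr \<alpha> * c powr \<beta> = 1\<close>, the
    condition under which the weights cancel in Young's inequality.\<close>
  define c where "c = s powr (- \<alpha> / \<beta>)"
  have c: "c > 0" using s by (simp add: c_def)
  have pt: "norm (q x * v k x) powr p \<le> s * norm (q x) powr a + c * norm (v k x) powr b" for k x
  proof (cases "q x = 0 \<or> v k x = 0")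
    case True
    have "0 \<le> s * norm (q x) powr a" "0 \<le> c * norm (v k x) powr b" using s c by auto
    then show ?thesis using True by auto
  next
    case False
    let ?X = "s * norm (q x) powr a" and ?Y = "c * norm (v k x) powr b"
    have XY: "?X > 0" "?Y > 0" using False s c by auto
    have "?X powr \<alpha> * ?Y powr \<beta> = (s powr \<alpha> * c powr \<beta>) * (norm (q x) powr (a * \<alpha>) * norm (v k x) powr (b * \<beta>))"
      by (simp add: powr_mult powr_powr)
    also have "s powr \<alpha> * c powr \<beta> = 1"
      using \<alpha>\<beta> s by (simp add: c_def powr_powr powr_add[symmetric])
    also have "a * \<alpha> = p" using pos by (simp add: \<alpha>_def)
    also have "b * \<beta> = p" using pos by (simp add: \<beta>_def)
    finally have "norm (q x * v k x) powr p = ?X powr \<alpha> * ?Y powr \<beta>" by (simp add: norm_mult powr_mult)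
    also have "\<dots> \<le> \<alpha> * ?X + \<beta> * ?Y"
      using Youngs_inequality_0[of \<alpha> \<beta> ?X ?Y] \<alpha>\<beta> XY by auto
    also have "\<dots> \<le> ?X + ?Y"
      using \<alpha>\<beta> XY mult_right_mono[of \<alpha> 1 ?X] mult_right_mono[of \<beta> 1 ?Y] by simp
    finally show ?thesis .
  qed
  have le: "Lpow p (\<lambda>x. q x * v k x) \<le> ennreal s * Lpow a q + ennreal c * Lpow b (v k)" for k
  proof -
    have "Lpow p (\<lambda>x. q x * v k x) \<le> (\<integral>\<^sup>+ x. ennreal s * ennreal (norm (q x) powr a) + ennreal c * ennreal (norm (v k x) powr b) \<partial>lborel)"
      unfolding Lpow_def using pt[of _ k] s c
      by (intro nn_integral_mono) (simp flip: ennreal_mult ennreal_plus)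
    then show ?thesis by (simp add: nn_integral_add nn_integral_cmult Lpow_def)
  qed
  have "e / (2 * c) > 0" using e c by simp
  from ennreal_tendsto_0D[OF v this]
  show "\<forall>\<^sub>F k in sequentially. Lpow p (\<lambda>x. q x * v k x) \<le> ennreal e"
  proof eventually_elim
    case (elim k)
    have "Lpow p (\<lambda>x. q x * v k x) \<le> ennreal s * ennreal Q + ennreal c * ennreal (e / (2 * c))"
      by (rule order_trans[OF le]) (intro add_mono mult_left_mono elim, simp_all add: Q)
    also have "\<dots> = ennreal (s * Q + c * (e / (2 * c)))" using s c Q e by (simp add: ennreal_mult[symmetric] ennreal_plus[symmetric] del: ennreal_plus)
    also have "\<dots> \<le> ennreal e" using s c by (intro ennreal_leI) auto
    finally show ?case .
  qed
qed


text \<open>The setting after passing to Borel representatives on the whole space: \<open>g\<close>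
  is the weak gradient and \<open>h\<close> holds the pure second derivatives. No mixed derivatives
  appear, since both the Laplacian and the interpolation along coordinate lines involve pure ones
  only.\<close>

locale vanishing_solution =
  fixes u q :: "real^'n::finite \<Rightarrow> 'b::{real_normed_field,euclidean_space}"
    and g h :: "'n \<Rightarrow> real^'n \<Rightarrow> 'b" and r\<^sub>0 \<kappa> p p' :: real
  assumes dim: "CARD('n) \<ge> 3" and p_def: "p = exp_p CARD('n)" and p'_def: "p' = exp_p' CARD('n)"
    and carleman: "carleman_inequality TYPE(real^'n \<Rightarrow> 'b) r\<^sub>0 \<kappa>" and \<kappa>: "\<kappa> > 0"
    and q: "q \<in> Lp_cball (real CARD('n) / 2) (ball 0 1) r\<^sub>0"
    and q_measurable [measurable]: "q \<in> borel_measurable borel"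
    and q_finite: "Lpow (real CARD('n) / 2) q < \<infinity>"
    and grad: "\<And>i. weak_pair (ball 0 1) i u (g i)"
    and hess: "\<And>i. weak_pair (ball 0 1) i (g i) (h i)"
    and u_finite: "Lpow p u < \<infinity>"
    and g_finite: "\<And>i. Lpow p (g i) < \<infinity>"
    and h_finite: "\<And>i. Lpow p (h i) < \<infinity>"
    and equation: "AE x in lborel. x \<in> ball 0 1 \<longrightarrow> (\<Sum>i\<in>UNIV. h i x) + q x * u x = 0"
begin

lemma p: "p \<ge> 1" "p > 1" "p > 0" "p' \<ge> 1" "p' > 0"
  using dim by (auto simp: p_def p'_def exp_p_def exp_p'_def field_simps)

text \<open>This is 1/p = 2/n + 1/p', the Hoelder relation placing the product of a potential in
  L^(n/2) and a function in L^p' into L^p.\<close>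

lemma p_conjugate: "p / (real CARD('n) / 2) + p / p' = 1"
proof -
  define N where "N = real CARD('n)"
  have "N \<ge> 3" using dim by (simp add: N_def)
  then have "2 * N / (N + 2) / (N / 2) = 4 / (N + 2)" "2 * N / (N + 2) / (2 * N / (N - 2)) = (N - 2) / (N + 2)"
    by (simp_all add: divide_simps)
  moreover have "4 / (N + 2) + (N - 2) / (N + 2) = 1" using \<open>N \<ge> 3\<close> by (simp flip: add_divide_distrib)
  ultimately show ?thesis by (simp add: p_def p'_def exp_p_def exp_p'_def N_def)
qed

lemma integrable_ugh: "integrable lborel u" "integrable lborel (g i)" "integrable lborel (h i)"
  using grad[of i] hess[of i] by (auto simp: weak_pair_def)

lemma measurable_ugh [measurable]:
  "u \<in> borel_measurable borel" "g i \<in> borel_measurable borel" "h i \<in> borel_measurable borel"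
  using integrable_ugh(1) integrable_ugh(2)[of i] integrable_ugh(3)[of i] by auto

text \<open>\<open>[\<Delta>, \<zeta>] u\<close>, with \<open>g\<close> for the gradient of \<open>u\<close>.\<close>

definition commutator :: "(real^'n \<Rightarrow> real) \<Rightarrow> real^'n \<Rightarrow> 'b"
  where "commutator \<zeta> x = (\<Sum>i\<in>UNIV. 2 *\<^sub>R partial i \<zeta> x *\<^sub>R g i x + partial i (partial i \<zeta>) x *\<^sub>R u x)"

text \<open>Carleman's inequality for the mollifications of \<open>\<zeta> u\<close>, followed by
  Fatou. All of them live at a fixed distance from 0, where the weight is bounded, so unweighted
  convergence suffices for the error terms; only the commutator keeps its weight.\<close>

lemma carleman_cutoff:
  assumes \<zeta>: "\<zeta> \<in> test_functions (ball 0 1 - {0})" and l: "l \<in> Lambda CARD('n)"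
    and A: "A > 0" "Lpow p (\<lambda>x. norm x powr (-l) *\<^sub>R commutator \<zeta> x) \<le> ennreal A"
  shows "Lpow p' (\<lambda>x. norm x powr (-l) *\<^sub>R \<zeta> x *\<^sub>R u x) \<le> ennreal ((\<kappa> * (2 * 2 powr p * A) powr (1 / p)) powr p')"
proof -
  obtain \<eta> :: "nat \<Rightarrow> real^'n \<Rightarrow> real" where ai: "approx_identity \<eta>" and \<eta>: "\<And>k. \<eta> k \<in> test_functions UNIV"
    using exists_smooth_approx_identity by blast
  interpret approx_identity \<eta> by (rule ai)
  let ?\<Omega> = "ball 0 1 - {0} :: (real^'n) set"
  have l0: "l > 0" using l by (simp add: Lambda_def)
  have p0: "p \<ge> 0" using p by simp
  have \<zeta>B: "\<zeta> \<in> test_functions (ball 0 1)" using test_functions_mono[OF \<zeta>] by blast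
  note \<zeta>' = test_functions_partial[OF \<zeta>B]
  note \<zeta>'' = test_functions_partial[OF \<zeta>']
  note borel_measurable_test_partials[OF \<zeta>B, measurable]
  obtain K where K: "compact K" "K \<subseteq> ?\<Omega>" "\<And>x. x \<notin> K \<Longrightarrow> \<zeta> x = 0"
    using test_functionsD(2)[OF \<zeta>] by blast
  obtain e where e: "e > 0" "(\<Union>x\<in>K. cball x e) \<subseteq> ?\<Omega>"
    using compact_subset_open_imp_cball_epsilon_subset[OF K(1) _ K(2)] by (metis open_ball open_delete)
  define d where "d = e / 2"
  have d: "d > 0" using e by (simp add: d_def)
  \<comment> \<open>With d half the distance \<open>e\<close> guaranteed to the complement of the
    punctured ball, a d-neighbourhood of the support of \<open>\<zeta>\<close> remains in the ball
    and d-far from 0.\<close>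
  define \<Omega>d where "\<Omega>d = {x :: real^'n. x \<in> ?\<Omega> \<and> d \<le> norm x}"
  have Kd: "x \<in> \<Omega>d" if "y \<in> K" "norm (x - y) \<le> d" for x y
  proof -
    have "x \<in> cball y e" using that d by (simp add: d_def dist_norm norm_minus_commute)
    then have "x \<in> ?\<Omega>" using e that by blast
    moreover have "0 \<notin> cball y e" using e that by blast
    then have "norm y > e" by simp
    then have "norm x \<ge> d" using norm_triangle_sub[of y x] that by (simp add: d_def norm_minus_commute)
    ultimately show ?thesis by (simp add: \<Omega>d_def)
  qed
  define w where "w = (\<lambda>x. \<zeta> x *\<^sub>R u x)"
  define H where "H i = (\<lambda>y. \<zeta> y *\<^sub>R h i y + 2 *\<^sub>R partial i \<zeta> y *\<^sub>R g i y + partial i (partial i \<zeta>) y *\<^sub>R u y)" for i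
  define G where "G = (\<lambda>y. \<Sum>i\<in>UNIV. H i y)"
  define W where "W k = conv (\<eta> k) w" for k
  have w_int: "integrable lborel w" unfolding w_def by (intro integrable_test_scaleR[OF \<zeta>B] integrable_ugh)
  then have [measurable]: "w \<in> borel_measurable borel" by auto
  have [measurable]: "W k \<in> borel_measurable borel" for k unfolding W_def by measurable
  have H_int: "integrable lborel (H i)" for i
    unfolding H_def by (intro Bochner_Integration.integrable_add integrable_scaleR_right integrable_test_scaleR[OF \<zeta>B]
        integrable_test_scaleR[OF \<zeta>'] integrable_test_scaleR[OF \<zeta>''] integrable_ugh)
  have [measurable]: "H i \<in> borel_measurable borel" for i using H_int[of i] by auto
  have G_int: "integrable lborel G" unfolding G_def by (intro Bochner_Integration.integrable_sum H_int)
  then have [measurable]: "G \<in> borel_measurable borel" by auto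
  have scale_fin: "Lpow p (\<lambda>x. 2 *\<^sub>R f x) < \<infinity>" if "f \<in> borel_measurable borel" "Lpow p f < \<infinity>" for f :: "real^'n \<Rightarrow> 'b"
    using that by (simp add: Lpow_scaleR ennreal_mult_less_top)
  have H_fin: "Lpow p (H i) < \<infinity>" for i
    unfolding H_def
    by (intro Lpow_add_finite p0 scale_fin Lpow_test_scaleR_finite[OF p0 _ \<zeta>B] Lpow_test_scaleR_finite[OF p0 _ \<zeta>'] Lpow_test_scaleR_finite[OF p0 _ \<zeta>'']
        u_finite g_finite h_finite; measurable)
  have sum_fin: "Lpow p (\<lambda>x. \<Sum>i\<in>I. H i x) < \<infinity>" if "finite I" for I
    using that
  proof (induction I)
    case (insert i I)
    have "Lpow p (\<lambda>x. H i x + (\<Sum>i\<in>I. H i x)) < \<infinity>"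
      using insert by (intro Lpow_add_finite p0 H_fin) measurable
    with insert show ?case by simp
  qed (simp add: Lpow_def)
  have G_fin: "Lpow p G < \<infinity>" unfolding G_def by (rule sum_fin) simp
  obtain N where N: "1 / Suc N < d" using nat_approx_posE[OF d] by auto
  have W_test: "W k \<in> test_functions \<Omega>d" if k: "k \<ge> N" for k
    unfolding W_def
  proof (rule conv_test_function(1)[OF \<eta> w_int K(1)])
    show "w x = 0" if "x \<notin> K" for x using K(3)[OF that] by (simp add: w_def)
    have "1 / Suc k \<le> d" using k N frac_le[of 1 1 "Suc N" "Suc k"] by simp
    then show "\<eta> k x = 0" if "d \<le> norm x" for x using kernel_support[of k x] that by simp
  qed (use Kd in blast)
  have W_lap: "laplacian (W k) = conv (\<eta> k) G" for k
  proof
    fix x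
    have "partial i (partial i (W k)) = conv (\<eta> k) (H i)" for i
      unfolding W_def w_def H_def by (rule partial_partial_conv_weak[OF \<eta> \<zeta>B grad hess])
    then have "laplacian (W k) x = (\<Sum>i\<in>UNIV. conv (\<eta> k) (H i) x)" by (simp add: laplacian_def)
    also have "\<dots> = conv (\<eta> k) G x"
      unfolding conv_def G_def scaleR_sum_right
      by (rule Bochner_Integration.integral_sum[symmetric]) (rule integrable_kernel[OF H_int])
    finally show "laplacian (W k) x = conv (\<eta> k) G x" .
  qed
  let ?m = "\<lambda>x::real^'n. norm x powr (-l)"
  \<comment> \<open>On \<open>\<Omega>d\<close> the weight lies between 1 and d^(-l). The upper
    bound controls the mollification errors, the lower one allows the weight to be dropped when
    bounding \<open>w\<close> in L^p'.\<close>
  have m_le: "?m x \<le> d powr (-l)" if "x \<in> \<Omega>d" for x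
    using that d l0 by (intro powr_mono2') (auto simp: \<Omega>d_def)
  have m_ge: "1 \<le> ?m x" if "x \<in> \<Omega>d" for x
    using that d l0 ge_one_powr_ge_zero[of "1 / norm x" l] by (auto simp: \<Omega>d_def powr_minus_divide powr_divide field_simps)
  have W_sub: "W k \<in> test_functions ?\<Omega>" if "k \<ge> N" for k
    by (rule test_functions_mono[OF W_test[OF that]]) (auto simp: \<Omega>d_def)
  note W_out = laplacian_test_function_outside[OF W_test]
  have W_L1: "(\<lambda>k. Lpow 1 (\<lambda>x. W k x - w x)) \<longlonglongrightarrow> 0"
    unfolding W_def by (rule conv_tendsto_L1[OF w_int])
  have w_fin: "Lpow p' w < \<infinity>"
    \<comment> \<open>Carleman's inequality with \<open>q = 0\<close> bounds the mollifications; this replaces Sobolev's embedding.\<close>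
  proof -
    have q0: "(\<lambda>x. 0 :: 'b) \<in> Lp_cball (real CARD('n) / 2) (ball 0 1) r\<^sub>0"
      using dim by (simp add: Lp_cball_def Lp_def Lp_norm_def Let_def)
    define A0 where "A0 = enn2real (ennreal ((d powr (-l)) powr p) * Lpow p G)"
    have A0: "ennreal ((d powr (-l)) powr p) * Lpow p G = ennreal A0" "A0 \<ge> 0"
      using G_fin by (auto simp: A0_def ennreal_mult_less_top)
    define C where "C = ennreal ((\<kappa> * A0 powr (1 / p)) powr p')"
    have le: "Lpow p' (\<lambda>x. 1 *\<^sub>R W k x) \<le> C" if k: "k \<ge> N" for k
    proof -
      have "Lpow p (\<lambda>x. ?m x *\<^sub>R (laplacian (W k) x + 0 * W k x)) \<le> Lpow p (\<lambda>x. d powr (-l) *\<^sub>R conv (\<eta> k) G x)"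
      proof (rule Lpow_mono[OF p0])
        fix x
        show "norm (?m x *\<^sub>R (laplacian (W k) x + 0 * W k x)) \<le> norm (d powr (-l) *\<^sub>R conv (\<eta> k) G x)"
          using W_out[OF k, of x] m_le[of x] by (cases "x \<in> \<Omega>d") (auto simp: W_lap intro!: mult_right_mono)
      qed
      also have "\<dots> \<le> ennreal ((d powr (-l)) powr p) * Lpow p G"
        using Lpow_conv[OF p(1), of G k] by (subst Lpow_scaleR) (auto intro!: mult_left_mono)
      finally have "Lpow p (\<lambda>x. ?m x *\<^sub>R (laplacian (W k) x + 0 * W k x)) \<le> ennreal A0" unfolding A0(1) .
      from carleman_Lpow[OF dim carleman \<kappa> W_sub[OF k] q0 l this[unfolded p_def] A0(2), folded p_def p'_def]
      have "Lpow p' (\<lambda>x. ?m x *\<^sub>R W k x) \<le> C" by (simp add: C_def)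
      moreover have "Lpow p' (\<lambda>x. 1 *\<^sub>R W k x) \<le> Lpow p' (\<lambda>x. ?m x *\<^sub>R W k x)"
      proof (rule Lpow_mono)
        fix x
        show "norm (1 *\<^sub>R W k x) \<le> norm (?m x *\<^sub>R W k x)"
          using W_out(2)[OF k, of x] m_ge[of x] mult_right_mono[of 1 "?m x" "norm (W k x)"] by (cases "x \<in> \<Omega>d") auto
      qed (use p in auto)
      ultimately show ?thesis by (rule order_trans[rotated])
    qed
    have "Lpow p' (\<lambda>x. 1 *\<^sub>R w x) \<le> C"
      by (rule Lpow_fatou[OF _ _ _ W_L1]) (use le p in \<open>auto simp: eventually_sequentially\<close>)
    then show ?thesis by (simp add: C_def) (auto intro: le_less_trans)
  qed
  have X: "(\<lambda>k. err p k G) \<longlonglongrightarrow> 0"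
    by (rule conv_tendsto_Lp[OF p(1) G_int G_fin])
  have "(\<lambda>k. Lpow p' (\<lambda>x. W k x - w x)) \<longlonglongrightarrow> 0"
    unfolding W_def by (rule conv_tendsto_Lp[OF p(4) w_int w_fin])
  \<comment> \<open>This is where membership of \<open>w\<close> in L^p' is used: its mollifications
    converge there, and Hoelder with \<open>q\<close> brings the product back to L^p.\<close>
  then have Y: "(\<lambda>k. Lpow p (\<lambda>x. q x * (W k x - w x))) \<longlonglongrightarrow> 0"
    by (intro Lpow_mult_tendsto_0[where a="real CARD('n) / 2" and b=p'])
      (use dim p p_conjugate q_finite in auto)
  let ?X = "\<lambda>k x. conv (\<eta> k) G x - G x" and ?Y = "\<lambda>k x. q x * (W k x - w x)"
  let ?D = "d powr (-l)"
  define Z where "Z k = ennreal (2 powr p) * (ennreal (?D powr p) * Lpow p (?X k) + ennreal (?D powr p) * Lpow p (?Y k))" for k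
  have "Z \<longlonglongrightarrow> ennreal (2 powr p) * (ennreal (?D powr p) * 0 + ennreal (?D powr p) * 0)"
    unfolding Z_def by (intro ennreal_tendsto_cmult tendsto_add X Y) auto
  then have Z: "Z \<longlonglongrightarrow> 0" by simp
  have [measurable]: "commutator \<zeta> \<in> borel_measurable borel"
    unfolding commutator_def[abs_def] by measurable
  \<comment> \<open>By the product rule the left side is \<zeta> times the equation plus the
    commutator; the first part vanishes in the ball by the equation and outside it by the support of
    \<zeta>.\<close>
  have GF: "AE x in lborel. G x + q x * w x = commutator \<zeta> x"
    using equation
  proof eventually_elim
    case (elim x)
    have "G x + q x * w x = \<zeta> x *\<^sub>R ((\<Sum>i\<in>UNIV. h i x) + q x * u x) + commutator \<zeta> x"
      by (simp add: G_def H_def commutator_def w_def sum.distrib scaleR_sum_right algebra_simps)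
    moreover have "\<zeta> x *\<^sub>R ((\<Sum>i\<in>UNIV. h i x) + q x * u x) = 0"
    proof (cases "x \<in> ball 0 1")
      case False
      then have "\<zeta> x = 0" using K(2) K(3)[of x] by blast
      then show ?thesis by simp
    qed (use elim in simp)
    ultimately show ?case by simp
  qed
  have bound: "Lpow p (\<lambda>x. ?m x *\<^sub>R (laplacian (W k) x + q x * W k x)) \<le>
     ennreal (2 powr p) * (Z k + ennreal A)" if k: "k \<ge> N" for k
  proof -
    have "Lpow p (\<lambda>x. ?m x *\<^sub>R (laplacian (W k) x + q x * W k x)) \<le>
      Lpow p (\<lambda>x. (norm (?D *\<^sub>R ?X k x) + norm (?D *\<^sub>R ?Y k x)) + norm (?m x *\<^sub>R commutator \<zeta> x))"
    proof (rule Lpow_mono_AE[OF p0])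
      show "AE x in lborel. norm (?m x *\<^sub>R (laplacian (W k) x + q x * W k x)) \<le>
        norm ((norm (?D *\<^sub>R ?X k x) + norm (?D *\<^sub>R ?Y k x)) + norm (?m x *\<^sub>R commutator \<zeta> x))"
        using GF
      proof eventually_elim
        case (elim x)
        show ?case
        proof (cases "x \<in> \<Omega>d")
          case True
          have eq: "laplacian (W k) x + q x * W k x = ?X k x + ?Y k x + commutator \<zeta> x"
            unfolding W_lap elim[symmetric] by (simp add: algebra_simps)
          have "norm (?m x *\<^sub>R (laplacian (W k) x + q x * W k x)) \<le>
            ?m x * norm (?X k x) + ?m x * norm (?Y k x) + ?m x * norm (commutator \<zeta> x)"
            unfolding eq norm_scaleR distrib_left[symmetric]
            by (auto intro!: mult_left_mono norm_triangle_le add_mono norm_triangle_ineq)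
          also have "\<dots> \<le> ?D * norm (?X k x) + ?D * norm (?Y k x) + ?m x * norm (commutator \<zeta> x)"
            by (intro add_mono mult_right_mono m_le[OF True]) auto
          finally show ?thesis by simp
        next
          case False
          then show ?thesis using W_out[OF k, of x] by (simp add: add_nonneg_nonneg)
        qed
      qed
    qed
    also have "\<dots> \<le> ennreal (2 powr p) * (Lpow p (\<lambda>x. norm (?D *\<^sub>R ?X k x) + norm (?D *\<^sub>R ?Y k x)) + Lpow p (\<lambda>x. norm (?m x *\<^sub>R commutator \<zeta> x)))"
      by (intro Lpow_add p0) measurable
    also have "Lpow p (\<lambda>x. norm (?m x *\<^sub>R commutator \<zeta> x)) \<le> ennreal A"
      using A(2) by (simp add: Lpow_def)
    also have "Lpow p (\<lambda>x. norm (?D *\<^sub>R ?X k x) + norm (?D *\<^sub>R ?Y k x)) \<le>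
       ennreal (2 powr p) * (Lpow p (\<lambda>x. norm (?D *\<^sub>R ?X k x)) + Lpow p (\<lambda>x. norm (?D *\<^sub>R ?Y k x)))"
      by (intro Lpow_add p0) measurable
    also have "Lpow p (\<lambda>x. norm (?D *\<^sub>R ?X k x)) = ennreal (?D powr p) * Lpow p (?X k)"
      using Lpow_scaleR[of "?X k" p ?D] by (simp add: Lpow_def)
    also have "Lpow p (\<lambda>x. norm (?D *\<^sub>R ?Y k x)) = ennreal (?D powr p) * Lpow p (?Y k)"
      using Lpow_scaleR[of "?Y k" p ?D] by (simp add: Lpow_def)
    finally show ?thesis by (simp add: Z_def add_mono mult_left_mono)
  qed
  show ?thesis
    unfolding w_def[symmetric, THEN fun_cong]
  proof (rule Lpow_fatou[OF _ _ _ W_L1])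
    \<comment> \<open>Since \<open>A > 0\<close>, the error \<open>Z k\<close> eventually falls
      below \<open>A\<close>, and \<open>A + A\<close> accounts for the factor 2. The factor 2^p
      comes from splitting off the commutator.\<close>
    show "\<forall>\<^sub>F k in sequentially. Lpow p' (\<lambda>x. ?m x *\<^sub>R W k x) \<le> ennreal ((\<kappa> * (2 * 2 powr p * A) powr (1 / p)) powr p')"
      using ennreal_tendsto_0D[OF Z A(1)] eventually_ge_at_top[of N]
    proof eventually_elim
      case (elim k)
      have "Lpow p (\<lambda>x. ?m x *\<^sub>R (laplacian (W k) x + q x * W k x)) \<le> ennreal (2 powr p) * (ennreal A + ennreal A)"
        by (rule order_trans[OF bound[OF elim(2)]]) (intro mult_left_mono add_mono elim; simp)
      also have "ennreal A + ennreal A = ennreal (2 * A)" using A(1) by (simp flip: ennreal_plus)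
      also have "ennreal (2 powr p) * ennreal (2 * A) = ennreal (2 * 2 powr p * A)"
        using A(1) by (simp add: ennreal_mult[symmetric] mult_ac)
      finally show ?case
        using A(1) by (intro carleman_Lpow[OF dim carleman \<kappa> W_sub[OF elim(2)] q l, folded p_def p'_def]) auto
    qed
  qed (use p in auto)
qed

end

section \<open>Vanishing of infinite order\<close>

text \<open>The indicator of the ball whose radius is the midpoint of a and b, mollified by a kernel
  supported within half of b - a. Quantifying over \<Omega> inside the conclusion makes one cut-off
  a test function on every admissible domain.\<close>

lemma exists_cutoff:
  assumes ab: "0 < a" "a < b"
  obtains A :: "real^'n::finite \<Rightarrow> real"
  where "\<And>\<Omega>. cball 0 b \<subseteq> \<Omega> \<Longrightarrow> A \<in> test_functions \<Omega>"
    "\<And>x. norm x < a \<Longrightarrow> A x = 1" "\<And>x. norm x > b \<Longrightarrow> A x = 0"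
proof -
  obtain \<eta> :: "nat \<Rightarrow> real^'n \<Rightarrow> real" where ai: "approx_identity \<eta>" and \<eta>: "\<And>k. \<eta> k \<in> test_functions UNIV"
    using exists_smooth_approx_identity by blast
  interpret approx_identity \<eta> by (rule ai)
  define c d where "c = (a + b) / 2" and "d = (b - a) / 2"
  have d: "d > 0" using ab by (simp add: d_def)
  obtain k where k: "1 / Suc k < d" using nat_approx_posE[OF d] by auto
  let ?v = "indicator (cball 0 c) :: real^'n \<Rightarrow> real"
  have v: "integrable lborel ?v" using emeasure_lborel_cball_finite[of "0::real^'n" c] by (simp add: less_top)
  have \<eta>0: "\<eta> k x = 0" if "d \<le> norm x" for x using kernel_support[of k x] that k by simp
  have sub: "norm x \<le> b" if "y \<in> cball 0 c" "norm (x - y) \<le> d" for x y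
    using that norm_triangle_sub[of x y] by (simp add: c_def d_def field_simps)
  have v0: "?v x = 0" if "x \<notin> cball 0 c" for x using that by simp
  show thesis
  proof (rule that[of "conv (\<eta> k) ?v"])
    show "conv (\<eta> k) ?v \<in> test_functions \<Omega>" if "cball 0 b \<subseteq> \<Omega>" for \<Omega>
    proof (rule conv_test_function(1)[OF \<eta> v compact_cball v0 \<eta>0])
      show "x \<in> \<Omega>" if "y \<in> cball 0 c" "norm (x - y) \<le> d" for x y
        using sub[OF that] \<open>cball 0 b \<subseteq> \<Omega>\<close> by auto
    qed
    show "conv (\<eta> k) ?v x = 0" if "norm x > b" for x
      using conv_test_function(2)[OF \<eta> v compact_cball v0 \<eta>0, where \<Omega>=UNIV and x=x] sub[of _ x] that by fastforce
    show "conv (\<eta> k) ?v x = 1" if "norm x < a" for x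
    proof -
      have "\<eta> k (x - y) *\<^sub>R ?v y = \<eta> k (x - y)" for y
      proof (cases "norm (x - y) < d")
        case True
        then have "norm y \<le> c" using that norm_triangle_sub[of y x] by (simp add: norm_minus_commute c_def d_def field_simps)
        then show ?thesis by simp
      qed (use \<eta>0 in auto)
      then have "(\<lambda>y. \<eta> k (x - y) *\<^sub>R ?v y) = (\<lambda>y. \<eta> k (x - y))" by (rule ext)
      then show ?thesis
        using kernel_has_integral[of k x] unfolding conv_def by (simp only: has_bochner_integral_iff)
    qed
  qed
qed

text \<open>These are the midpoints between neighbouring grid points. They supply arbitrarily large
  exponents for the final limit.\<close>

lemma half_shift_mem_Lambda:
  assumes "n \<ge> 3" "k > 0"
  shows "real k + (real n - 2) / 2 + 1 / 2 \<in> Lambda n"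
proof -
  let ?S = "{real k + (real n - 2) / 2 | k::nat. k > 0}"
  let ?l = "real k + (real n - 2) / 2 + 1 / 2"
  have S: "?S \<noteq> {}" using assms(2) by blast
  have "infdist ?l ?S \<le> dist ?l (real k + (real n - 2) / 2)"
    by (rule infdist_le) (use assms in blast)
  then have "infdist ?l ?S \<le> 1 / 2" by (simp add: dist_real_def)
  moreover have "1 / 2 \<le> infdist ?l ?S"
    unfolding infdist_notempty[OF S]
  proof (rule cINF_greatest[OF S])
    fix s assume "s \<in> ?S"
    then obtain j :: nat where j: "s = real j + (real n - 2) / 2" by blast
    \<comment> \<open>The difference of two integers, shifted by 1/2, is never closer to 0 than
      1/2.\<close>
    then have "dist ?l s = \<bar>real k - real j + 1 / 2\<bar>" by (simp add: dist_real_def)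
    also have "\<dots> \<ge> 1 / 2"
    proof (cases "j \<le> k")
      case False
      then have "real k + 1 \<le> real j" by linarith
      then show ?thesis by linarith
    qed simp
    finally show "1 / 2 \<le> dist ?l s" .
  qed
  ultimately have "infdist ?l ?S = 1 / 2" by linarith
  moreover have "(real n - 2) / 2 \<ge> 0" using assms by simp
  then have "?l > 0" by linarith
  ultimately show ?thesis by (simp add: Lambda_def)
qed

text \<open>Both the constant and the radius may depend on the order \<open>m\<close>. This freedom
  lets the property pass to sums and to the gradient without keeping track of a common
  radius.\<close>

definition vanishes_Lp :: "real \<Rightarrow> ('a::euclidean_space \<Rightarrow> 'b::real_normed_vector) \<Rightarrow> bool"
  where "vanishes_Lp p f \<longleftrightarrow> (\<forall>m::nat. \<exists>c>0. \<exists>\<gamma>>0. \<forall>r. 0 < r \<and> r < \<gamma> \<longrightarrow>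
    Lpow_on p (ball 0 r) f \<le> ennreal (c * r ^ m))"

lemma vanishes_Lp_norm: "vanishes_Lp p f \<Longrightarrow> vanishes_Lp p (\<lambda>x. norm (f x))"
  by (simp add: vanishes_Lp_def Lpow_def)

lemma vanishes_Lp_add:
  fixes f g :: "'a::euclidean_space \<Rightarrow> 'b::{real_normed_vector,second_countable_topology}"
  assumes p: "p \<ge> 0" and [measurable]: "f \<in> borel_measurable borel" "g \<in> borel_measurable borel"
    and f: "vanishes_Lp p f" and g: "vanishes_Lp p g"
  shows "vanishes_Lp p (\<lambda>x. f x + g x)"
  unfolding vanishes_Lp_def
proof
  fix m :: nat
  obtain c \<gamma> where c: "c > 0" "\<gamma> > 0" "\<And>r. 0 < r \<Longrightarrow> r < \<gamma> \<Longrightarrow> Lpow_on p (ball 0 r) f \<le> ennreal (c * r ^ m)"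
    using f unfolding vanishes_Lp_def by metis
  obtain c' \<gamma>' where c': "c' > 0" "\<gamma>' > 0" "\<And>r. 0 < r \<Longrightarrow> r < \<gamma>' \<Longrightarrow> Lpow_on p (ball 0 r) g \<le> ennreal (c' * r ^ m)"
    using g unfolding vanishes_Lp_def by metis
  have "Lpow p (\<lambda>x. indicator (ball 0 r) x *\<^sub>R (f x + g x)) \<le> ennreal ((2 powr p * (c + c')) * r ^ m)"
    if r: "0 < r" "r < min \<gamma> \<gamma>'" for r
  proof -
    have [measurable]: "ball (0::'a) r \<in> sets borel" by simp
    have "Lpow p (\<lambda>x. indicator (ball 0 r) x *\<^sub>R (f x + g x)) \<le>
      ennreal (2 powr p) * (Lpow_on p (ball 0 r) f + Lpow_on p (ball 0 r) g)"
      unfolding scaleR_add_right by (intro Lpow_add p) measurable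
    also have "\<dots> \<le> ennreal (2 powr p) * (ennreal (c * r ^ m) + ennreal (c' * r ^ m))"
      using c(3)[of r] c'(3)[of r] r by (intro mult_left_mono add_mono) auto
    also have "\<dots> = ennreal ((2 powr p * (c + c')) * r ^ m)"
      using c c' r by (simp add: ennreal_mult[symmetric] ennreal_plus[symmetric] algebra_simps del: ennreal_plus)
    finally show ?thesis .
  qed
  then show "\<exists>c>0. \<exists>\<gamma>>0. \<forall>r. 0 < r \<and> r < \<gamma> \<longrightarrow>
      Lpow p (\<lambda>x. indicator (ball 0 r) x *\<^sub>R (f x + g x)) \<le> ennreal (c * r ^ m)"
    using c c' by (intro exI[of _ "2 powr p * (c + c')"] exI[of _ "min \<gamma> \<gamma>'"] conjI) auto
qed

lemma vanishes_Lp_sum: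
  fixes f :: "'i \<Rightarrow> 'a::euclidean_space \<Rightarrow> 'b::{real_normed_vector,second_countable_topology}"
  assumes "finite I" "p > 0" "\<And>i. i \<in> I \<Longrightarrow> f i \<in> borel_measurable borel" "\<And>i. i \<in> I \<Longrightarrow> vanishes_Lp p (f i)"
  shows "vanishes_Lp p (\<lambda>x. \<Sum>i\<in>I. f i x)"
  using assms
proof (induction I)
  case empty
  then show ?case by (auto simp: vanishes_Lp_def Lpow_def intro!: exI[of _ 1])
next
  case (insert i I)
  then have "vanishes_Lp p (\<lambda>x. f i x + (\<Sum>i\<in>I. f i x))"
    by (intro vanishes_Lp_add borel_measurable_sum) auto
  with insert show ?case by simp
qed

text \<open>A pointwise substitute for Hoelder between L^2 and L^p. If a^p exceeds s = r^m, then
  a^(p - 2) is at most s^((p - 2)/p), because the exponent p - 2 is not positive.\<close>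

lemma powr_le_split:
  fixes a r p :: real
  assumes p: "1 \<le> p" "p \<le> 2" and r: "0 < r" "r < 1" and a: "a \<ge> 0"
  shows "a powr p \<le> r ^ m + a\<^sup>2 / r ^ m"
proof (cases "a powr p \<le> r ^ m")
  case True
  moreover have "a\<^sup>2 / r ^ m \<ge> 0" using r by simp
  ultimately show ?thesis by linarith
next
  case False
  define s where "s = r ^ m"
  have s: "0 < s" "s \<le> 1" using r by (auto simp: s_def power_le_one)
  have a0: "a > 0" using False a r by (cases "a = 0") (auto simp: zero_le_power)
  have "s powr (1 / p) \<le> (a powr p) powr (1 / p)"
    using False s p by (intro powr_mono2) (auto simp: s_def)
  then have sa: "s powr (1 / p) \<le> a" using p a0 by (simp add: powr_powr)
  have "a powr (p - 2) \<le> (s powr (1 / p)) powr (p - 2)"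
    using sa s p by (intro powr_mono2') auto
  also have "\<dots> = s powr ((p - 2) / p)" by (simp add: powr_powr)
  \<comment> \<open>Here (p - 2)/p \<ge> -1 is just p \<ge> 1, and s \<le> 1 reverses the order of
    exponents.\<close>
  also have "\<dots> \<le> s powr (-1)"
    using s p by (intro powr_mono') (auto simp: field_simps)
  also have "\<dots> = 1 / s" using s by (simp add: powr_minus_divide)
  finally have "a\<^sup>2 * a powr (p - 2) \<le> a\<^sup>2 * (1 / s)" by (intro mult_left_mono) auto
  moreover have "a\<^sup>2 * a powr (p - 2) = a powr p"
    using a0 by (simp flip: powr_numeral powr_add)
  ultimately show ?thesis using s by (simp add: s_def[symmetric])
qed

text \<open>Integrating the splitting over the ball: the term r^m is multiplied by a bounded volume,
  and the loss of r^m in the square term is paid by a higher order of vanishing in L^2.\<close>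

lemma vanishes_Lp_of_infinite_order:
  fixes u :: "real^'n::finite \<Rightarrow> 'b::{real_normed_vector,second_countable_topology}"
  assumes p: "1 \<le> p" "p \<le> 2" and [measurable]: "u \<in> borel_measurable borel" and v: "vanishes_of_infinite_order u"
  shows "vanishes_Lp p u"
  unfolding vanishes_Lp_def
proof
  fix m :: nat
  let ?I = "\<lambda>r. \<integral>\<^sup>+ x. ennreal ((norm (u x))\<^sup>2) * indicator (ball 0 r) x \<partial>lborel"
  obtain \<gamma> where \<gamma>: "0 < \<gamma>" "\<gamma> < 1" and v: "\<And>m::nat. m > 0 \<Longrightarrow> \<exists>c>0. \<forall>r. 0 < r \<and> r < \<gamma> \<longrightarrow>
        ennreal (1 / r ^ m) * (\<integral>\<^sup>+ x. ennreal ((norm (u x))\<^sup>2) \<partial>lebesgue_on (ball 0 r)) \<le> ennreal c"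
    using v unfolding vanishes_of_infinite_order_def by blast
  \<comment> \<open>Order 2m + 1 leaves m + 1 after division by r^m, and it is positive also for
    \<open>m = 0\<close>, as the definition requires.\<close>
  obtain c where c: "c > 0" "\<And>r. 0 < r \<Longrightarrow> r < \<gamma> \<Longrightarrow>
        ennreal (1 / r ^ (2 * m + 1)) * (\<integral>\<^sup>+ x. ennreal ((norm (u x))\<^sup>2) \<partial>lebesgue_on (ball 0 r)) \<le> ennreal c"
    using v[of "2 * m + 1"] by auto
  define b where "b = measure lborel (ball (0::real^'n) 1)"
  have "Lpow_on p (ball 0 r) u \<le> ennreal ((b + c) * r ^ m)"
    if r: "0 < r" "r < \<gamma>" for r
  proof -
    have r1: "r < 1" using r \<gamma> by simp
    have [measurable]: "ball (0::real^'n) r \<in> sets borel" by simp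
    have I: "?I r \<le> ennreal (c * r ^ (2 * m + 1))"
    proof -
      have "ennreal (1 / r ^ (2 * m + 1)) * ?I r \<le> ennreal c"
        using c(2)[OF r] by (simp add: nn_integral_lebesgue_on)
      then have "ennreal (r ^ (2 * m + 1)) * (ennreal (1 / r ^ (2 * m + 1)) * ?I r) \<le> ennreal (r ^ (2 * m + 1)) * ennreal c"
        by (rule mult_left_mono) simp
      moreover have "ennreal (r ^ (2 * m + 1)) * (ennreal (1 / r ^ (2 * m + 1)) * ?I r) = ?I r"
        using r by (simp add: mult.assoc[symmetric] ennreal_mult[symmetric] del: power_Suc)
      ultimately show ?thesis using r c(1) by (simp add: ennreal_mult[symmetric] mult.commute)
    qed
    have "Lpow_on p (ball 0 r) u \<le>
      (\<integral>\<^sup>+ x. ennreal (r ^ m) * indicator (ball 0 r) x + ennreal (1 / r ^ m) * (ennreal ((norm (u x))\<^sup>2) * indicator (ball 0 r) x) \<partial>lborel)"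
      unfolding Lpow_def
    proof (rule nn_integral_mono)
      fix x
      show "ennreal (norm (indicator (ball 0 r) x *\<^sub>R u x) powr p) \<le>
        ennreal (r ^ m) * indicator (ball 0 r) x + ennreal (1 / r ^ m) * (ennreal ((norm (u x))\<^sup>2) * indicator (ball 0 r) x)"
        using powr_le_split[OF p r(1) r1 norm_ge_zero, of "u x" m] r
        by (cases "x \<in> ball 0 r") (simp_all add: ennreal_mult[symmetric] ennreal_plus[symmetric] del: ennreal_plus)
    qed
    also have "\<dots> = ennreal (r ^ m) * emeasure lborel (ball (0::real^'n) r) + ennreal (1 / r ^ m) * ?I r"
      by (simp add: nn_integral_add nn_integral_cmult)
    also have "\<dots> \<le> ennreal (r ^ m) * ennreal b + ennreal (1 / r ^ m) * ennreal (c * r ^ (2 * m + 1))"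
    proof (intro add_mono mult_left_mono I)
      have "emeasure lborel (ball (0::real^'n) r) \<le> emeasure lborel (ball (0::real^'n) 1)"
        using r1 by (intro emeasure_mono) auto
      also have "\<dots> = ennreal b"
        unfolding b_def by (rule emeasure_eq_ennreal_measure) (use emeasure_lborel_ball_finite[of "0::real^'n" 1] in auto)
      finally show "emeasure lborel (ball (0::real^'n) r) \<le> ennreal b" .
    qed auto
    also have "\<dots> = ennreal (b * r ^ m + c * r ^ (m + 1))"
    proof -
      have "1 / r ^ m * (c * r ^ (2 * m + 1)) = c * r ^ (m + 1)"
      proof -
        have "r ^ (2 * m + 1) = r ^ m * r ^ (m + 1)" by (simp add: power_add[symmetric] mult_2)
        then show ?thesis using r by simp
      qed
      moreover have "b \<ge> 0" by (simp add: b_def)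
      ultimately show ?thesis
        using r c(1) by (simp add: ennreal_mult[symmetric] ennreal_plus[symmetric] mult.commute del: ennreal_plus)
    qed
    also have "\<dots> \<le> ennreal ((b + c) * r ^ m)"
    proof (rule ennreal_leI)
      have "r ^ (m + 1) \<le> r ^ m" using r r1 by (intro power_decreasing) auto
      then show "b * r ^ m + c * r ^ (m + 1) \<le> (b + c) * r ^ m"
        using c(1) mult_left_mono[of "r ^ (m + 1)" "r ^ m" c] by (simp add: distrib_right)
    qed
    finally show ?thesis .
  qed
  then show "\<exists>c>0. \<exists>\<gamma>>0. \<forall>r. 0 < r \<and> r < \<gamma> \<longrightarrow>
      Lpow_on p (ball 0 r) u \<le> ennreal (c * r ^ m)"
    using c(1) \<gamma> by (intro exI[of _ "b + c"] exI[of _ \<gamma>] conjI) (auto simp: b_def add_nonneg_pos)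
qed

context vanishing_solution
begin

lemma p_le_2: "p \<le> 2"
  using dim by (simp add: p_def exp_p_def field_simps)

text \<open>Interpolation with a step t that is itself a power of the radius: the bounded second
  derivative term becomes small through t^p, while the cost t^(-p) on \<open>u\<close> is only
  polynomial and is absorbed by the infinite order of vanishing.\<close>

lemma vanishes_Lp_gradient:
  assumes u: "vanishes_Lp p u"
  shows "vanishes_Lp p (g i)"
  unfolding vanishes_Lp_def
proof
  fix m :: nat
  have ab: "(0::real) < 1 / 2" "(1 / 2 :: real) < 3 / 4" by auto
  obtain \<zeta> :: "real^'n \<Rightarrow> real" where \<zeta>: "\<And>\<Omega>. cball 0 (3 / 4) \<subseteq> \<Omega> \<Longrightarrow> \<zeta> \<in> test_functions \<Omega>"
    "\<And>x. norm x < 1 / 2 \<Longrightarrow> \<zeta> x = 1" using exists_cutoff[OF ab] by metis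
  have \<zeta>B: "\<zeta> \<in> test_functions (ball 0 1)" by (rule \<zeta>(1)) auto
  note \<zeta>' = test_functions_partial[OF \<zeta>B]
  note \<zeta>'' = test_functions_partial[OF \<zeta>']
  note borel_measurable_test_partials[OF \<zeta>B, measurable]
  have \<zeta>'0: "partial i \<zeta> x = 0" if "norm x < 1 / 2" for x
    by (rule partial_eq_0_open[where S="ball 0 (1 / 2)" and c=1]) (use that \<zeta>(2) in auto)
  have p0: "p \<ge> 0" using p by simp
  let ?H = "\<lambda>y. \<zeta> y *\<^sub>R h i y + 2 *\<^sub>R partial i \<zeta> y *\<^sub>R g i y + partial i (partial i \<zeta>) y *\<^sub>R u y"
  have "Lpow p (\<lambda>x. 2 *\<^sub>R partial i \<zeta> x *\<^sub>R g i x) < \<infinity>"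
    using Lpow_test_scaleR_finite[OF p0 measurable_ugh(2) \<zeta>' g_finite, of i i]
    by (subst Lpow_scaleR) (auto simp: ennreal_mult_less_top)
  then have H_fin: "Lpow p ?H < \<infinity>"
    by (intro Lpow_add_finite p0 Lpow_test_scaleR_finite[OF p0 _ \<zeta>B] Lpow_test_scaleR_finite[OF p0 _ \<zeta>''] u_finite h_finite; measurable)
  define K where "K = enn2real (Lpow p ?H)"
  have K: "Lpow p ?H = ennreal K" "K \<ge> 0" using H_fin by (auto simp: K_def)
  \<comment> \<open>The order is (2m + 2) + (m + 1): the first summand pays for t^(-p), the second
    is more than the wanted order m.\<close>
  obtain c \<gamma> where c: "c > 0" "\<gamma> > 0"
    "\<And>r. 0 < r \<Longrightarrow> r < \<gamma> \<Longrightarrow> Lpow_on p (ball 0 r) u \<le> ennreal (c * r ^ (3 * m + 3))"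
    using u unfolding vanishes_Lp_def by metis
  define b where "b = 16 powr p * (2 * c * 2 ^ (3 * m + 3) + K)"
  \<comment> \<open>For r below 1/4 the ball of radius 2r lies where \<zeta> is 1, so the cut-off
    disappears from both sides of the interpolation and survives only in the constant
    \<open>K\<close>.\<close>
  have bound: "Lpow_on p (ball 0 r) (g i) \<le> ennreal (b * r ^ m)"
    if r: "0 < r" "r < min (\<gamma> / 2) (1 / 4)" for r
  proof -
    \<comment> \<open>t \<le> r keeps the shifted points in the ball of radius 2r; p \<ge> 1 gives
      t^p \<le> r^m, and p \<le> 2 gives t^(-p) \<le> r^(-(2m + 2)).\<close>
    define t where "t = r ^ (m + 1)"
    have r1: "r < 1" using r by auto
    have t: "t > 0" "t \<le> r" using r r1 by (auto simp: t_def power_le_one mult_left_le)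
    have "Lpow_on p (ball 0 r) (g i) = Lpow p (\<lambda>x. indicator (ball 0 r) x *\<^sub>R (\<zeta> x *\<^sub>R g i x + partial i \<zeta> x *\<^sub>R u x))"
      using r by (intro arg_cong[where f="Lpow p"] ext) (auto simp: indicator_def \<zeta>(2) \<zeta>'0)
    also have "\<dots> \<le> ennreal (16 powr p) * (ennreal (2 * t powr (-p)) * Lpow p (\<lambda>x. indicator (ball 0 (2 * r)) x *\<^sub>R \<zeta> x *\<^sub>R u x)
      + ennreal (t powr p) * Lpow p ?H)"
    proof (rule Lpow_weak_partial_interpolation[OF p(1) \<zeta>B grad hess u_finite g_finite t(1)])
      show "x + t *\<^sub>R axis i 1 \<in> ball 0 (2 * r)" if "x \<in> ball 0 r" for x :: "real^'n"
        using that t norm_triangle_ineq[of x "t *\<^sub>R axis i 1"] by simp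
    qed (use r in auto)
    also have "Lpow p (\<lambda>x. indicator (ball 0 (2 * r)) x *\<^sub>R \<zeta> x *\<^sub>R u x) = Lpow_on p (ball 0 (2 * r)) u"
      using r by (intro arg_cong[where f="Lpow p"] ext) (auto simp: indicator_def \<zeta>(2))
    also have "\<dots> \<le> ennreal (c * (2 * r) ^ (3 * m + 3))"
      by (rule c(3)) (use r in auto)
    also have "ennreal (t powr p) \<le> ennreal (r ^ m)"
    proof (rule ennreal_leI)
      have "t powr p \<le> t powr 1" using t r1 p by (intro powr_mono') auto
      also have "\<dots> = r ^ (m + 1)" using t by (simp add: t_def)
      also have "\<dots> \<le> r ^ m" using r r1 by (intro power_decreasing) auto
      finally show "t powr p \<le> r ^ m" .
    qed
    also have "ennreal (2 * t powr (-p)) \<le> ennreal (2 / r ^ (2 * m + 2))"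
    proof (rule ennreal_leI)
      have "t powr (-p) \<le> t powr (-2)" using t r1 p_le_2 by (intro powr_mono') auto
      also have "\<dots> = 1 / t\<^sup>2" using t by (simp add: powr_minus_divide)
      also have "t\<^sup>2 = r ^ (2 * m + 2)" unfolding t_def power_mult[symmetric] by (rule arg_cong[where f="\<lambda>k. r ^ k"]) simp
      finally show "2 * t powr (-p) \<le> 2 / r ^ (2 * m + 2)" by simp
    qed
    also have "ennreal (16 powr p) * (ennreal (2 / r ^ (2 * m + 2)) * ennreal (c * (2 * r) ^ (3 * m + 3)) + ennreal (r ^ m) * Lpow p ?H)
      = ennreal (16 powr p * (2 / r ^ (2 * m + 2) * (c * (2 * r) ^ (3 * m + 3)) + r ^ m * K))"
      unfolding K(1) using r c(1) K(2) by (simp add: ennreal_mult[symmetric] ennreal_plus[symmetric] del: ennreal_plus power_Suc)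
    also have "\<dots> \<le> ennreal (b * r ^ m)"
    proof (rule ennreal_leI)
      have "2 / r ^ (2 * m + 2) * (c * (2 * r) ^ (3 * m + 3)) = 2 * c * 2 ^ (3 * m + 3) * (r ^ (3 * m + 3) / r ^ (2 * m + 2))"
        by (simp add: power_mult_distrib del: power_Suc power_add)
      also have "r ^ (3 * m + 3) / r ^ (2 * m + 2) = r ^ (m + 1)"
        using r by (subst power_diff[symmetric]) auto
      also have "2 * c * 2 ^ (3 * m + 3) * r ^ (m + 1) \<le> 2 * c * 2 ^ (3 * m + 3) * r ^ m"
        using r r1 c(1) by (intro mult_left_mono power_decreasing) auto
      finally have "2 / r ^ (2 * m + 2) * (c * (2 * r) ^ (3 * m + 3)) + r ^ m * K \<le> (2 * c * 2 ^ (3 * m + 3) + K) * r ^ m"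
        by (simp add: algebra_simps)
      then show "16 powr p * (2 / r ^ (2 * m + 2) * (c * (2 * r) ^ (3 * m + 3)) + r ^ m * K) \<le> b * r ^ m"
        unfolding b_def mult.assoc by (intro mult_left_mono) auto
    qed
    finally show ?thesis by (simp add: mult_left_mono mult_right_mono add_mono)
  qed
  have "b > 0" unfolding b_def using c(1) K(2) by (simp add: add_pos_nonneg)
  moreover have "min (\<gamma> / 2) (1 / 4) > 0" using c(2) by simp
  ultimately show "\<exists>c>0. \<exists>\<gamma>>0. \<forall>r. 0 < r \<and> r < \<gamma> \<longrightarrow> Lpow_on p (ball 0 r) (g i) \<le> ennreal (c * r ^ m)"
    using bound by blast
qed


section \<open>The commutator under differences and dilations\<close>

lemma commutator_diff:
  assumes \<zeta>: "smooth \<zeta>" and \<xi>: "smooth \<xi>"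
  shows "commutator (\<lambda>x. \<zeta> x - \<xi> x) x = commutator \<zeta> x - commutator \<xi> x"
proof -
  have 1: "partial i (\<lambda>x. \<zeta> x - \<xi> x) = (\<lambda>x. partial i \<zeta> x - partial i \<xi> x)" for i
    by (intro ext partial_diff smooth_differentiable \<zeta> \<xi>)
  have 2: "partial i (\<lambda>x. partial i \<zeta> x - partial i \<xi> x) x = partial i (partial i \<zeta>) x - partial i (partial i \<xi>) x" for i
    by (intro partial_diff smooth_differentiable smooth_partial \<zeta> \<xi>)
  show ?thesis unfolding commutator_def 1 2 by (simp add: algebra_simps sum_subtractf sum.distrib)
qed

lemma commutator_dilate:
  assumes \<zeta>: "smooth \<zeta>"
  shows "commutator (\<lambda>x. \<zeta> (c *\<^sub>R x)) x =
    (\<Sum>i\<in>UNIV. (2 * c * partial i \<zeta> (c *\<^sub>R x)) *\<^sub>R g i x + (c\<^sup>2 * partial i (partial i \<zeta>) (c *\<^sub>R x)) *\<^sub>R u x)"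
proof -
  have aff: "partial i (\<lambda>x. f (c *\<^sub>R x)) x = c * partial i f (c *\<^sub>R x)" if "smooth f" for f :: "real^'n \<Rightarrow> real" and x i
    using partial_affine[where f=f and a=0 and c=c and x=x and i=i, OF smooth_differentiable[OF that]] by simp
  have 1: "partial i (\<lambda>x. \<zeta> (c *\<^sub>R x)) = (\<lambda>x. c *\<^sub>R partial i \<zeta> (c *\<^sub>R x))" for i
    using aff[OF \<zeta>] by auto
  have "partial i (\<lambda>x. c *\<^sub>R partial i \<zeta> (c *\<^sub>R x)) x = c\<^sup>2 * partial i (partial i \<zeta>) (c *\<^sub>R x)" for i
  proof -
    have "smooth (\<lambda>x. partial i \<zeta> (c *\<^sub>R x))"
      using smooth_affine[OF smooth_partial[OF \<zeta>, of i], where a=0 and c=c] by simp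
    then have "partial i (\<lambda>x. c *\<^sub>R partial i \<zeta> (c *\<^sub>R x)) x = c *\<^sub>R partial i (\<lambda>x. partial i \<zeta> (c *\<^sub>R x)) x"
      by (subst partial_scaleR) (auto simp: smooth_differentiable partial_eq_0_open[where S=UNIV and c=c])
    then show ?thesis by (simp add: aff[OF smooth_partial[OF \<zeta>]] power2_eq_square)
  qed
  then show ?thesis unfolding commutator_def 1 by (simp add: mult.assoc)
qed

lemma commutator_eq_0:
  assumes "open S" "x \<in> S" "\<And>y. y \<in> S \<Longrightarrow> \<zeta> y = c"
  shows "commutator \<zeta> x = 0"
proof -
  have 1: "partial i \<zeta> y = 0" if "y \<in> S" for i y
    using partial_eq_0_open[OF assms(1) that assms(3)] .
  have "partial i (partial i \<zeta>) x = 0" for i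
    using partial_eq_0_open[OF assms(1,2) 1] .
  then show ?thesis using 1[OF assms(2)] by (simp add: commutator_def)
qed

lemma Lpow_commutator_finite:
  assumes "\<zeta> \<in> test_functions (ball 0 1)"
  shows "Lpow p (commutator \<zeta>) < \<infinity>"
proof -
  note \<zeta>' = test_functions_partial[OF assms]
  note \<zeta>'' = test_functions_partial[OF \<zeta>']
  have p0: "p \<ge> 0" using p by simp
  have [measurable]: "partial i \<zeta> \<in> borel_measurable borel" "partial i (partial i \<zeta>) \<in> borel_measurable borel" for i
    by (intro borel_measurable_test_function[OF \<zeta>'] borel_measurable_test_function[OF \<zeta>''])+
  have scale: "Lpow p (\<lambda>x. 2 *\<^sub>R partial i \<zeta> x *\<^sub>R g i x) < \<infinity>" for i
    using Lpow_test_scaleR_finite[OF p0 measurable_ugh(2) \<zeta>' g_finite, of i i]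
    by (subst Lpow_scaleR) (auto simp: ennreal_mult_less_top)
  have "Lpow p (\<lambda>x. \<Sum>i\<in>I. 2 *\<^sub>R partial i \<zeta> x *\<^sub>R g i x + partial i (partial i \<zeta>) x *\<^sub>R u x) < \<infinity>" if "finite I" for I
    using that
  proof (induction I)
    case (insert j I)
    have "Lpow p (\<lambda>x. (2 *\<^sub>R partial j \<zeta> x *\<^sub>R g j x + partial j (partial j \<zeta>) x *\<^sub>R u x) +
       (\<Sum>i\<in>I. 2 *\<^sub>R partial i \<zeta> x *\<^sub>R g i x + partial i (partial i \<zeta>) x *\<^sub>R u x)) < \<infinity>"
      by (intro Lpow_add_finite p0 scale insert.IH Lpow_test_scaleR_finite[OF p0 _ \<zeta>''] u_finite; measurable)
    with insert show ?case by simp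
  qed (simp add: Lpow_def)
  then show ?thesis unfolding commutator_def[abs_def] by simp
qed

text \<open>The commutator of A - A(x/e) splits into an outer part in |x| \<ge> 1/2 and an inner
  part at scale e. For a fixed annulus and exponent, e is chosen last, so that the final bound has a
  constant \<open>F\<close> free of all three.\<close>

lemma vanishes_near_0:
  assumes u: "vanishes_Lp p u"
  shows "AE x in lborel. x \<in> ball 0 (1 / 4) \<longrightarrow> u x = 0"
proof -
  have p0: "p \<ge> 0" using p by simp
  have ab: "(0::real) < 1 / 2" "(1 / 2 :: real) < 3 / 4" by auto
  obtain A :: "real^'n \<Rightarrow> real" where A: "\<And>\<Omega>. cball 0 (3 / 4) \<subseteq> \<Omega> \<Longrightarrow> A \<in> test_functions \<Omega>"
    "\<And>x. norm x < 1 / 2 \<Longrightarrow> A x = 1" "\<And>x. norm x > 3 / 4 \<Longrightarrow> A x = 0"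
    using exists_cutoff[OF ab] by metis
  have AB: "A \<in> test_functions (ball 0 1)" by (rule A(1)) auto
  note A' = test_functions_partial[OF AB]
  note A'' = test_functions_partial[OF A']
  have sA: "smooth A" by (rule test_functionsD(1)[OF AB])
  note borel_measurable_test_partials[OF AB, measurable]
  obtain D where D: "D > 0" "\<And>i x. \<bar>partial i A x\<bar> \<le> D" "\<And>i x. \<bar>partial i (partial i A) x\<bar> \<le> D"
  proof -
    have "\<exists>B>0. \<forall>x. norm (partial i A x) \<le> B" "\<exists>B>0. \<forall>x. norm (partial i (partial i A) x) \<le> B" for i
      using test_function_bounded[OF A', of i] test_function_bounded[OF A'', of i i] by metis+
    then obtain B B' where B: "\<And>i. B i > 0" "\<And>i x. norm (partial i A x) \<le> B i"
      "\<And>i. B' i > 0" "\<And>i x. norm (partial i (partial i A) x) \<le> B' i" by metis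
    define D where "D = (\<Sum>i\<in>UNIV. B i + B' i)"
    have "B i + B' i \<le> D" for i
      unfolding D_def by (rule member_le_sum) (use B in \<open>auto intro!: less_imp_le[OF add_pos_pos]\<close>)
    then have le: "B i \<le> D" "B' i \<le> D" for i using B(1)[of i] B(3)[of i] by (smt (verit))+
    show thesis
    proof (rule that[of D])
      show "D > 0" using le(1) B(1) by (meson less_le_trans)
      show "\<bar>partial i A x\<bar> \<le> D" "\<bar>partial i (partial i A) x\<bar> \<le> D" for i x
        using B(2)[of i x] B(4)[of i x] le[of i] by auto
    qed
  qed
  \<comment> \<open>One function dominating every term of the inner commutator. It contains |u| once
    per coordinate, which does no harm.\<close>
  define R where "R = (\<lambda>x. \<Sum>i\<in>UNIV. norm (g i x) + norm (u x))"
  have R_meas [measurable]: "R \<in> borel_measurable borel" unfolding R_def by measurable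
  have R0: "R x \<ge> 0" for x unfolding R_def by (intro sum_nonneg) auto
  have R: "vanishes_Lp p R"
    unfolding R_def using p u
    by (intro vanishes_Lp_sum vanishes_Lp_add vanishes_Lp_norm vanishes_Lp_gradient) auto
  define KA where "KA = enn2real (Lpow p (commutator A))"
  have KA: "Lpow p (commutator A) = ennreal KA" "KA \<ge> 0"
    using Lpow_commutator_finite[OF AB] by (auto simp: KA_def)
  \<comment> \<open>Quasi-triangle factor times outer contribution \<open>KA\<close> plus inner
    contribution 1, after the common factor 2^(l p) has been taken out.\<close>
  define E where "E = 2 powr p * (KA + 1)"
  have E: "E > 0" using KA(2) by (simp add: E_def)
  define F where "F = (\<kappa> * (2 * 2 powr p * E) powr (1 / p)) powr p'"
  have comm_meas: "commutator \<zeta> \<in> borel_measurable borel" if "smooth \<zeta>" for \<zeta>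
  proof -
    have [measurable]: "partial i \<zeta> \<in> borel_measurable borel" "partial i (partial i \<zeta>) \<in> borel_measurable borel" for i
      by (intro borel_measurable_continuous_onI smooth_continuous_on smooth_partial that)+
    show ?thesis unfolding commutator_def[abs_def] by measurable
  qed
  have key: "Lpow_on p' (ball 0 (1 / 4) - ball 0 \<rho>) u \<le> ennreal (F * 2 powr (- l * p'))"
    if \<rho>: "\<rho> > 0" and l: "l \<in> Lambda CARD('n)" for \<rho> l
  proof -
    have l0: "l > 0" using l by (simp add: Lambda_def)
    let ?m = "\<lambda>x::real^'n. norm x powr (-l)"
    \<comment> \<open>The weight costs e^(-l) and the derivatives of the dilated cut-off e^(-2).
      Order p (l + 2) + 1 in the power integral compensates both and leaves one factor e.\<close>
    obtain M :: nat where M: "p * (l + 2) + 1 \<le> real M" using real_arch_simple by blast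
    obtain c \<gamma> where c: "c > 0" "\<gamma> > 0"
      "\<And>r. 0 < r \<Longrightarrow> r < \<gamma> \<Longrightarrow> Lpow_on p (ball 0 r) R \<le> ennreal (c * r ^ M)"
      using R unfolding vanishes_Lp_def by metis
    define B where "B = (2 * D) powr p * 2 powr (l * p) * c"
    have B: "B > 0" using c D by (simp add: B_def)
    \<comment> \<open>e \<le> \<rho> hides the inner cut-off from the annulus, e < \<gamma>
      activates the decay of \<open>R\<close>, and the last entry turns the spare factor e into
      \<open>B * e \<le> 1\<close>.\<close>
    define e where "e = min (min (1 / 2) \<rho>) (min (\<gamma> / 2) (1 / (B + 1)))"
    have e: "0 < e" "e \<le> 1 / 2" "e \<le> \<rho>" "e < \<gamma>" "B * e \<le> 1"
    proof -
      show "0 < e" "e \<le> 1 / 2" "e \<le> \<rho>" "e < \<gamma>" using \<rho> c B by (auto simp: e_def min_less_iff_disj min_le_iff_disj)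
      have "B * e \<le> B * (1 / (B + 1))" using B by (intro mult_left_mono) (auto simp: e_def)
      also have "\<dots> \<le> 1" using B by (simp add: field_simps)
      finally show "B * e \<le> 1" .
    qed
    define Ae where "Ae = (\<lambda>x. A ((1 / e) *\<^sub>R x))"
    have sAe: "smooth Ae" unfolding Ae_def using smooth_affine[OF sA, of 0 "1 / e"] by simp
    have Ae1: "Ae x = 1" if "norm x < e / 2" for x using that e by (auto simp: Ae_def field_simps intro!: A(2))
    have Ae0: "Ae x = 0" if "norm x > 3 / 4 * e" for x using that e by (auto simp: Ae_def field_simps intro!: A(3))
    define \<zeta> where "\<zeta> = (\<lambda>x. A x - Ae x)"
    have \<zeta>: "\<zeta> \<in> test_functions (ball 0 1 - {0})"
    proof (rule test_functionsI)
      show "smooth \<zeta>" unfolding \<zeta>_def by (rule smooth_diff[OF sA sAe])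
      show "compact (cball 0 (3 / 4) - ball 0 (e / 2) :: (real^'n) set)" by (intro compact_diff compact_cball open_ball)
      show "cball 0 (3 / 4) - ball 0 (e / 2) \<subseteq> (ball 0 1 - {0} :: (real^'n) set)" using e by auto
      show "\<zeta> x = 0" if "x \<notin> cball 0 (3 / 4) - ball 0 (e / 2)" for x
      proof (cases "norm x < e / 2")
        case True
        then show ?thesis using e A(2)[of x] Ae1[of x] by (simp add: \<zeta>_def)
      next
        case False
        then have "norm x > 3 / 4" using that by auto
        then show ?thesis using e A(3)[of x] Ae0[of x] by (simp add: \<zeta>_def)
      qed
    qed
    \<comment> \<open>The commutator of A vanishes in |x| < 1/2, where A is constant; elsewhere the
      weight is at most 2^l.\<close>
    have outer: "norm (?m x *\<^sub>R commutator A x) \<le> norm (2 powr l *\<^sub>R commutator A x)" for x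
    proof (cases "norm x < 1 / 2")
      case True
      then have "commutator A x = 0" by (intro commutator_eq_0[of "ball 0 (1 / 2)" _ _ 1]) (auto simp: A(2))
      then show ?thesis by simp
    next
      case False
      then have "?m x \<le> (1 / 2) powr (-l)" using l0 by (intro powr_mono2') auto
      also have "\<dots> = 2 powr l" by (simp add: powr_minus_divide powr_divide)
      finally show ?thesis by (simp add: mult_right_mono)
    qed
    let ?c = "(2 / e) powr l * (2 * D / e\<^sup>2)"
    have inner: "norm (?m x *\<^sub>R commutator Ae x) \<le> norm (?c *\<^sub>R (indicator (ball 0 e) x *\<^sub>R R x))" for x
    proof -
      \<comment> \<open>Outside the layer e/2 \<le> |x| \<le> 3e/4 the dilated cut-off is locally
        constant. Inside it the weight is at most (2/e)^l, and both derivative factors 1/e and 1/e^2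
        are bounded by 1/e^2.\<close>
      consider "norm x < e / 2" | "norm x > 3 / 4 * e" | "e / 2 \<le> norm x" "norm x \<le> 3 / 4 * e" by linarith
      then show ?thesis
      proof cases
        case 1
        then have "commutator Ae x = 0" by (intro commutator_eq_0[of "ball 0 (e / 2)" _ _ 1]) (auto simp: Ae1)
        then show ?thesis by simp
      next
        case 2
        then have "commutator Ae x = 0"
          by (intro commutator_eq_0[of "- cball 0 (3 / 4 * e)" _ _ 0]) (auto simp: Ae0)
        then show ?thesis by simp
      next
        case 3
        have "?m x \<le> (e / 2) powr (-l)" using 3 l0 e by (intro powr_mono2') auto
        also have "\<dots> = (2 / e) powr l" using e by (simp add: powr_minus_divide powr_divide)
        finally have m: "?m x \<le> (2 / e) powr l" .
        have e1: "1 \<le> 1 / e" using e by simp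
        then have e2: "1 / e \<le> (1 / e)\<^sup>2" by (rule self_le_power) simp
        have "norm (commutator Ae x) \<le> (\<Sum>i\<in>UNIV. (2 * D / e\<^sup>2) * (norm (g i x) + norm (u x)))"
          unfolding Ae_def commutator_dilate[OF sA]
        proof (rule sum_norm_le)
          fix i
          let ?y = "(1 / e) *\<^sub>R x"
          have "norm ((2 * (1 / e) * partial i A ?y) *\<^sub>R g i x + ((1 / e)\<^sup>2 * partial i (partial i A) ?y) *\<^sub>R u x) \<le>
            (2 * (1 / e) * \<bar>partial i A ?y\<bar>) * norm (g i x) + ((1 / e)\<^sup>2 * \<bar>partial i (partial i A) ?y\<bar>) * norm (u x)"
            using e(1) by (intro norm_triangle_le) (simp add: abs_mult)
          also have "\<dots> \<le> (2 * (1 / e)\<^sup>2 * D) * norm (g i x) + (2 * (1 / e)\<^sup>2 * D) * norm (u x)"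
          proof (intro add_mono mult_right_mono)
            show "2 * (1 / e) * \<bar>partial i A ?y\<bar> \<le> 2 * (1 / e)\<^sup>2 * D"
              using D(1,2) e1 e2 e(1) by (intro mult_mono) auto
            have "(1 / e)\<^sup>2 \<le> 2 * (1 / e)\<^sup>2" by simp
            then show "(1 / e)\<^sup>2 * \<bar>partial i (partial i A) ?y\<bar> \<le> 2 * (1 / e)\<^sup>2 * D"
              using D(1,3) by (intro mult_mono) auto
          qed auto
          also have "\<dots> = (2 * D / e\<^sup>2) * (norm (g i x) + norm (u x))"
            by (simp add: power_divide distrib_left)
          finally show "norm ((2 * (1 / e) * partial i A ?y) *\<^sub>R g i x + ((1 / e)\<^sup>2 * partial i (partial i A) ?y) *\<^sub>R u x)
            \<le> (2 * D / e\<^sup>2) * (norm (g i x) + norm (u x))" .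
        qed
        also have "\<dots> = (2 * D / e\<^sup>2) * R x" by (simp add: R_def sum_distrib_left)
        finally have "?m x * norm (commutator Ae x) \<le> (2 / e) powr l * ((2 * D / e\<^sup>2) * R x)"
          using m by (intro mult_mono) auto
        moreover have "x \<in> ball 0 e" using 3 e by simp
        ultimately show ?thesis using R0[of x] D(1) by (simp add: abs_mult mult.assoc)
      qed
    qed
    have inner_Lp: "Lpow p (\<lambda>x. ?m x *\<^sub>R commutator Ae x) \<le> ennreal (2 powr (l * p))"
    proof -
      have [measurable]: "ball (0::real^'n) e \<in> sets borel" by simp
      have "Lpow p (\<lambda>x. ?m x *\<^sub>R commutator Ae x) \<le> Lpow p (\<lambda>x. ?c *\<^sub>R (indicator (ball 0 e) x *\<^sub>R R x))"
        by (rule Lpow_mono[OF p0 inner])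
      also have "\<dots> = ennreal (?c powr p) * Lpow_on p (ball 0 e) R"
        using D(1) by (subst Lpow_scaleR) auto
      also have "\<dots> \<le> ennreal (?c powr p) * ennreal (c * e ^ M)"
        using c(3)[OF e(1,4)] by (rule mult_left_mono) simp
      also have "\<dots> = ennreal (?c powr p * (c * e ^ M))"
        by (rule ennreal_mult[symmetric]) (use c e in auto)
      also have "?c powr p * (c * e ^ M) \<le> 2 powr (l * p)"
      proof -
        have c_eq: "?c = 2 powr l * (2 * D) * e powr (- (l + 2))"
        proof -
          have "e powr (- (l + 2)) = 1 / (e powr l * e\<^sup>2)"
            unfolding powr_minus_divide powr_add using e(1) by simp
          moreover have "(2 / e) powr l = 2 powr l / e powr l"
            using e(1) by (simp add: powr_divide)
          ultimately show ?thesis by simp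
        qed
        have "?c powr p = 2 powr (l * p) * (2 * D) powr p * e powr (- (l + 2) * p)"
          unfolding c_eq by (simp add: powr_mult powr_powr)
        then have "?c powr p * (c * e ^ M) = B * (e powr (- (l + 2) * p) * e powr real M)"
          using e(1) by (simp add: B_def powr_realpow)
        also have "e powr (- (l + 2) * p) * e powr real M = e powr (- (l + 2) * p + real M)"
          by (rule powr_add[symmetric])
        also have "\<dots> \<le> e powr 1"
          using M e by (intro powr_mono') (auto simp: algebra_simps)
        also have "B * e powr 1 \<le> 1" using e by simp
        finally have "?c powr p * (c * e ^ M) \<le> 1" using B by simp
        \<comment> \<open>A deliberate loss, giving the inner part the same growth in l as the outer
          one.\<close>
        also have "1 \<le> 2 powr (l * p)" using l0 p by (intro ge_one_powr_ge_zero) auto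
        finally show ?thesis .
      qed
      finally show ?thesis by (simp add: ennreal_leI)
    qed
    have [measurable]: "commutator A \<in> borel_measurable borel" "commutator Ae \<in> borel_measurable borel"
      using comm_meas sA sAe by auto
    have comm: "Lpow p (\<lambda>x. ?m x *\<^sub>R commutator \<zeta> x) \<le> ennreal (2 powr (l * p) * E)"
    proof -
      have "Lpow p (\<lambda>x. ?m x *\<^sub>R commutator \<zeta> x) = Lpow p (\<lambda>x. ?m x *\<^sub>R commutator A x - ?m x *\<^sub>R commutator Ae x)"
        unfolding \<zeta>_def commutator_diff[OF sA sAe] scaleR_diff_right ..
      also have "\<dots> \<le> ennreal (2 powr p) * (Lpow p (\<lambda>x. ?m x *\<^sub>R commutator A x) + Lpow p (\<lambda>x. ?m x *\<^sub>R commutator Ae x))"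
        by (intro Lpow_diff p0) measurable
      also have "Lpow p (\<lambda>x. ?m x *\<^sub>R commutator A x) \<le> Lpow p (\<lambda>x. 2 powr l *\<^sub>R commutator A x)"
        by (rule Lpow_mono[OF p0 outer])
      also have "\<dots> = ennreal (2 powr (l * p)) * ennreal KA"
        by (subst Lpow_scaleR) (auto simp: KA powr_powr)
      also have "ennreal (2 powr p) * (ennreal (2 powr (l * p)) * ennreal KA + Lpow p (\<lambda>x. ?m x *\<^sub>R commutator Ae x)) \<le>
        ennreal (2 powr p) * (ennreal (2 powr (l * p)) * ennreal KA + ennreal (2 powr (l * p)))"
        by (intro mult_left_mono add_mono inner_Lp) auto
      also have "\<dots> = ennreal (2 powr p * (2 powr (l * p) * KA + 2 powr (l * p)))"
        using KA(2) by (simp add: ennreal_mult[symmetric] ennreal_plus[symmetric] del: ennreal_plus)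
      also have "2 powr p * (2 powr (l * p) * KA + 2 powr (l * p)) = 2 powr (l * p) * E"
        by (simp add: E_def algebra_simps)
      finally show ?thesis by (simp add: mult_left_mono add_mono)
    qed
    \<comment> \<open>On the annulus the weight is at least 4^l and \<zeta> is 1, since |x| \<ge>
      \<rho> \<ge> e puts x outside the support of the inner cut-off.\<close>
    have "ennreal (4 powr (l * p')) * Lpow_on p' (ball 0 (1 / 4) - ball 0 \<rho>) u =
       Lpow p' (\<lambda>x. 4 powr l *\<^sub>R (indicator (ball 0 (1 / 4) - ball 0 \<rho>) x *\<^sub>R u x))"
    proof -
      have [measurable]: "ball (0::real^'n) (1 / 4) - ball 0 \<rho> \<in> sets borel" by simp
      show ?thesis by (subst Lpow_scaleR) (auto simp: powr_powr)
    qed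
    also have "\<dots> \<le> Lpow p' (\<lambda>x. ?m x *\<^sub>R \<zeta> x *\<^sub>R u x)"
    proof (rule Lpow_mono)
      fix x
      show "norm (4 powr l *\<^sub>R (indicator (ball 0 (1 / 4) - ball 0 \<rho>) x *\<^sub>R u x)) \<le> norm (?m x *\<^sub>R \<zeta> x *\<^sub>R u x)"
      proof (cases "x \<in> ball 0 (1 / 4) - ball 0 \<rho>")
        case True
        then have x: "norm x < 1 / 4" "norm x \<ge> \<rho>" "norm x > 0" using \<rho> by auto
        have "norm x > 3 / 4 * e" using x(2) e(1,3) by linarith
        then have "\<zeta> x = 1" using A(2)[of x] Ae0[of x] x(1) by (simp add: \<zeta>_def)
        moreover have "4 powr l \<le> ?m x"
        proof -
          have "(1 / 4) powr (-l) \<le> ?m x" using x l0 by (intro powr_mono2') auto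
          then show ?thesis by (simp add: powr_minus_divide powr_divide)
        qed
        ultimately show ?thesis using True by (simp add: mult_right_mono)
      qed simp
    qed (use p in auto)
    also have "\<dots> \<le> ennreal ((\<kappa> * (2 * 2 powr p * (2 powr (l * p) * E)) powr (1 / p)) powr p')"
      by (rule carleman_cutoff[OF \<zeta> l _ comm]) (use E in auto)
    also have "(\<kappa> * (2 * 2 powr p * (2 powr (l * p) * E)) powr (1 / p)) powr p' = F * 2 powr (l * p')"
    proof -
      have "2 * 2 powr p * (2 powr (l * p) * E) = (2 * 2 powr p * E) * 2 powr (l * p)" by simp
      then have "(2 * 2 powr p * (2 powr (l * p) * E)) powr (1 / p) = (2 * 2 powr p * E) powr (1 / p) * 2 powr l"
        using p by (simp only: powr_mult powr_powr) simp
      then show ?thesis unfolding F_def by (simp only: mult.assoc[symmetric] powr_mult powr_powr)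
    qed
    finally have le: "ennreal (4 powr (l * p')) * Lpow_on p' (ball 0 (1 / 4) - ball 0 \<rho>) u \<le> ennreal (F * 2 powr (l * p'))" .
    \<comment> \<open>Cancelling 4^(l p') against 2^(l p') leaves 2^(-l p'): the gain is the ratio
      of the radii 1/2 and 1/4.\<close>
    have "ennreal (4 powr (- l * p')) * (ennreal (4 powr (l * p')) * Lpow_on p' (ball 0 (1 / 4) - ball 0 \<rho>) u)
      \<le> ennreal (4 powr (- l * p')) * ennreal (F * 2 powr (l * p'))"
      by (rule mult_left_mono[OF le]) simp
    moreover have "ennreal (4 powr (- l * p')) * ennreal (4 powr (l * p')) = 1"
      by (simp add: ennreal_mult[symmetric] powr_add[symmetric])
    moreover have "ennreal (4 powr (- l * p')) * ennreal (F * 2 powr (l * p')) = ennreal (F * 2 powr (- l * p'))"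
    proof -
      have "(4::real) powr (- l * p') = 2 powr (- l * p') * 2 powr (- l * p')" by (simp add: powr_mult[symmetric])
      then have "4 powr (- l * p') * (F * 2 powr (l * p')) = F * 2 powr (- l * p') * (2 powr (- l * p') * 2 powr (l * p'))" by simp
      also have "2 powr (- l * p') * 2 powr (l * p') = (1::real)" by (simp add: powr_add[symmetric])
      finally have "4 powr (- l * p') * (F * 2 powr (l * p')) = F * 2 powr (- l * p')"
        by (simp only: mult_1_right)
      then show ?thesis by (metis ennreal_mult' powr_ge_zero)
    qed
    ultimately show ?thesis by (simp add: mult.assoc[symmetric])
  qed
  have AE_annulus: "AE x in lborel. indicator (ball 0 (1 / 4) - ball 0 \<rho>) x *\<^sub>R u x = 0" if \<rho>: "\<rho> > 0" for \<rho>
  proof -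
    let ?f = "\<lambda>x. indicator (ball 0 (1 / 4) - ball 0 \<rho>) x *\<^sub>R u x"
    have [measurable]: "ball (0::real^'n) (1 / 4) - ball 0 \<rho> \<in> sets borel" by simp
    have "(\<lambda>k. F * 2 powr (- (real k + (real CARD('n) - 2) / 2 + 1 / 2) * p')) \<longlonglongrightarrow> 0"
      using p by real_asymp
    then have lim: "(\<lambda>k. ennreal (F * 2 powr (- (real k + (real CARD('n) - 2) / 2 + 1 / 2) * p'))) \<longlonglongrightarrow> 0"
      using tendsto_ennrealI by fastforce
    \<comment> \<open>The left side does not depend on k, while the bound tends to 0 along the
      exponents supplied by the midpoints.\<close>
    have "Lpow p' ?f \<le> 0"
    proof (rule tendsto_lowerbound[OF lim])
      show "\<forall>\<^sub>F k in sequentially. Lpow p' ?f \<le> ennreal (F * 2 powr (- (real k + (real CARD('n) - 2) / 2 + 1 / 2) * p'))"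
        using eventually_gt_at_top[of 0]
        by (rule eventually_mono) (use key[OF \<rho> half_shift_mem_Lambda[OF dim]] in blast)
    qed simp
    then have "(\<integral>\<^sup>+ x. ennreal (norm (?f x) powr p') \<partial>lborel) = 0" by (simp add: Lpow_def)
    then have "AE x in lborel. ennreal (norm (?f x) powr p') = 0"
      by (subst (asm) nn_integral_0_iff_AE) auto
    then show ?thesis by (rule eventually_mono) auto
  qed
  \<comment> \<open>Countably many annuli exhaust the ball except for its centre, a null
    set.\<close>
  have "AE x in lborel. \<forall>k::nat. indicator (ball 0 (1 / 4) - ball 0 (1 / Suc k)) x *\<^sub>R u x = 0"
    unfolding AE_all_countable by (intro allI AE_annulus) simp
  moreover have "AE x in lborel. x \<noteq> (0::real^'n)"
    by (rule AE_lborel_singleton)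
  ultimately show ?thesis
  proof eventually_elim
    case (elim x)
    show ?case
    proof
      assume x: "x \<in> ball 0 (1 / 4)"
      obtain k where "1 / Suc k < norm x" using nat_approx_posE[of "norm x"] elim(2) by auto
      then have "x \<in> ball 0 (1 / 4) - ball 0 (1 / Suc k)" using x by (simp del: of_nat_Suc)
      then have "indicator (ball 0 (1 / 4) - ball 0 (1 / Suc k)) x *\<^sub>R u x = u x" by (simp del: of_nat_Suc)
      then show "u x = 0" using elim(1) by metis
    qed
  qed
qed

end

section \<open>Borel representatives and uniqueness of weak derivatives\<close>

abbreviation agree_on :: "'a::euclidean_space set \<Rightarrow> ('a \<Rightarrow> 'b) \<Rightarrow> ('a \<Rightarrow> 'b) \<Rightarrow> bool"
  where "agree_on S f g \<equiv> (AE x in lborel. x \<in> S \<longrightarrow> f x = g x)"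

text \<open>Lebesgue measurable real functions have Borel versions; the vector case is assembled
  from the finitely many coordinates.\<close>

lemma exists_borel_representative:
  fixes f :: "'a::euclidean_space \<Rightarrow> 'b::euclidean_space"
  assumes \<Omega>: "\<Omega> \<in> sets borel" and f: "f \<in> borel_measurable (lebesgue_on \<Omega>)"
  obtains f' where "f' \<in> borel_measurable borel" "\<And>x. x \<notin> \<Omega> \<Longrightarrow> f' x = 0"
    "agree_on \<Omega> f' f"
proof -
  have \<Omega>': "\<Omega> \<in> sets lebesgue" using \<Omega> by simp
  let ?F = "\<lambda>x. indicator \<Omega> x *\<^sub>R f x"
  have F: "?F \<in> borel_measurable lebesgue"
    using f \<Omega>' by (subst (asm) borel_measurable_restrict_space_iff) auto
  have "\<exists>g\<in>borel_measurable lborel. (AE x in lborel. ?F x \<bullet> b = g x)" for b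
    by (rule completion_ex_borel_measurable_real) (use F in measurable)
  then obtain g where g: "\<And>b. g b \<in> borel_measurable lborel" "\<And>b. AE x in lborel. ?F x \<bullet> b = g b x" by metis
  define f' where "f' x = indicator \<Omega> x *\<^sub>R (\<Sum>b\<in>Basis. g b x *\<^sub>R b)" for x
  show thesis
  proof (rule that[of f'])
    have [measurable]: "g b \<in> borel_measurable borel" for b using g(1)[of b] by simp
    note \<Omega>[measurable]
    show "f' \<in> borel_measurable borel" unfolding f'_def by measurable
    show "f' x = 0" if "x \<notin> \<Omega>" for x using that by (simp add: f'_def)
    have "AE x in lborel. \<forall>b\<in>Basis. ?F x \<bullet> b = g b x"
      by (intro AE_finite_allI g finite_Basis)
    then show "agree_on \<Omega> f' f"
    proof eventually_elim
      case (elim x)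
      then have "(\<Sum>b\<in>Basis. g b x *\<^sub>R b) = (\<Sum>b\<in>Basis. (?F x \<bullet> b) *\<^sub>R b)" by (intro sum.cong) auto
      also have "\<dots> = ?F x" by (rule euclidean_representation)
      finally show ?case by (simp add: f'_def)
    qed
  qed
qed

lemma nn_integral_representative:
  assumes "\<Omega> \<in> sets borel" "agree_on \<Omega> f' f"
  shows "(\<integral>\<^sup>+ x. G (f x) \<partial>lebesgue_on \<Omega>) = (\<integral>\<^sup>+ x. G (f' x) \<partial>lebesgue_on \<Omega>)"
proof -
  have \<Omega>: "\<Omega> \<in> sets lebesgue" using assms(1) by simp
  show ?thesis
    unfolding nn_integral_lebesgue_on[OF \<Omega>]
  proof (rule nn_integral_cong_AE)
    show "AE x in lborel. G (f x) * indicator \<Omega> x = G (f' x) * indicator \<Omega> x"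
      using assms(2) by eventually_elim (auto simp: indicator_def)
  qed
qed

lemma Lp_norm_representative:
  assumes "\<Omega> \<in> sets borel" "agree_on \<Omega> f' f"
  shows "Lp_norm s \<Omega> f' = Lp_norm s \<Omega> f"
  using nn_integral_representative[OF assms, of "\<lambda>z. ennreal (norm z powr s)"] by (simp add: Lp_norm_def)

lemma Lp_representative:
  fixes f :: "'a::euclidean_space \<Rightarrow> 'b::euclidean_space"
  assumes \<Omega>: "\<Omega> \<in> sets borel" and f: "f \<in> Lp s \<Omega>"
  obtains f' where "f' \<in> borel_measurable borel" "\<And>x. x \<notin> \<Omega> \<Longrightarrow> f' x = 0"
    "agree_on \<Omega> f' f" "Lpow s f' < \<infinity>" "f' \<in> Lp s \<Omega>"
proof -
  have fm: "f \<in> borel_measurable (lebesgue_on \<Omega>)" and fin: "Lp_norm s \<Omega> f < \<infinity>"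
    using f by (auto simp: Lp_def)
  obtain f' where f': "f' \<in> borel_measurable borel" "\<And>x. x \<notin> \<Omega> \<Longrightarrow> f' x = 0"
    "agree_on \<Omega> f' f"
    by (rule exists_borel_representative[OF \<Omega> fm]) (rule that)
  have fin': "Lp_norm s \<Omega> f' < \<infinity>"
    using fin Lp_norm_representative[OF \<Omega> f'(3)] by simp
  moreover have "Lp_norm s \<Omega> f' = (if Lpow s f' = \<infinity> then \<infinity> else ennreal (enn2real (Lpow s f') powr (1 / s)))"
    by (rule Lp_norm_Lpow) (use \<Omega> f' in auto)
  ultimately have "Lpow s f' < \<infinity>" by (auto split: if_splits simp: less_top)
  moreover have "f' \<in> borel_measurable (lebesgue_on \<Omega>)"
    using f'(1) by (intro measurable_restrict_space1 measurable_completion) simp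
  then have "f' \<in> Lp s \<Omega>" using fin' by (simp add: Lp_def)
  ultimately show thesis using that f' by blast
qed

text \<open>On a bounded set L^s lies in L^1, from t \<le> 1 + t^s.\<close>

lemma integrable_of_Lpow:
  fixes f :: "'a::euclidean_space \<Rightarrow> 'b::{banach,second_countable_topology}"
  assumes s: "s \<ge> 1" and [measurable]: "f \<in> borel_measurable borel" and f0: "\<And>x. x \<notin> ball 0 r \<Longrightarrow> f x = 0"
    and fin: "Lpow s f < \<infinity>"
  shows "integrable lborel f"
proof (rule integrableI_bounded)
  have [measurable]: "ball (0::'a) r \<in> sets borel" by simp
  have pt: "t \<le> 1 + t powr s" if "t \<ge> 0" for t :: real
    using powr_mono[of 1 s t] that s by (cases "t \<ge> 1") (auto intro: add_increasing2)
  have "(\<integral>\<^sup>+ x. ennreal (norm (f x)) \<partial>lborel) \<le> (\<integral>\<^sup>+ x. indicator (ball 0 r) x + ennreal (norm (f x) powr s) \<partial>lborel)"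
  proof (rule nn_integral_mono)
    fix x
    show "ennreal (norm (f x)) \<le> indicator (ball 0 r) x + ennreal (norm (f x) powr s)"
      using pt[of "norm (f x)"] f0[of x]
      by (cases "x \<in> ball 0 r") (auto simp flip: ennreal_1 ennreal_plus intro!: ennreal_leI)
  qed
  also have "\<dots> = emeasure lborel (ball (0::'a) r) + Lpow s f"
    by (simp add: nn_integral_add Lpow_def)
  also have "\<dots> < \<infinity>" using fin emeasure_lborel_ball_finite[of "0::'a" r] by (simp add: less_top)
  finally show "(\<integral>\<^sup>+ x. ennreal (norm (f x)) \<partial>lborel) < \<infinity>" .
qed simp

lemma integral_representative:
  fixes f f' :: "'a::euclidean_space \<Rightarrow> 'b::euclidean_space"
  assumes \<Omega>: "\<Omega> \<in> sets borel" and f: "f \<in> borel_measurable (lebesgue_on \<Omega>)"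
    and f': "f' \<in> borel_measurable borel" "agree_on \<Omega> f' f"
    and \<phi>: "\<phi> \<in> borel_measurable borel" "\<And>x. x \<notin> \<Omega> \<Longrightarrow> \<phi> x = (0::real)"
  shows "(\<integral>x. \<phi> x *\<^sub>R f x \<partial>lebesgue_on \<Omega>) = (\<integral>x. \<phi> x *\<^sub>R f' x \<partial>lborel)"
proof -
  have \<Omega>': "\<Omega> \<in> sets lebesgue" using \<Omega> by simp
  have F: "(\<lambda>x. indicator \<Omega> x *\<^sub>R f x) \<in> borel_measurable lebesgue"
    using f \<Omega>' by (subst (asm) borel_measurable_restrict_space_iff) auto
  have \<phi>': "\<phi> \<in> borel_measurable lebesgue" using \<phi>(1) by (intro measurable_completion) simp
  have prod: "(\<lambda>x. \<phi> x *\<^sub>R f' x) \<in> borel_measurable lborel" using \<phi>(1) f'(1) by simp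
  have eq: "indicator \<Omega> x *\<^sub>R (\<phi> x *\<^sub>R f x) = \<phi> x *\<^sub>R (indicator \<Omega> x *\<^sub>R f x)" for x by simp
  have "(\<integral>x. \<phi> x *\<^sub>R f x \<partial>lebesgue_on \<Omega>) = (\<integral>x. \<phi> x *\<^sub>R (indicator \<Omega> x *\<^sub>R f x) \<partial>lebesgue)"
    using \<Omega>' by (simp add: integral_restrict_space eq del: scaleR_scaleR)
  also have "\<dots> = (\<integral>x. \<phi> x *\<^sub>R f' x \<partial>lebesgue)"
  proof (rule integral_cong_AE)
    show "(\<lambda>x. \<phi> x *\<^sub>R (indicator \<Omega> x *\<^sub>R f x)) \<in> borel_measurable lebesgue" using \<phi>' F by (rule borel_measurable_scaleR)
    show "(\<lambda>x. \<phi> x *\<^sub>R f' x) \<in> borel_measurable lebesgue" using prod by (rule measurable_completion)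
    show "AE x in lebesgue. \<phi> x *\<^sub>R (indicator \<Omega> x *\<^sub>R f x) = \<phi> x *\<^sub>R f' x"
      using AE_completion[OF f'(2)] by eventually_elim (use \<phi>(2) in \<open>auto simp: indicator_def\<close>)
  qed
  also have "\<dots> = (\<integral>x. \<phi> x *\<^sub>R f' x \<partial>lborel)" by (rule integral_completion[OF prod])
  finally show ?thesis .
qed

lemma integral_lebesgue_on_subset:
  fixes f :: "'a::euclidean_space \<Rightarrow> 'b::euclidean_space" and \<phi> :: "'a \<Rightarrow> real"
  assumes "S \<in> sets borel" "\<Omega> \<in> sets borel" "S \<subseteq> \<Omega>" "\<And>x. x \<notin> S \<Longrightarrow> \<phi> x = 0"
  shows "(\<integral>x. \<phi> x *\<^sub>R f x \<partial>lebesgue_on \<Omega>) = (\<integral>x. \<phi> x *\<^sub>R f x \<partial>lebesgue_on S)"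
  using assms by (simp add: integral_restrict_space)
    (intro Bochner_Integration.integral_cong refl, auto simp: indicator_def)

lemma test_function_outside: "\<phi> \<in> test_functions \<Omega> \<Longrightarrow> x \<notin> \<Omega> \<Longrightarrow> \<phi> x = 0"
  using test_functionsD(2) by blast

lemma weak_pair_representative:
  fixes u g u' g' :: "real^'n::finite \<Rightarrow> 'b::euclidean_space"
  assumes w: "has_weak_partial \<Omega> i u g" and \<Omega>: "\<Omega> \<in> sets borel"
    and u: "u \<in> borel_measurable (lebesgue_on \<Omega>)" "integrable lborel u'" "agree_on \<Omega> u' u"
    and g: "g \<in> borel_measurable (lebesgue_on \<Omega>)" "integrable lborel g'" "agree_on \<Omega> g' g"
  shows "weak_pair \<Omega> i u' g'"
proof -
  have [measurable]: "u' \<in> borel_measurable borel" "g' \<in> borel_measurable borel" using u(2) g(2) by auto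
  have "(\<integral>x. partial i \<phi> x *\<^sub>R u' x \<partial>lborel) = - (\<integral>x. \<phi> x *\<^sub>R g' x \<partial>lborel)"
    if \<phi>: "\<phi> \<in> test_functions \<Omega>" for \<phi> :: "real^'n \<Rightarrow> real"
  proof -
    note \<phi>' = test_functions_partial[OF \<phi>, of i]
    have "(\<integral>x. partial i \<phi> x *\<^sub>R u x \<partial>lebesgue_on \<Omega>) = (\<integral>x. partial i \<phi> x *\<^sub>R u' x \<partial>lborel)"
      by (rule integral_representative[OF \<Omega> u(1) _ u(3)])
        (use borel_measurable_test_function[OF \<phi>'] test_function_outside[OF \<phi>'] in auto)
    moreover have "(\<integral>x. \<phi> x *\<^sub>R g x \<partial>lebesgue_on \<Omega>) = (\<integral>x. \<phi> x *\<^sub>R g' x \<partial>lborel)"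
      by (rule integral_representative[OF \<Omega> g(1) _ g(3)])
        (use borel_measurable_test_function[OF \<phi>] test_function_outside[OF \<phi>] in auto)
    ultimately show ?thesis using w \<phi> by (simp add: has_weak_partial_def)
  qed
  then show ?thesis using u(2) g(2) by (simp add: weak_pair_def)
qed

text \<open>The fundamental lemma of the calculus of variations. Testing with a cut-off times a
  reflected mollifier shows that every mollification of \<zeta> (f - g) is 0, and these converge to
  it in L^1.\<close>

lemma locally_integrable_unique:
  fixes f g :: "real^'n::finite \<Rightarrow> 'b::euclidean_space"
  assumes f: "locally_integrable (ball 0 1) f" and g: "locally_integrable (ball 0 1) g"
    and eq: "\<And>\<phi> :: real^'n \<Rightarrow> real. \<phi> \<in> test_functions (ball 0 1) \<Longrightarrow>
      (\<integral>x. \<phi> x *\<^sub>R f x \<partial>lebesgue_on (ball 0 1)) = (\<integral>x. \<phi> x *\<^sub>R g x \<partial>lebesgue_on (ball 0 1))"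
  shows "agree_on (ball 0 1) f g"
proof -
  obtain \<eta> :: "nat \<Rightarrow> real^'n \<Rightarrow> real" where ai: "approx_identity \<eta>" and \<eta>: "\<And>k. \<eta> k \<in> test_functions UNIV"
    using exists_smooth_approx_identity by blast
  interpret approx_identity \<eta> by (rule ai)
  have main: "agree_on (ball 0 a) f g" if a: "0 < a" "a < 1" for a
  proof -
    \<comment> \<open>A radius strictly between a and 1: the cut-off lives on a compact ball inside
      the open one, where local integrability becomes integrability.\<close>
    define b where "b = (a + 1) / 2"
    have ab: "a < b" "b < 1" using a by (auto simp: b_def)
    obtain \<zeta> :: "real^'n \<Rightarrow> real" where \<zeta>: "\<And>\<Omega>. cball 0 b \<subseteq> \<Omega> \<Longrightarrow> \<zeta> \<in> test_functions \<Omega>"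
      "\<And>x. norm x < a \<Longrightarrow> \<zeta> x = 1" "\<And>x. norm x > b \<Longrightarrow> \<zeta> x = 0" using exists_cutoff[OF a(1) ab(1)] by metis
    have \<zeta>B: "\<zeta> \<in> test_functions (ball 0 1)" by (rule \<zeta>(1)) (use ab in auto)
    let ?S = "cball 0 b :: (real^'n) set"
    have S: "?S \<in> sets borel" "?S \<in> sets lebesgue" by auto
    have rep: "\<exists>v'. integrable lborel v' \<and> (agree_on ?S v' v) \<and> v \<in> borel_measurable (lebesgue_on ?S)"
      if v: "locally_integrable (ball 0 1) v" for v :: "real^'n \<Rightarrow> 'b"
    proof -
      have "compact ?S" "?S \<subseteq> ball 0 1" using ab by auto
      then have "set_integrable lebesgue ?S v" using v unfolding locally_integrable_def by blast
      then have int: "integrable (lebesgue_on ?S) v"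
        using S by (simp add: integrable_restrict_space set_integrable_def)
      then have vm: "v \<in> borel_measurable (lebesgue_on ?S)" by simp
      obtain v' where v': "v' \<in> borel_measurable borel" "\<And>x. x \<notin> ?S \<Longrightarrow> v' x = 0" "agree_on ?S v' v"
        by (rule exists_borel_representative[OF S(1) vm]) (rule that)
      have "(\<integral>\<^sup>+ x. ennreal (norm (v' x)) \<partial>lborel) = (\<integral>\<^sup>+ x. ennreal (norm (v' x)) \<partial>lebesgue_on ?S)"
        unfolding nn_integral_lebesgue_on[OF S(2)] using v'(2) by (intro nn_integral_cong) (auto simp: indicator_def)
      also have "\<dots> = (\<integral>\<^sup>+ x. ennreal (norm (v x)) \<partial>lebesgue_on ?S)"
        using nn_integral_representative[OF S(1) v'(3), of "\<lambda>z. ennreal (norm z)"] by simp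
      also have "\<dots> < \<infinity>" using int by (simp add: integrable_iff_bounded)
      finally have "integrable lborel v'" using v'(1) by (intro integrableI_bounded) auto
      with v' vm show ?thesis by blast
    qed
    obtain f' where f': "integrable lborel f'" "agree_on ?S f' f" "f \<in> borel_measurable (lebesgue_on ?S)"
      using rep[OF f] by blast
    obtain g' where g': "integrable lborel g'" "agree_on ?S g' g" "g \<in> borel_measurable (lebesgue_on ?S)"
      using rep[OF g] by blast
    have [measurable]: "f' \<in> borel_measurable borel" "g' \<in> borel_measurable borel" using f' g' by auto
    have pair: "(\<integral>x. \<phi> x *\<^sub>R v x \<partial>lebesgue_on (ball 0 1)) = (\<integral>x. \<phi> x *\<^sub>R v' x \<partial>lborel)"
      if "integrable lborel v'" "agree_on ?S v' v" "v \<in> borel_measurable (lebesgue_on ?S)"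
        and \<phi>: "\<phi> \<in> borel_measurable borel" "\<And>x. x \<notin> ?S \<Longrightarrow> \<phi> x = 0" for v v' :: "real^'n \<Rightarrow> 'b" and \<phi> :: "real^'n \<Rightarrow> real"
    proof -
      have "(\<integral>x. \<phi> x *\<^sub>R v x \<partial>lebesgue_on (ball 0 1)) = (\<integral>x. \<phi> x *\<^sub>R v x \<partial>lebesgue_on ?S)"
        by (rule integral_lebesgue_on_subset) (use \<phi>(2) ab in auto)
      also have "\<dots> = (\<integral>x. \<phi> x *\<^sub>R v' x \<partial>lborel)"
        using that by (intro integral_representative) auto
      finally show ?thesis .
    qed
    define w where "w = (\<lambda>x. \<zeta> x *\<^sub>R f' x - \<zeta> x *\<^sub>R g' x)"
    have w_int: "integrable lborel w"
      unfolding w_def by (intro Bochner_Integration.integrable_diff integrable_test_scaleR[OF \<zeta>B] f' g')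
    then have [measurable]: "w \<in> borel_measurable borel" by auto
    have conv0: "conv (\<eta> k) w x = 0" for k x
    proof -
      define \<phi> where "\<phi> y = \<zeta> y *\<^sub>R \<eta> k (x - y)" for y
      have \<phi>: "\<phi> \<in> test_functions (ball 0 1)"
        unfolding \<phi>_def by (rule test_functions_scaleR_smooth[OF \<zeta>B test_functionsD(1)[OF test_functions_reflect[OF \<eta>]]])
      have \<phi>0: "\<phi> y = 0" if "y \<notin> ?S" for y using that \<zeta>(3)[of y] by (simp add: \<phi>_def)
      note \<phi>m = borel_measurable_test_function[OF \<phi>]
      have "conv (\<eta> k) w x = (\<integral>y. \<phi> y *\<^sub>R f' y - \<phi> y *\<^sub>R g' y \<partial>lborel)"
        unfolding conv_def w_def \<phi>_def by (simp add: scaleR_diff_right mult.commute)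
      also have "\<dots> = (\<integral>y. \<phi> y *\<^sub>R f' y \<partial>lborel) - (\<integral>y. \<phi> y *\<^sub>R g' y \<partial>lborel)"
        by (intro Bochner_Integration.integral_diff integrable_test_scaleR[OF \<phi>] f' g')
      also have "\<dots> = 0"
        using pair[OF f' \<phi>m \<phi>0] pair[OF g' \<phi>m \<phi>0] eq[OF \<phi>] by simp
      finally show ?thesis .
    qed
    have "(\<lambda>k. err 1 k w) \<longlonglongrightarrow> 0" by (rule conv_tendsto_L1[OF w_int])
    then have "Lpow 1 w = 0" by (simp add: conv0 Lpow_minus LIMSEQ_const_iff)
    then have "AE x in lborel. w x = 0" by (simp add: Lpow_1 nn_integral_0_iff_AE)
    with f'(2) g'(2) show ?thesis
    proof eventually_elim
      case (elim x)
      show ?case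
      proof
        assume "x \<in> ball 0 a"
        then have "norm x < a" by simp
        then show "f x = g x" using elim ab \<zeta>(2)[of x] by (simp add: w_def)
      qed
    qed
  qed
  \<comment> \<open>The 2 in the denominator keeps the radius positive for
    \<open>k = 0\<close>.\<close>
  have "AE x in lborel. \<forall>k::nat. x \<in> ball 0 (1 - 1 / (real k + 2)) \<longrightarrow> f x = g x"
    unfolding AE_all_countable by (intro allI main) (auto simp: field_simps)
  then show ?thesis
  proof eventually_elim
    case (elim x)
    show ?case
    proof
      assume "x \<in> ball 0 1"
      then have "0 < 1 - norm x" by simp
      then obtain k where k: "1 / real (Suc k) < 1 - norm x" using nat_approx_posE by metis
      have "1 / (real k + 2) \<le> 1 / real (Suc k)" by (simp add: field_simps)
      with k have "x \<in> ball 0 (1 - 1 / (real k + 2))" by simp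
      with elim show "f x = g x" by blast
    qed
  qed
qed

text \<open>Partials of test functions are test functions, so two weak derivatives of
  \<open>u\<close> agree when tested against \<open>partial j \<phi>\<close>. This makes them
  interchangeable for further differentiation without knowing that they agree almost
  everywhere.\<close>

lemma has_weak_partial_transfer:
  fixes u g g' h :: "real^'n::finite \<Rightarrow> 'b::euclidean_space"
  assumes "has_weak_partial \<Omega> i u g" "has_weak_partial \<Omega> i u g'" "has_weak_partial \<Omega> j g h"
  shows "has_weak_partial \<Omega> j g' h"
proof -
  have "(\<integral>x. partial j \<phi> x *\<^sub>R g' x \<partial>lebesgue_on \<Omega>) = (\<integral>x. partial j \<phi> x *\<^sub>R g x \<partial>lebesgue_on \<Omega>)"
    if "\<phi> \<in> test_functions \<Omega>" for \<phi> :: "real^'n \<Rightarrow> real"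
  proof -
    note \<phi>' = test_functions_partial[OF that, of j]
    have "(\<integral>x. partial i (partial j \<phi>) x *\<^sub>R u x \<partial>lebesgue_on \<Omega>) = - (\<integral>x. partial j \<phi> x *\<^sub>R g x \<partial>lebesgue_on \<Omega>)"
      using assms(1) \<phi>' unfolding has_weak_partial_def by blast
    moreover have "(\<integral>x. partial i (partial j \<phi>) x *\<^sub>R u x \<partial>lebesgue_on \<Omega>) = - (\<integral>x. partial j \<phi> x *\<^sub>R g' x \<partial>lebesgue_on \<Omega>)"
      using assms(2) \<phi>' unfolding has_weak_partial_def by blast
    ultimately show ?thesis by simp
  qed
  with assms show ?thesis unfolding has_weak_partial_def by simp
qed

text \<open>\<open>weak_partial\<close> selects an arbitrary weak derivative, which a priori need not be the one in \<open>L\<^sup>p\<close>.\<close>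

lemma weak_partial_eq_AE:
  fixes u g h :: "real^'n::finite \<Rightarrow> 'b::euclidean_space"
  assumes ug: "has_weak_partial (ball 0 1) i u g" and gh: "has_weak_partial (ball 0 1) i g h"
  shows "AE x in lborel. x \<in> ball 0 1 \<longrightarrow> weak_partial (ball 0 1) i (weak_partial (ball 0 1) i u) x = h x"
proof -
  let ?B = "ball 0 1 :: (real^'n) set"
  let ?g = "weak_partial (ball 0 1) i u" and ?h = "weak_partial (ball 0 1) i (weak_partial (ball 0 1) i u)"
  have g: "has_weak_partial (ball 0 1) i u ?g"
    unfolding weak_partial_def by (rule someI[of "has_weak_partial ?B i u", OF ug])
  \<comment> \<open>The second choice is made relative to the first selected derivative, so a
    derivative of that particular function must be shown to exist before the choice can be
    unfolded.\<close>
  have gh': "has_weak_partial (ball 0 1) i ?g h" by (rule has_weak_partial_transfer[OF ug g gh])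
  then have h: "has_weak_partial (ball 0 1) i ?g ?h"
    unfolding weak_partial_def[of _ _ ?g] by (rule someI[of "has_weak_partial ?B i ?g"])
  show ?thesis
  proof (rule locally_integrable_unique)
    show "(\<integral>x. \<phi> x *\<^sub>R ?h x \<partial>lebesgue_on (ball 0 1)) = (\<integral>x. \<phi> x *\<^sub>R h x \<partial>lebesgue_on (ball 0 1))"
      if "\<phi> \<in> test_functions (ball 0 1)" for \<phi> :: "real^'n \<Rightarrow> real"
    proof -
      have "(\<integral>x. partial i \<phi> x *\<^sub>R ?g x \<partial>lebesgue_on ?B) = - (\<integral>x. \<phi> x *\<^sub>R ?h x \<partial>lebesgue_on ?B)"
        using h that unfolding has_weak_partial_def by blast
      moreover have "(\<integral>x. partial i \<phi> x *\<^sub>R ?g x \<partial>lebesgue_on ?B) = - (\<integral>x. \<phi> x *\<^sub>R h x \<partial>lebesgue_on ?B)"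
        using gh' that unfolding has_weak_partial_def by blast
      ultimately show ?thesis by simp
    qed
  qed (use gh' h in \<open>auto simp: has_weak_partial_def\<close>)
qed

lemma vanishes_of_infinite_order_representative:
  assumes v: "vanishes_of_infinite_order u" and eq: "agree_on (ball 0 1) u' u"
  shows "vanishes_of_infinite_order u'"
proof -
  have I: "(\<integral>\<^sup>+ x. ennreal ((norm (u' x))\<^sup>2) \<partial>lebesgue_on (ball 0 r)) = (\<integral>\<^sup>+ x. ennreal ((norm (u x))\<^sup>2) \<partial>lebesgue_on (ball 0 r))"
    if "r < 1" for r
  proof -
    have "agree_on (ball 0 r) u' u"
      using eq by eventually_elim (use that in auto)
    from nn_integral_representative[OF _ this, of "\<lambda>z. ennreal ((norm z)\<^sup>2)"] show ?thesis by simp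
  qed
  obtain \<gamma> where \<gamma>: "0 < \<gamma>" "\<gamma> < 1" and v: "\<And>m::nat. m > 0 \<Longrightarrow> \<exists>c>0. \<forall>r. 0 < r \<and> r < \<gamma> \<longrightarrow>
        ennreal (1 / r ^ m) * (\<integral>\<^sup>+ x. ennreal ((norm (u x))\<^sup>2) \<partial>lebesgue_on (ball 0 r)) \<le> ennreal c"
    using v unfolding vanishes_of_infinite_order_def by blast
  have "\<exists>c>0. \<forall>r. 0 < r \<and> r < \<gamma> \<longrightarrow>
        ennreal (1 / r ^ m) * (\<integral>\<^sup>+ x. ennreal ((norm (u' x))\<^sup>2) \<partial>lebesgue_on (ball 0 r)) \<le> ennreal c" if m: "m > 0" for m :: nat
  proof -
    obtain c where c: "c > 0" "\<And>r. 0 < r \<Longrightarrow> r < \<gamma> \<Longrightarrow>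
        ennreal (1 / r ^ m) * (\<integral>\<^sup>+ x. ennreal ((norm (u x))\<^sup>2) \<partial>lebesgue_on (ball 0 r)) \<le> ennreal c"
      using v[OF m] by blast
    have "ennreal (1 / r ^ m) * (\<integral>\<^sup>+ x. ennreal ((norm (u' x))\<^sup>2) \<partial>lebesgue_on (ball 0 r)) \<le> ennreal c"
      if "0 < r" "r < \<gamma>" for r
      using c(2)[OF that] I[of r] that \<gamma> by simp
    with c(1) show ?thesis by blast
  qed
  with \<gamma> show ?thesis unfolding vanishes_of_infinite_order_def by blast
qed

theorem corollary1p1:
  fixes q u :: "real^'n::finite \<Rightarrow> 'b::{real_normed_field,euclidean_space}"
    and r_star r\<^sub>0 \<theta> :: real
  assumes "CARD('n) \<ge> 3"
    and "carleman_threshold TYPE(real^'n \<Rightarrow> 'b) r_star"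
    and "0 < r\<^sub>0" and "r\<^sub>0 < r_star"
    and "\<theta> > 0"
    and "2 * ennreal \<theta> * (sobolev_const TYPE(real^'n \<Rightarrow> 'b))\<^sup>2 < 1"
    and "q \<in> Lp_cball (real CARD('n) / 2) (ball 0 1) (min r\<^sub>0 \<theta>)"
    and "u \<in> sobolev 2 (exp_p CARD('n)) (ball 0 1)"
    and "AE x in lebesgue_on (ball 0 1). weak_laplacian (ball 0 1) u x + q x * u x = 0"
    and "vanishes_of_infinite_order u"
  shows "AE x in lebesgue_on (ball 0 (1/4)). u x = 0"
proof -
  let ?B = "ball 0 1 :: (real^'n) set"
  let ?p = "exp_p CARD('n)" and ?a = "real CARD('n) / 2"
  note dim = assms(1) and eqn = assms(9)
  have B: "?B \<in> sets borel" by simp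
  have p: "?p \<ge> 1" using dim by (simp add: exp_p_def)
  obtain \<kappa> where \<kappa>: "\<kappa> > 0" "carleman_inequality TYPE(real^'n \<Rightarrow> 'b) r\<^sub>0 \<kappa>"
    using assms(2-4) unfolding carleman_threshold_def by blast
  have q: "q \<in> Lp ?a ?B" and qn: "Lp_norm ?a ?B q \<le> ennreal r\<^sub>0"
    using assms(7) by (auto simp: Lp_cball_def intro: order_trans[OF _ ennreal_leI])
  obtain q' where q': "q' \<in> borel_measurable borel" "\<And>x. x \<notin> ?B \<Longrightarrow> q' x = 0" "agree_on ?B q' q"
    "Lpow ?a q' < \<infinity>" "q' \<in> Lp ?a ?B"
    by (rule Lp_representative[OF B q]) (rule that)
  have q'ball: "q' \<in> Lp_cball ?a ?B r\<^sub>0"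
    using q'(5) qn Lp_norm_representative[OF B q'(3), of ?a] by (simp add: Lp_cball_def)
  have uLp: "u \<in> Lp ?p ?B"
    and "\<forall>i. \<exists>g. g \<in> sobolev (Suc 0) ?p ?B \<and> has_weak_partial ?B i u g"
    using assms(8) by (auto simp: numeral_2_eq_2)
  then obtain g where g: "\<And>i. g i \<in> sobolev (Suc 0) ?p ?B" "\<And>i. has_weak_partial ?B i u (g i)" by metis
  have gLp: "g i \<in> Lp ?p ?B" for i using g(1)[of i] by simp
  have "\<forall>i. \<exists>h. h \<in> Lp ?p ?B \<and> has_weak_partial ?B i (g i) h" using g(1) by auto
  then obtain h where h: "\<And>i. h i \<in> Lp ?p ?B" "\<And>i. has_weak_partial ?B i (g i) (h i)" by metis
  have rep: "\<exists>f'. integrable lborel f' \<and> (agree_on ?B f' f) \<and> Lpow ?p f' < \<infinity>"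
    if "f \<in> Lp ?p ?B" for f :: "real^'n \<Rightarrow> 'b"
  proof -
    obtain f' where f': "f' \<in> borel_measurable borel" "\<And>x. x \<notin> ?B \<Longrightarrow> f' x = 0" "agree_on ?B f' f"
      "Lpow ?p f' < \<infinity>" "f' \<in> Lp ?p ?B"
      by (rule Lp_representative[OF B \<open>f \<in> Lp ?p ?B\<close>]) (rule that)
    then show ?thesis using integrable_of_Lpow[OF p f'(1,2,4)] by blast
  qed
  obtain u' where u': "integrable lborel u'" "agree_on ?B u' u" "Lpow ?p u' < \<infinity>"
    using rep[OF uLp] by blast
  have "\<forall>i. \<exists>f'. integrable lborel f' \<and> (agree_on ?B f' (g i)) \<and> Lpow ?p f' < \<infinity>"
    using rep[OF gLp] by blast
  from choice[OF this] obtain g' where g'_all: "\<forall>i. integrable lborel (g' i) \<and> (agree_on ?B (g' i) (g i)) \<and> Lpow ?p (g' i) < \<infinity>"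
    by (rule exE)
  have g': "integrable lborel (g' i)" "agree_on ?B (g' i) (g i)" "Lpow ?p (g' i) < \<infinity>" for i
    using spec[OF g'_all, of i] by blast+
  have "\<forall>i. \<exists>f'. integrable lborel f' \<and> (agree_on ?B f' (h i)) \<and> Lpow ?p f' < \<infinity>"
    using rep[OF h(1)] by blast
  from choice[OF this] obtain h' where h'_all: "\<forall>i. integrable lborel (h' i) \<and> (agree_on ?B (h' i) (h i)) \<and> Lpow ?p (h' i) < \<infinity>"
    by (rule exE)
  have h': "integrable lborel (h' i)" "agree_on ?B (h' i) (h i)" "Lpow ?p (h' i) < \<infinity>" for i
    using spec[OF h'_all, of i] by blast+
  have meas: "f \<in> borel_measurable (lebesgue_on ?B)" if "f \<in> Lp ?p ?B" for f :: "real^'n \<Rightarrow> 'b"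
    using that by (simp add: Lp_def)
  \<comment> \<open>Everything is instantiated with Borel representatives; the conclusion for
    \<open>u'\<close> returns to \<open>u\<close> because they agree almost everywhere in the
    ball.\<close>
  interpret vanishing_solution u' q' g' h' r\<^sub>0 \<kappa> ?p "exp_p' CARD('n)"
  proof
    show "weak_pair ?B i u' (g' i)" for i
      by (rule weak_pair_representative[OF g(2) B meas[OF uLp] u'(1,2) meas[OF gLp] g'(1,2)])
    show "weak_pair ?B i (g' i) (h' i)" for i
      by (rule weak_pair_representative[OF h(2) B meas[OF gLp] g'(1,2) meas[OF h(1)] h'(1,2)])
    have "AE x in lborel. x \<in> ?B \<longrightarrow> weak_laplacian ?B u x + q x * u x = 0"
      using eqn by (simp add: AE_restrict_space_iff AE_completion_iff)
    \<comment> \<open>The equation is stated for the selected derivatives; uniqueness replaces them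
      by the \<open>h i\<close>, which are known to lie in L^p.\<close>
    moreover have "AE x in lborel. \<forall>i. x \<in> ?B \<longrightarrow> weak_partial ?B i (weak_partial ?B i u) x = h i x"
      unfolding AE_all_countable by (intro allI weak_partial_eq_AE[OF g(2) h(2)])
    moreover have "AE x in lborel. \<forall>i. x \<in> ?B \<longrightarrow> h' i x = h i x"
      unfolding AE_all_countable by (intro allI h'(2))
    ultimately show "AE x in lborel. x \<in> ?B \<longrightarrow> (\<Sum>i\<in>UNIV. h' i x) + q' x * u' x = 0"
      using q'(3) u'(2) by eventually_elim (simp add: weak_laplacian_def)
  qed (fact dim \<kappa> q' q'ball u'(3) g'(3) h'(3) | rule refl)+
  have "vanishes_Lp ?p u'"
    using vanishes_of_infinite_order_representative[OF assms(10) u'(2)] p p_le_2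
    by (intro vanishes_Lp_of_infinite_order) auto
  from vanishes_near_0[OF this] u'(2)
  have "AE x in lborel. x \<in> ball 0 (1 / 4) \<longrightarrow> u x = 0"
    by eventually_elim auto
  then show ?thesis by (simp add: AE_restrict_space_iff AE_completion)
qed

end
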